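(* Let $(\mathbf{G},\boldsymbol{\lambda},\varkappa)$ be a measured groupoid. The following conditions are equivalent: (i) the groupoid $(\mathbf{G},\boldsymbol{\lambda},\varkappa)$ is amenable; (ii) the groupoid admits an equivariant Markov chain with absolutely continuous transition probabilities such that its tail boundary is fibrewise trivial; (iii) the groupoid admits a fibrewise Liouville equivariant Markov chain with absolutely continuous transition probabilities.
   Context: Groupoids. A groupoid $\mathbf{G}$ is a small category in which each morphism is an isomorphism; $X$ is its set of objects and $\mathbf{G}$ also denotes its set of morphisms. The source and target of $g\in\mathbf{G}$ are $\underline{g}\in X$ and $\overline{g}\in X$. The product $gg'$ is defined exactly when $\underline{g}=\overline{g'}$ (set $\mathbf{G}^{(2)}$ of composable pairs), and $\underline{gg'}=\underline{g'}$, $\overline{gg'}=\overline{g}$. Objects $x\in X$ are identified with the identity morphisms $\epsilon_x\in\mathbf{G}$. The target fibre over $x$ is $\mathbf{G}^x=\{g\in\mathbf{G}:\overline{g}=x\}$. Left multiplication by $g$ is a bijection $\mathbf{G}^{\underline{g}}\to\mathbf{G}^{\overline{g}}$, and for a measure $\alpha$ on $\mathbf{G}^{\underline g}$, $g\alpha$ denotes its image under this map. Measured groupoids. All measure spaces are Lebesgue–Rokhlin spaces and all measures are finite or $\sigma$-finite. A groupoid is measurable if its set of morphisms carries a $\sigma$-algebra such that all structure maps (source, target, composition, unit inclusion, inversion) are measurable, where $X$ and $\mathbf{G}^{(2)}$ carry the pullback $\sigma$-algebras under $X\hookrightarrow\mathbf{G}$ and $\mathbf{G}^{(2)}\hookrightarrow\mathbf{G}\times\mathbf{G}$.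 A measurable target fibred system of measures is a family $\{\lambda^x\}_{x\in X}$, $\lambda^x$ a measure on $\mathbf{G}^x$, such that $x\mapsto\langle f,\lambda^x\rangle=\int f\,d\lambda^x$ is measurable for every non-negative measurable $f$ on $\mathbf{G}$. A Haar system is such a system $\boldsymbol{\lambda}=\{\lambda^x\}$ which is left invariant ($g\lambda^{\underline g}=\lambda^{\overline g}$ for all $g\in\mathbf{G}$) and proper (there is a non-negative measurable $f$ on $\mathbf{G}$ with $\langle f,\lambda^x\rangle=1$ for all $x\in X$). For a measure $\varkappa$ on $X$, $\boldsymbol{\lambda}\star\varkappa$ is the measure $\int\lambda^x\,d\varkappa(x)$ on $\mathbf{G}$; $\varkappa$ is quasi-invariant if $g\mapsto g^{-1}$ preserves the $(\boldsymbol{\lambda}\star\varkappa)$-negligible sets. A measured groupoid is a triple $(\mathbf{G},\boldsymbol{\lambda},\varkappa)$ with $\mathbf{G}$ a measurable groupoid, $\boldsymbol{\lambda}$ a Haar system and $\varkappa$ a quasi-invariant measure on $X$. Amenability. $(\mathbf{G},\boldsymbol{\lambda},\varkappa)$ is amenable if there is a sequence of measurable target fibred systems $\{\theta_n^x\}_{x\in X}$ of probability measures, absolutely continuous in the sense that $\theta_n^x\prec\lambda^x$ for all $x\in X$, such that $\int\|g\,\theta_n^{\underline g}-\theta_n^{\overline g}\|\,dm(g)\to0$ as $n\to\infty$ for every probability measure $m\prec\boldsymbol{\lambda}\star\varkappa$, where $\|\cdot\|$ is the total variation norm. Equivariant Markov chains. A Markov chain on $\mathbf{G}$ with a measurable family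 of transition probabilities $\{\pi^g\}_{g\in\mathbf{G}}$ (i.e. $g\mapsto\langle f,\pi^g\rangle$ is measurable for every measurable $f$ on $\mathbf{G}$ for which this makes sense) is equivariant if $\pi^g(\mathbf{G}^{\overline g})=1$ for all $g\in\mathbf{G}$ and $\pi^{gg'}=g\,\pi^{g'}$ for all $(g,g')\in\mathbf{G}^{(2)}$. It has absolutely continuous transition probabilities if $\pi^g\prec\lambda^{\overline g}$ for all $g\in\mathbf{G}$. Its sample paths stay in a single target fibre, so it is a collection of fibrewise Markov chains on the fibres $\mathbf{G}^x$, $x\in X$ (with transition probabilities $\pi^g$, $g\in\mathbf{G}^x$). Boundaries. For a Markov chain on a state space $\Omega$ and a (possibly infinite, $\sigma$-finite) initial measure $m$, let $\mathsf{P}_m$ be the corresponding measure on the path space $\Omega^{\mathbb{Z}_+}$. The tail $\sigma$-algebra is the ($\mathsf{P}_m$-completed) $\sigma$-algebra $\bigcap_{n}\sigma(\omega_n,\omega_{n+1},\dots)$ of paths $(\omega_0,\omega_1,\dots)$; the exit $\sigma$-algebra is its subalgebra of time shift invariant events. The tail boundary (resp. Poisson boundary) is the quotient of the path space determined by the tail (resp. exit) $\sigma$-algebra; it is trivial with respect to $m$ if every event of this $\sigma$-algebra is $\mathsf{P}_m$-negligible or has $\mathsf{P}_m$-negligible complement. A chain is Liouville if its Poisson boundary is trivial (equivalently, it has no non-constant bounded harmonic functions, mod 0). The tail (resp. Poisson) boundary of an equivariant Markov chain is fibrewise trivial if for $\varkappa$-almost every $x\in X$ the tail (resp. Poisson)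 boundary of the fibrewise chain on $\mathbf{G}^x$ is trivial with respect to the initial measure $\lambda^x$. The chain is fibrewise Liouville if its Poisson boundary is fibrewise trivial. *)

theory Defs
  imports "HOL-Probability.Probability"
begin

section \<open>Lebesgue--Rokhlin spaces\<close>

text \<open>
  The sigma-algebras are not completed: a Lebesgue space in Rokhlin's sense is the completion of a
  measure space as defined here.  The sigma-algebra has a countable basis separating the points,
  and off a null set the space is isomorphic to a Borel subset of the line (with the transported
  Borel measure).  Every sigma-finite Borel measure on a standard Borel space qualifies.
\<close>

definition lebesgue_rokhlin :: "'a measure \<Rightarrow> bool" where
  "lebesgue_rokhlin M \<longleftrightarrow>
     sigma_finite_measure M \<and>
     (\<exists>B. countable B \<and> sets M = sigma_sets (space M) B \<and>
        (\<forall>x\<in>space M. \<forall>y\<in>space M. x \<noteq> y \<longrightarrow> (\<exists>b\<in>B. (x \<in> b) \<noteq> (y \<in> b)))) \<and>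
     (\<exists>N\<in>null_sets M. \<exists>f :: 'a \<Rightarrow> real.
        f \<in> borel_measurable (restrict_space M (space M - N)) \<and>
        inj_on f (space M - N) \<and>
        (\<forall>A\<in>sets (restrict_space M (space M - N)). f ` A \<in> sets borel))"


section \<open>Measured groupoids\<close>

text \<open>
  Objects are identified with their identity morphisms.  The field \<open>arrows\<close> is a measurable space:
  its carrier is the set of morphisms, and the values of its measure are never used.
\<close>

record 'g groupoid_structure =
  arrows :: "'g measure"
  objects :: "'g set"
  source :: "'g \<Rightarrow> 'g"
  target :: "'g \<Rightarrow> 'g"
  gmult :: "'g \<Rightarrow> 'g \<Rightarrow> 'g"
  ginv :: "'g \<Rightarrow> 'g"

definition mor :: "'g groupoid_structure \<Rightarrow> 'g set" where
  "mor G = space (arrows G)"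

definition composable :: "'g groupoid_structure \<Rightarrow> ('g \<times> 'g) set" where
  "composable G = {(g, h). g \<in> mor G \<and> h \<in> mor G \<and> source G g = target G h}"

definition fibre :: "'g groupoid_structure \<Rightarrow> 'g \<Rightarrow> 'g set" where
  "fibre G x = {g \<in> mor G. target G g = x}"

locale groupoid =
  fixes G :: "'g groupoid_structure"
  assumes objects_subset: "objects G \<subseteq> mor G"
    and source_object: "g \<in> mor G \<Longrightarrow> source G g \<in> objects G"
    and target_object: "g \<in> mor G \<Longrightarrow> target G g \<in> objects G"
    and source_identity: "x \<in> objects G \<Longrightarrow> source G x = x"
    and target_identity: "x \<in> objects G \<Longrightarrow> target G x = x"
    and mult_closed: "(g, h) \<in> composable G \<Longrightarrow> gmult G g h \<in> mor G"
    and source_mult: "(g, h) \<in> composable G \<Longrightarrow> source G (gmult G g h) = source G h"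
    and target_mult: "(g, h) \<in> composable G \<Longrightarrow> target G (gmult G g h) = target G g"
    and mult_assoc: "(g, h) \<in> composable G \<Longrightarrow> (h, k) \<in> composable G \<Longrightarrow>
      gmult G (gmult G g h) k = gmult G g (gmult G h k)"
    and mult_source: "g \<in> mor G \<Longrightarrow> gmult G g (source G g) = g"
    and target_mult_left: "g \<in> mor G \<Longrightarrow> gmult G (target G g) g = g"
    and inv_closed: "g \<in> mor G \<Longrightarrow> ginv G g \<in> mor G"
    and source_inv: "g \<in> mor G \<Longrightarrow> source G (ginv G g) = target G g"
    and target_inv: "g \<in> mor G \<Longrightarrow> target G (ginv G g) = source G g"
    and mult_inv: "g \<in> mor G \<Longrightarrow> gmult G g (ginv G g) = target G g"
    and inv_mult: "g \<in> mor G \<Longrightarrow> gmult G (ginv G g) g = source G g"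

definition obj_space :: "'g groupoid_structure \<Rightarrow> 'g measure" where
  "obj_space G = restrict_space (arrows G) (objects G)"

locale measurable_groupoid = groupoid +
  assumes source_measurable: "source G \<in> arrows G \<rightarrow>\<^sub>M obj_space G"
    and target_measurable: "target G \<in> arrows G \<rightarrow>\<^sub>M obj_space G"
    and unit_measurable: "(\<lambda>x. x) \<in> obj_space G \<rightarrow>\<^sub>M arrows G"
    and mult_measurable: "(\<lambda>(g, h). gmult G g h)
      \<in> restrict_space (arrows G \<Otimes>\<^sub>M arrows G) (composable G) \<rightarrow>\<^sub>M arrows G"
    and inv_measurable: "ginv G \<in> arrows G \<rightarrow>\<^sub>M arrows G"

text \<open>
  A measure on a target fibre is represented by a measure on the space of all morphisms that is
  concentrated on this fibre.
\<close>

definition fibred_system :: "'g groupoid_structure \<Rightarrow> ('g \<Rightarrow> 'g measure) \<Rightarrow> bool" where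
  "fibred_system G \<alpha> \<longleftrightarrow>
     (\<forall>x\<in>objects G. sets (\<alpha> x) = sets (arrows G) \<and> (AE g in \<alpha> x. g \<in> fibre G x)) \<and>
     (\<forall>f :: 'g \<Rightarrow> ennreal. f \<in> borel_measurable (arrows G) \<longrightarrow>
        (\<lambda>x. \<integral>\<^sup>+ g. f g \<partial>\<alpha> x) \<in> borel_measurable (obj_space G))"

text \<open>
  The measure \<open>g\<alpha>\<close>, for \<open>\<alpha>\<close> concentrated on the fibre over the source of \<open>g\<close>.  The restriction
  matters because \<open>gmult G g\<close> is unspecified off this fibre.
\<close>

definition translate :: "'g groupoid_structure \<Rightarrow> 'g \<Rightarrow> 'g measure \<Rightarrow> 'g measure" where
  "translate G g \<alpha> = distr (restrict_space \<alpha> (fibre G (source G g))) (arrows G) (gmult G g)"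

definition haar_system :: "'g groupoid_structure \<Rightarrow> ('g \<Rightarrow> 'g measure) \<Rightarrow> bool" where
  "haar_system G lam \<longleftrightarrow>
     fibred_system G lam \<and>
     (\<forall>g\<in>mor G. translate G g (lam (source G g)) = lam (target G g)) \<and>
     (\<exists>f :: 'g \<Rightarrow> ennreal. f \<in> borel_measurable (arrows G) \<and>
        (\<forall>x\<in>objects G. (\<integral>\<^sup>+ g. f g \<partial>lam x) = 1))"

definition star_measure ::
    "'g groupoid_structure \<Rightarrow> ('g \<Rightarrow> 'g measure) \<Rightarrow> 'g measure \<Rightarrow> 'g measure" where
  "star_measure G lam kap =
     measure_of (space (arrows G)) (sets (arrows G)) (\<lambda>A. \<integral>\<^sup>+ x. emeasure (lam x) A \<partial>kap)"

definition quasi_invariant ::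
    "'g groupoid_structure \<Rightarrow> ('g \<Rightarrow> 'g measure) \<Rightarrow> 'g measure \<Rightarrow> bool" where
  "quasi_invariant G lam kap \<longleftrightarrow>
     (\<forall>A\<in>null_sets (star_measure G lam kap). ginv G ` A \<in> null_sets (star_measure G lam kap))"

locale measured_groupoid = measurable_groupoid +
  fixes lam :: "'a \<Rightarrow> 'a measure" and kap :: "'a measure"
  assumes haar: "haar_system G lam"
    and sets_kap: "sets kap = sets (obj_space G)"
    and quasi_inv: "quasi_invariant G lam kap"
    and rokhlin_fibres: "x \<in> objects G \<Longrightarrow> lebesgue_rokhlin (lam x)"
    and rokhlin_objects: "lebesgue_rokhlin kap"
    and rokhlin_arrows: "lebesgue_rokhlin (star_measure G lam kap)"


section \<open>Amenability\<close>

definition tv_dist :: "'a measure \<Rightarrow> 'a measure \<Rightarrow> ennreal" where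
  "tv_dist \<alpha> \<beta> =
     (SUP P \<in> {P. finite P \<and> P \<subseteq> sets \<alpha> \<and> partition_on (space \<alpha>) P}.
        ennreal (\<Sum>A\<in>P. \<bar>measure \<alpha> A - measure \<beta> A\<bar>))"

definition amenable ::
    "'g groupoid_structure \<Rightarrow> ('g \<Rightarrow> 'g measure) \<Rightarrow> 'g measure \<Rightarrow> bool" where
  "amenable G lam kap \<longleftrightarrow>
     (\<exists>\<theta> :: nat \<Rightarrow> 'g \<Rightarrow> 'g measure.
        (\<forall>n. fibred_system G (\<theta> n) \<and>
           (\<forall>x\<in>objects G. prob_space (\<theta> n x) \<and> absolutely_continuous (lam x) (\<theta> n x))) \<and>
        (\<forall>m. prob_space m \<and> sets m = sets (arrows G) \<and>
             absolutely_continuous (star_measure G lam kap) m \<longrightarrow>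
           (\<lambda>n. \<integral>\<^sup>+ g. tv_dist (translate G g (\<theta> n (source G g))) (\<theta> n (target G g)) \<partial>m)
             \<longlonglongrightarrow> 0))"


section \<open>Markov chains and their boundaries\<close>

text \<open>
  \<open>chain_from S K y\<close> is the law of the Markov chain with state space \<open>S\<close> and transition kernel \<open>K\<close>
  started at \<open>y\<close>; \<open>path_measure S K m\<close> is its integral against the initial measure \<open>m\<close>, which may
  be infinite.
\<close>

definition chain_from :: "'a measure \<Rightarrow> ('a \<Rightarrow> 'a measure) \<Rightarrow> 'a \<Rightarrow> (nat \<Rightarrow> 'a) measure" where
  "chain_from S K y =
     projective_family.lim UNIV
       (Ionescu_Tulcea.CI
          (\<lambda>n \<omega>. case n of 0 \<Rightarrow> return S y | Suc k \<Rightarrow> K (\<omega> k)) (\<lambda>_. S))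
       (\<lambda>_. S)"

definition path_measure ::
    "'a measure \<Rightarrow> ('a \<Rightarrow> 'a measure) \<Rightarrow> 'a measure \<Rightarrow> (nat \<Rightarrow> 'a) measure" where
  "path_measure S K m = bind m (chain_from S K)"

definition future_sets :: "'a measure \<Rightarrow> nat \<Rightarrow> (nat \<Rightarrow> 'a) set set" where
  "future_sets S n =
     sigma_sets (space (Pi\<^sub>M UNIV (\<lambda>_. S)))
       {(\<lambda>\<omega>. \<omega> k) -` A \<inter> space (Pi\<^sub>M UNIV (\<lambda>_. S)) | k A. n \<le> k \<and> A \<in> sets S}"

text \<open>The second argument is the measure on paths with respect to which one completes.\<close>

definition tail_sets :: "'a measure \<Rightarrow> (nat \<Rightarrow> 'a) measure \<Rightarrow> (nat \<Rightarrow> 'a) set set" where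
  "tail_sets S P =
     {A. A \<subseteq> space P \<and>
        (\<exists>B\<in>(\<Inter>n. future_sets S n). (A - B) \<union> (B - A) \<in> null_sets (completion P))}"

definition exit_sets :: "'a measure \<Rightarrow> (nat \<Rightarrow> 'a) measure \<Rightarrow> (nat \<Rightarrow> 'a) set set" where
  "exit_sets S P = {A \<in> tail_sets S P. (\<lambda>\<omega> n. \<omega> (Suc n)) -` A \<inter> space P = A}"

definition trivial_events :: "'a measure \<Rightarrow> 'a set set \<Rightarrow> bool" where
  "trivial_events P \<A> \<longleftrightarrow>
     (\<forall>A\<in>\<A>. A \<in> null_sets (completion P) \<or> space P - A \<in> null_sets (completion P))"

definition tail_boundary_trivial ::
    "'a measure \<Rightarrow> ('a \<Rightarrow> 'a measure) \<Rightarrow> 'a measure \<Rightarrow> bool" where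
  "tail_boundary_trivial S K m \<longleftrightarrow>
     trivial_events (path_measure S K m) (tail_sets S (path_measure S K m))"

definition poisson_boundary_trivial ::
    "'a measure \<Rightarrow> ('a \<Rightarrow> 'a measure) \<Rightarrow> 'a measure \<Rightarrow> bool" where
  "poisson_boundary_trivial S K m \<longleftrightarrow>
     trivial_events (path_measure S K m) (exit_sets S (path_measure S K m))"


section \<open>Equivariant Markov chains on a groupoid\<close>

definition equivariant_chain :: "'g groupoid_structure \<Rightarrow> ('g \<Rightarrow> 'g measure) \<Rightarrow> bool" where
  "equivariant_chain G \<pi> \<longleftrightarrow>
     \<pi> \<in> arrows G \<rightarrow>\<^sub>M prob_algebra (arrows G) \<and>
     (\<forall>g\<in>mor G. emeasure (\<pi> g) (fibre G (target G g)) = 1) \<and>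
     (\<forall>(g, h)\<in>composable G. \<pi> (gmult G g h) = translate G g (\<pi> h))"

definition abs_cont_transitions ::
    "'g groupoid_structure \<Rightarrow> ('g \<Rightarrow> 'g measure) \<Rightarrow> ('g \<Rightarrow> 'g measure) \<Rightarrow> bool" where
  "abs_cont_transitions G lam \<pi> \<longleftrightarrow>
     (\<forall>g\<in>mor G. absolutely_continuous (lam (target G g)) (\<pi> g))"

definition fibre_space :: "'g groupoid_structure \<Rightarrow> 'g \<Rightarrow> 'g measure" where
  "fibre_space G x = restrict_space (arrows G) (fibre G x)"

definition fibre_chain ::
    "'g groupoid_structure \<Rightarrow> ('g \<Rightarrow> 'g measure) \<Rightarrow> 'g \<Rightarrow> 'g \<Rightarrow> 'g measure" where
  "fibre_chain G \<pi> x g = restrict_space (\<pi> g) (fibre G x)"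

definition fibrewise_tail_trivial ::
    "'g groupoid_structure \<Rightarrow> ('g \<Rightarrow> 'g measure) \<Rightarrow> 'g measure \<Rightarrow> ('g \<Rightarrow> 'g measure) \<Rightarrow> bool" where
  "fibrewise_tail_trivial G lam kap \<pi> \<longleftrightarrow>
     (AE x in kap. tail_boundary_trivial (fibre_space G x) (fibre_chain G \<pi> x)
        (restrict_space (lam x) (fibre G x)))"

definition fibrewise_liouville ::
    "'g groupoid_structure \<Rightarrow> ('g \<Rightarrow> 'g measure) \<Rightarrow> 'g measure \<Rightarrow> ('g \<Rightarrow> 'g measure) \<Rightarrow> bool" where
  "fibrewise_liouville G lam kap \<pi> \<longleftrightarrow>
     (AE x in kap. poisson_boundary_trivial (fibre_space G x) (fibre_chain G \<pi> x)
        (restrict_space (lam x) (fibre G x)))"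

end

theory Submission
  imports Defs
begin

text \<open>
  Liouville implies amenable.  If the Cesaro averages of a fibrewise Liouville chain started at two
  points of a fibre stayed apart, then for every \<open>n\<close> the functions with values in \<open>[0, 1]\<close> which
  separate the two points by \<open>\<delta>\<close> and are harmonic up to \<open>1 / n\<close> would form a nonempty convex set.
  Approximate minimisers of the \<open>L\<^sup>2\<close> norm in these sets converge almost everywhere, and their limit
  is a bounded harmonic function \<open>h\<close> separating the two points.  By orthogonality of martingale increments
  \<open>h\<close> is, along a subsequence, the limit of its values on the sample paths, which is shift invariant
  mod 0, hence constant: a contradiction.  So the Cesaro averages of the transition probabilities
  issued from the objects are asymptotically invariant.

  Amenable implies trivial tail boundary.  As in the construction of Kaimanovich--Vershik and
  Rosenblatt for groups, put \<open>\<pi> = \<Sum>k. 2 ^ -(k + 1) \<alpha>\<^sub>k\<close>, where \<open>\<alpha>\<^sub>k\<close> is the equivariant kernel given by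
  a member of the amenability sequence, chosen so late that for every \<open>m \<le> k\<close> its invariance defects,
  averaged over the products of \<open>j\<close> of the kernels \<open>\<alpha>\<^sub>i\<close>, \<open>i < m\<close>, and summed over \<open>j < N m\<close>, are at
  most \<open>1\<close>.  With \<open>N m\<close> large, a path of length \<open>N m\<close> most likely uses
  some \<open>\<alpha>\<^sub>k\<close> with \<open>k \<ge> m\<close>, and the first such step forgets the starting point.  Hence the
  \<open>N m\<close>-step transition probabilities from almost all points of a fibre merge.  Then the conditional probability of a tail
  event given the path up to time \<open>n\<close> is a constant, so the event is independent of itself.
\<close>

section \<open>Markov chains on the path space\<close>

text \<open>Both implications rest on one effect of absolute continuity: after a single step the
  chain no longer sees null sets. Almost everywhere statements therefore become statements at every
  starting point, provided that averages begin at time 1 and that conditioning happens at positive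
  times. In the first implication the obstacle is to find a limit of Cesaro averages that is a
  genuine function. Convex selection supplies almost everywhere limits, and near-harmonicity
  upgrades them to limits at every point, in particular at the two separated points, which may lie
  in a null set. In the second, amenability controls integrals against any probability measure
  absolutely continuous with respect to \<open>star\<close>. This class is stable under the kernels,
  so defects stay controllable after any fixed number of earlier steps; this permits the recursive
  choice. Mean merging errors of order \<open>(1/2)^m\<close> are summable, whence almost everywhere
  convergence along the whole sequence. Total variation is a supremum over uncountably many
  partitions, so defects are measured on a countable generating algebra, where they are measurable
  and comparable with total variation.\<close>

locale markov_kernel =
  fixes S :: "'a measure" and K :: "'a \<Rightarrow> 'a measure"
  assumes kernel[measurable]: "K \<in> S \<rightarrow>\<^sub>M prob_algebra S"
begin

lemma kernel_subprob[measurable]: "K \<in> S \<rightarrow>\<^sub>M subprob_algebra S"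
  by (rule measurable_prob_algebraD[OF kernel])

lemma prob_space_kernel: "y \<in> space S \<Longrightarrow> prob_space (K y)"
  using measurable_space[OF kernel] by (auto simp: space_prob_algebra)

lemma sets_kernel_eq: "y \<in> space S \<Longrightarrow> sets (K y) = sets S"
  using measurable_space[OF kernel] by (auto simp: space_prob_algebra)

lemma space_kernel_eq: "y \<in> space S \<Longrightarrow> space (K y) = space S"
  using sets_eq_imp_space_eq[OF sets_kernel_eq] .

definition Kop :: "('a \<Rightarrow> ennreal) \<Rightarrow> 'a \<Rightarrow> ennreal" where
  "Kop h y = (\<integral>\<^sup>+z. h z \<partial>K y)"

lemma Kop_measurable[measurable (raw)]:
  "h \<in> borel_measurable S \<Longrightarrow> Kop h \<in> borel_measurable S"
  unfolding Kop_def
  by (rule measurable_compose[OF kernel_subprob nn_integral_measurable_subprob_algebra])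

lemma Kop_cong: "y \<in> space S \<Longrightarrow> (\<And>z. z \<in> space S \<Longrightarrow> f z = g z) \<Longrightarrow> Kop f y = Kop g y"
  unfolding Kop_def by (rule nn_integral_cong) (simp add: space_kernel_eq)

lemma Kop_mono: "y \<in> space S \<Longrightarrow> (\<And>z. z \<in> space S \<Longrightarrow> f z \<le> g z) \<Longrightarrow> Kop f y \<le> Kop g y"
  unfolding Kop_def by (rule nn_integral_mono) (simp add: space_kernel_eq)

lemma Kop_const: "y \<in> space S \<Longrightarrow> Kop (\<lambda>_. c) y = c"
  unfolding Kop_def using prob_space_kernel[THEN prob_space.emeasure_space_1] by simp

lemma measurable_kernel_cong: "y \<in> space S \<Longrightarrow> measurable (K y) M = measurable S M"
  by (rule measurable_cong_sets[OF sets_kernel_eq refl])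

lemma Kop_cmult:
  assumes [measurable]: "f \<in> borel_measurable S" and y: "y \<in> space S"
  shows "Kop (\<lambda>z. c * f z) y = c * Kop f y"
  unfolding Kop_def by (rule nn_integral_cmult) (auto simp: measurable_kernel_cong y)

lemma Kop_funpow_measurable[measurable (raw)]:
  "h \<in> borel_measurable S \<Longrightarrow> (Kop ^^ n) h \<in> borel_measurable S"
  by (induction n) auto

lemma Kop_funpow_const: "y \<in> space S \<Longrightarrow> (Kop ^^ n) (\<lambda>_. c) y = c"
proof (induction n arbitrary: y)
  case (Suc n)
  then have "Kop ((Kop ^^ n) (\<lambda>_. c)) y = Kop (\<lambda>_. c) y" by (intro Kop_cong) auto
  with Suc show ?case by (simp add: Kop_const)
qed simp

lemma Kop_funpow_mono:
  "y \<in> space S \<Longrightarrow> (\<And>z. z \<in> space S \<Longrightarrow> f z \<le> g z) \<Longrightarrow> (Kop ^^ n) f y \<le> (Kop ^^ n) g y"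
  by (induction n arbitrary: y) (auto intro!: Kop_mono)

lemma Kop_funpow_le_1:
  assumes "y \<in> space S" "\<And>z. z \<in> space S \<Longrightarrow> h z \<le> 1" shows "(Kop ^^ n) h y \<le> 1"
  using Kop_funpow_mono[of y h "\<lambda>_. 1" n] assms by (simp add: Kop_funpow_const)

text \<open>The expectation of the product of \<open>f i (\<omega> i)\<close> over
  \<open>i < n\<close> for the chain started at \<open>y\<close>, unfolded from the first
  step.\<close>

primrec cylinder :: "nat \<Rightarrow> (nat \<Rightarrow> 'a \<Rightarrow> ennreal) \<Rightarrow> 'a \<Rightarrow> ennreal" where
  "cylinder 0 f y = 1"
| "cylinder (Suc n) f y = f 0 y * Kop (cylinder n (f \<circ> Suc)) y"

lemma cylinder_measurable[measurable (raw)]: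
  "(\<And>i. f i \<in> borel_measurable S) \<Longrightarrow> cylinder n f \<in> borel_measurable S"
proof (induction n arbitrary: f)
  case (Suc n)
  from Suc.prems have [measurable]: "\<And>i. f i \<in> borel_measurable S" .
  have [measurable]: "cylinder n (f \<circ> Suc) \<in> borel_measurable S"
    by (rule Suc.IH) simp
  show ?case unfolding cylinder.simps by measurable
qed (simp add: cylinder.simps[abs_def])

text \<open>\<open>cylinder\<close> peels factors off at the front, while the Ionescu-Tulcea
  construction adds coordinates at the end. Absorbing the last factor into its predecessor
  reconciles the two.\<close>

lemma cylinder_snoc:
  assumes "y \<in> space S"
  shows "cylinder (Suc (Suc n)) f y =
    cylinder (Suc n) (f(n := (\<lambda>z. f n z * Kop (f (Suc n)) z))) y"
  using assms
proof (induction n arbitrary: f y)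
  case 0
  have "Kop (\<lambda>z. f (Suc 0) z * Kop (\<lambda>_. 1) z) y = Kop (f (Suc 0)) y"
    using 0 by (intro Kop_cong) (auto simp: Kop_const)
  then show ?case using 0 by (simp add: Kop_const comp_def cylinder.simps[abs_def])
next
  case (Suc n)
  have "Kop (cylinder (Suc (Suc n)) (f \<circ> Suc)) y =
    Kop (cylinder (Suc n) ((f \<circ> Suc)(n := (\<lambda>z. (f \<circ> Suc) n z * Kop ((f \<circ> Suc) (Suc n)) z)))) y"
    using Suc.prems by (intro Kop_cong Suc.IH)
  also have "(f \<circ> Suc)(n := (\<lambda>z. (f \<circ> Suc) n z * Kop ((f \<circ> Suc) (Suc n)) z)) =
      f(Suc n := (\<lambda>z. f (Suc n) z * Kop (f (Suc (Suc n))) z)) \<circ> Suc"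
    by (auto simp: fun_eq_iff)
  finally show ?case
    unfolding cylinder.simps(2)[of "Suc (Suc n)" f y]
      cylinder.simps(2)[of "Suc n" "f(Suc n := (\<lambda>z. f (Suc n) z * Kop (f (Suc (Suc n))) z))" y]
    by (simp only: fun_upd_apply nat.distinct if_False)
qed

section \<open>Laws of the chain and integrals of products of coordinates\<close>

definition chain_step :: "'a \<Rightarrow> nat \<Rightarrow> (nat \<Rightarrow> 'a) \<Rightarrow> 'a measure" where
  "chain_step y n \<omega> = (case n of 0 \<Rightarrow> return S y | Suc k \<Rightarrow> K (\<omega> k))"

lemma Ionescu_Tulcea_chain:
  assumes y: "y \<in> space S"
  shows "Ionescu_Tulcea (chain_step y) (\<lambda>_. S)"
proof (rule Ionescu_Tulcea.intro)
  fix n :: nat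
  show "chain_step y n \<in> Pi\<^sub>M {0..<n} (\<lambda>_. S) \<rightarrow>\<^sub>M subprob_algebra S"
  proof (cases n)
    case 0 then show ?thesis using y
      by (auto simp: chain_step_def[abs_def] intro!: measurable_const simp: space_subprob_algebra prob_space_imp_subprob_space prob_space_return)
  next
    case (Suc k)
    have "(\<lambda>\<omega>. \<omega> k) \<in> Pi\<^sub>M {0..<n} (\<lambda>_. S) \<rightarrow>\<^sub>M S"
      by (rule measurable_component_singleton) (simp add: Suc)
    then have "(\<lambda>\<omega>. K (\<omega> k)) \<in> Pi\<^sub>M {0..<n} (\<lambda>_. S) \<rightarrow>\<^sub>M subprob_algebra S"
      by (rule measurable_compose[OF _ kernel_subprob])
    then show ?thesis by (simp add: chain_step_def[abs_def] Suc)
  qed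
next
  fix n :: nat and x :: "nat \<Rightarrow> 'a" assume "x \<in> space (Pi\<^sub>M {0..<n} (\<lambda>_. S))"
  then show "prob_space (chain_step y n x)"
    using y by (cases n) (auto simp: chain_step_def space_PiM prob_space_return intro!: prob_space_kernel)
qed

abbreviation paths :: "(nat \<Rightarrow> 'a) measure" where
  "paths \<equiv> Pi\<^sub>M UNIV (\<lambda>_. S)"

abbreviation chain :: "'a \<Rightarrow> (nat \<Rightarrow> 'a) measure" where
  "chain \<equiv> chain_from S K"

lemma chain_from_eq:
  "chain y = projective_family.lim UNIV (Ionescu_Tulcea.CI (chain_step y) (\<lambda>_. S)) (\<lambda>_. S)"
  by (simp add: chain_from_def chain_step_def[abs_def])

lemma sets_chain: "y \<in> space S \<Longrightarrow> sets (chain y) = sets paths"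
proof -
  assume y: "y \<in> space S"
  interpret IT: Ionescu_Tulcea "chain_step y" "\<lambda>_. S" by (rule Ionescu_Tulcea_chain[OF y])
  show ?thesis unfolding chain_from_eq by (rule IT.PF.sets_lim)
qed

lemma prob_space_chain:
  assumes y: "y \<in> space S" shows "prob_space (chain y)"
proof -
  interpret IT: Ionescu_Tulcea "chain_step y" "\<lambda>_. S" by (rule Ionescu_Tulcea_chain[OF y])
  \<comment> \<open>The total mass is read off from the marginal on the empty set of
    coordinates.\<close>
  have "prob_space (IT.CI {})" by (rule IT.PF.prob_space_P) auto
  then have "prob_space (distr IT.PF.lim (Pi\<^sub>M {} (\<lambda>_. S)) (\<lambda>x. restrict x {}))"
    by (subst IT.distr_lim) auto
  then show ?thesis unfolding chain_from_eq
    by (rule prob_space_distrD[rotated]) (auto simp: space_PiM intro!: measurable_restrict)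
qed

text \<open>Integrating out the last coordinate shortens the product by one factor and modifies the
  factor before it, so \<open>f\<close> has to vary in the induction.\<close>

lemma nn_integral_C_cylinder:
  assumes y: "y \<in> space S" and f: "\<And>i. f i \<in> borel_measurable S"
  shows "(\<integral>\<^sup>+\<omega>. (\<Prod>i<n. f i (\<omega> i)) \<partial>Ionescu_Tulcea.C (chain_step y) (\<lambda>_. S) 0 n (\<lambda>_. undefined)) = cylinder n f y"
proof -
  interpret IT: Ionescu_Tulcea "chain_step y" "\<lambda>_. S" by (rule Ionescu_Tulcea_chain[OF y])
  let ?u = "(\<lambda>_. undefined) :: nat \<Rightarrow> 'a"
  have u: "?u \<in> space (Pi\<^sub>M {0..<0} (\<lambda>_. S))" by (simp add: space_PiM)
  have Pm: "(\<lambda>\<omega>. \<Prod>i<n. g i (\<omega> i)) \<in> borel_measurable (Pi\<^sub>M {0..<n} (\<lambda>_. S))"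
    if "\<And>i. g i \<in> borel_measurable S" for n and g :: "nat \<Rightarrow> 'a \<Rightarrow> ennreal"
    by (intro borel_measurable_prod_ennreal measurable_compose[OF _ that] measurable_component_singleton) auto
  have step: "(\<integral>\<^sup>+\<omega>. (\<Prod>i<Suc n. f i (\<omega> i)) \<partial>IT.C 0 (Suc n) ?u) =
     (\<integral>\<^sup>+\<omega>. (\<Prod>i<n. f i (\<omega> i)) * (\<integral>\<^sup>+z. f n z \<partial>chain_step y n \<omega>) \<partial>IT.C 0 n ?u)"
    if f: "\<And>i. f i \<in> borel_measurable S" for n f
  proof -
    have "(\<integral>\<^sup>+\<omega>. (\<Prod>i<Suc n. f i (\<omega> i)) \<partial>IT.C 0 (Suc n) ?u) =
       (\<integral>\<^sup>+\<omega>. (\<integral>\<^sup>+\<omega>'. (\<Prod>i<Suc n. f i (\<omega>' i)) \<partial>IT.eP n \<omega>) \<partial>IT.C 0 n ?u)"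
      unfolding IT.C.simps add_0
    proof (rule nn_integral_bind[where B="Pi\<^sub>M {0..<Suc n} (\<lambda>_. S)"])
      show "(\<lambda>\<omega>. \<Prod>i<Suc n. f i (\<omega> i)) \<in> borel_measurable (Pi\<^sub>M {0..<Suc n} (\<lambda>_. S))"
        by (rule Pm[OF f])
      have "sets (IT.C 0 n ?u) = sets (Pi\<^sub>M {0..<n} (\<lambda>_. S))"
        using IT.sets_C[OF u, of n] by simp
      then show "IT.eP n \<in> IT.C 0 n ?u \<rightarrow>\<^sub>M subprob_algebra (Pi\<^sub>M {0..<Suc n} (\<lambda>_. S))"
        by (subst measurable_cong_sets[OF _ refl]) (assumption, rule IT.measurable_eP)
    qed
    also have "\<dots> = (\<integral>\<^sup>+\<omega>. (\<integral>\<^sup>+z. (\<Prod>i<Suc n. f i ((fun_upd \<omega> n z) i)) \<partial>chain_step y n \<omega>) \<partial>IT.C 0 n ?u)"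
      using IT.space_C[OF u, of n]
      by (intro nn_integral_cong IT.nn_integral_eP Pm[OF f]) simp
    also have "\<dots> = (\<integral>\<^sup>+\<omega>. (\<Prod>i<n. f i (\<omega> i)) * (\<integral>\<^sup>+z. f n z \<partial>chain_step y n \<omega>) \<partial>IT.C 0 n ?u)"
    proof (intro nn_integral_cong)
      fix \<omega> assume "\<omega> \<in> space (IT.C 0 n ?u)"
      then have \<omega>: "\<omega> \<in> space (Pi\<^sub>M {0..<n} (\<lambda>_. S))" using IT.space_C[OF u, of n] by simp
      have "(\<Prod>i<Suc n. f i ((fun_upd \<omega> n z) i)) = (\<Prod>i<n. f i (\<omega> i)) * f n z" for z
        by simp
      then show "(\<integral>\<^sup>+z. (\<Prod>i<Suc n. f i ((fun_upd \<omega> n z) i)) \<partial>chain_step y n \<omega>) =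
         (\<Prod>i<n. f i (\<omega> i)) * (\<integral>\<^sup>+z. f n z \<partial>chain_step y n \<omega>)"
        using f[of n] IT.sets_P[OF \<omega>]
        by (simp del: prod.lessThan_Suc) (subst nn_integral_cmult, auto cong: measurable_cong_sets)
    qed
    finally show ?thesis .
  qed
  show ?thesis using f
  proof (induction n arbitrary: f)
    case 0 then show ?case by (subst IT.C.simps, subst nn_integral_return) (auto simp: u)
  next
    case (Suc n)
    show ?case
    \<comment> \<open>The first coordinate is drawn from \<open>return S y\<close> and not from
      \<open>K\<close>, so a single factor is a case of its own.\<close>
    proof (cases n)
      case 0
      have "cylinder 0 (f \<circ> Suc) = (\<lambda>_. 1)" by (simp add: fun_eq_iff)
      then have "cylinder (Suc 0) f y = f 0 y" by (simp add: Kop_const y)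
      moreover have "(\<integral>\<^sup>+\<omega>. (\<Prod>i<0. f i (\<omega> i)) * (\<integral>\<^sup>+z. f 0 z \<partial>chain_step y 0 \<omega>) \<partial>IT.C 0 0 ?u) = f 0 y"
        using Suc.prems[of 0] y prob_space.emeasure_space_1[OF IT.prob_space_C[OF u, of 0]]
        by (simp add: chain_step_def nn_integral_return del: IT.C.simps)
      ultimately show ?thesis unfolding 0 step[OF Suc.prems] by simp
    next
      case (Suc k)
      let ?g = "f(k := (\<lambda>z. f k z * Kop (f (Suc k)) z))"
      have g: "?g i \<in> borel_measurable S" for i using Suc.prems by auto
      have "(\<integral>\<^sup>+\<omega>. (\<Prod>i<Suc n. f i (\<omega> i)) \<partial>IT.C 0 (Suc n) ?u) =
        (\<integral>\<^sup>+\<omega>. (\<Prod>i<n. ?g i (\<omega> i)) \<partial>IT.C 0 n ?u)"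
        unfolding step[OF Suc.prems]
        by (intro nn_integral_cong) (simp add: Suc chain_step_def Kop_def mult.assoc)
      also have "\<dots> = cylinder n ?g y" by (rule Suc.IH[OF g])
      also have "\<dots> = cylinder (Suc n) f y"
        unfolding Suc by (rule cylinder_snoc[OF y, symmetric])
      finally show ?thesis .
    qed
  qed
qed

lemma nn_integral_chain_cylinder:
  assumes y: "y \<in> space S" and f: "\<And>i. f i \<in> borel_measurable S"
  shows "(\<integral>\<^sup>+\<omega>. (\<Prod>i<n. f i (\<omega> i)) \<partial>chain y) = cylinder n f y"
proof -
  interpret IT: Ionescu_Tulcea "chain_step y" "\<lambda>_. S" by (rule Ionescu_Tulcea_chain[OF y])
  let ?u = "(\<lambda>_. undefined) :: nat \<Rightarrow> 'a"
  have u: "?u \<in> space (Pi\<^sub>M {0..<0} (\<lambda>_. S))" by (simp add: space_PiM)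
  have Pm: "(\<lambda>\<omega>. \<Prod>i<n. f i (\<omega> i)) \<in> borel_measurable (Pi\<^sub>M {0..<n} (\<lambda>_. S))"
    by (intro borel_measurable_prod_ennreal measurable_compose[OF _ f] measurable_component_singleton) auto
  have upto: "IT.up_to {0..<n} = n"
  proof (rule antisym)
    have iff: "IT.up_to {0..<n} \<le> k \<longleftrightarrow> n \<le> k" for k by (auto simp: IT.up_to_iff_Ico)
    show "IT.up_to {0..<n} \<le> n" "n \<le> IT.up_to {0..<n}" using iff by blast+
  qed
  have "(\<integral>\<^sup>+\<omega>. (\<Prod>i<n. f i (\<omega> i)) \<partial>chain y) =
     (\<integral>\<^sup>+\<omega>. (\<Prod>i<n. f i (\<omega> i)) \<partial>distr (chain y) (Pi\<^sub>M {0..<n} (\<lambda>_. S)) (\<lambda>x. restrict x {0..<n}))"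
    using Pm sets_chain[OF y]
    by (subst nn_integral_distr) (auto cong: measurable_cong_sets intro!: measurable_restrict_subset nn_integral_cong prod.cong)
  also have "distr (chain y) (Pi\<^sub>M {0..<n} (\<lambda>_. S)) (\<lambda>x. restrict x {0..<n}) = IT.CI {0..<n}"
    unfolding chain_from_eq by (rule IT.distr_lim) simp
  also have "IT.CI {0..<n} = distr (IT.C 0 n ?u) (Pi\<^sub>M {0..<n} (\<lambda>_. S)) (\<lambda>x. restrict x {0..<n})"
    unfolding IT.CI_def upto by simp
  also have "(\<integral>\<^sup>+\<omega>. (\<Prod>i<n. f i (\<omega> i)) \<partial>distr (IT.C 0 n ?u) (Pi\<^sub>M {0..<n} (\<lambda>_. S)) (\<lambda>x. restrict x {0..<n})) =
      (\<integral>\<^sup>+\<omega>. (\<Prod>i<n. f i (\<omega> i)) \<partial>IT.C 0 n ?u)"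
    using Pm IT.sets_C[OF u, of n]
    by (subst nn_integral_distr) (auto cong: measurable_cong_sets intro!: measurable_restrict_subset nn_integral_cong prod.cong)
  also have "\<dots> = cylinder n f y" by (rule nn_integral_C_cylinder[OF y f])
  finally show ?thesis .
qed


section \<open>Measurability in the starting point and the Markov property\<close>

lemma prod_algebra_cylinder:
  assumes "X \<in> prod_algebra UNIV (\<lambda>_::nat. S)"
  shows "\<exists>n A. (\<forall>i. A i \<in> sets S) \<and> X = {\<omega>\<in>space paths. \<forall>i<n. \<omega> i \<in> A i}"
proof -
  obtain J E where X: "X = prod_emb UNIV (\<lambda>_::nat. S) J (\<Pi>\<^sub>E j\<in>J. E j)" and J: "finite J"
    and E: "\<And>i. i \<in> J \<Longrightarrow> E i \<in> sets S"
    using prod_algebraE[OF assms] by metis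
  obtain n where n: "J \<subseteq> {..<n}"
    using J finite_nat_iff_bounded by blast
  define A where "A i = (if i \<in> J then E i else space S)" for i
  have "X = {\<omega>\<in>space paths. \<forall>i<n. \<omega> i \<in> A i}"
    using n unfolding X A_def by (auto simp: prod_emb_def space_PiM PiE_iff subset_eq)
  moreover have "A i \<in> sets S" for i using E by (auto simp: A_def)
  ultimately show ?thesis by blast
qed

lemma indicator_cylinder:
  assumes "\<omega> \<in> space paths"
  shows "indicator {\<omega>\<in>space paths. \<forall>i<n. \<omega> i \<in> A i} \<omega> = (\<Prod>i<n. indicator (A i) (\<omega> i) :: ennreal)"
proof (cases "\<forall>i<n. \<omega> i \<in> A i")
  case True
  then have "(\<Prod>i<n. indicator (A i) (\<omega> i) :: ennreal) = 1" by (intro prod.neutral) auto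
  with True assms show ?thesis by simp
next
  case False
  then obtain i where "i < n" "\<omega> i \<notin> A i" by blast
  then have "(\<Prod>i<n. indicator (A i) (\<omega> i) :: ennreal) = 0" by (intro prod_zero) (auto intro!: bexI[of _ i])
  with False show ?thesis by simp
qed

lemma cylinder_sets:
  assumes [measurable]: "\<And>i. A i \<in> sets S"
  shows "{\<omega>\<in>space paths. \<forall>i<n. \<omega> i \<in> A i} \<in> sets paths"
  by measurable

lemma emeasure_cylinder:
  assumes "sets P = sets paths" "\<And>i. A i \<in> sets S"
  shows "emeasure P {\<omega>\<in>space paths. \<forall>i<n. \<omega> i \<in> A i} = (\<integral>\<^sup>+\<omega>. (\<Prod>i<n. indicator (A i) (\<omega> i)) \<partial>P)"
  using assms sets_eq_imp_space_eq[OF assms(1)] cylinder_sets[OF assms(2), where n=n]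
  by (subst nn_integral_indicator[symmetric])
    (auto simp del: nn_integral_indicator intro!: nn_integral_cong indicator_cylinder)

lemma chain_measurable[measurable]: "chain \<in> S \<rightarrow>\<^sub>M prob_algebra paths"
proof (rule measurable_prob_algebra_generated[OF sets_PiM Int_stable_prod_algebra prod_algebra_sets_into_space])
  fix X assume "X \<in> prod_algebra UNIV (\<lambda>_::nat. S)"
  then obtain n A where "\<forall>i. A i \<in> sets S" and X: "X = {\<omega>\<in>space paths. \<forall>i<n. \<omega> i \<in> A i}"
    using prod_algebra_cylinder by blast
  then have A[measurable]: "\<And>i. A i \<in> sets S" by blast
  have "emeasure (chain y) X = cylinder n (\<lambda>i. indicator (A i)) y" if "y \<in> space S" for y
    unfolding X by (subst emeasure_cylinder[OF sets_chain[OF that] A], subst nn_integral_chain_cylinder[OF that]) auto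
  then show "(\<lambda>y. emeasure (chain y) X) \<in> borel_measurable S"
    by (subst measurable_cong) auto
qed (auto simp: prob_space_chain sets_chain)

lemma chain_measurable_subprob[measurable]: "chain \<in> S \<rightarrow>\<^sub>M subprob_algebra paths"
  by (rule measurable_prob_algebraD[OF chain_measurable])

lemma space_chain: "y \<in> space S \<Longrightarrow> space (chain y) = space paths"
  using sets_eq_imp_space_eq[OF sets_chain] .

text \<open>Taking indicators for the \<open>f i\<close> gives agreement on an intersection-stable
  generator. Products of functions are used because \<open>cylinder\<close> computes exactly their
  integrals.\<close>

lemma path_measure_eqI:
  assumes P: "sets P = sets paths" and Q: "sets Q = sets paths" and "finite_measure P"
    and eq: "\<And>n f. (\<And>i. f i \<in> borel_measurable S) \<Longrightarrow>
      (\<integral>\<^sup>+\<omega>. (\<Prod>i<n. f i (\<omega> i)) \<partial>P) = (\<integral>\<^sup>+\<omega>. (\<Prod>i<n. f i (\<omega> i)) \<partial>Q)"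
  shows "P = Q"
proof (rule measure_eqI_PiM_infinite[OF P Q])
  fix A :: "nat \<Rightarrow> 'a set" and J :: "nat set" assume J: "finite J" and A: "\<And>i. i \<in> J \<Longrightarrow> A i \<in> sets S"
  obtain n where n: "J \<subseteq> {..<n}"
    using J finite_nat_iff_bounded by blast
  define B where "B i = (if i \<in> J then A i else space S)" for i
  have X: "prod_emb UNIV (\<lambda>_. S) J (Pi\<^sub>E J A) = {\<omega>\<in>space paths. \<forall>i<n. \<omega> i \<in> B i}"
    using n unfolding B_def by (auto simp: prod_emb_def space_PiM PiE_iff subset_eq)
  have B[measurable]: "B i \<in> sets S" for i using A by (auto simp: B_def)
  show "emeasure P (prod_emb UNIV (\<lambda>_. S) J (Pi\<^sub>E J A)) = emeasure Q (prod_emb UNIV (\<lambda>_. S) J (Pi\<^sub>E J A))"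
    unfolding X emeasure_cylinder[OF P B] emeasure_cylinder[OF Q B] by (rule eq) simp
qed fact

lemma case_nat_measurable[measurable]: "y \<in> space S \<Longrightarrow> case_nat y \<in> paths \<rightarrow>\<^sub>M paths"
  by (rule measurable_case_nat') auto

text \<open>For products of coordinate functions this is the recursion of \<open>cylinder\<close>;
  since such products determine a finite measure on paths, the two laws coincide.\<close>

lemma nn_integral_chain_first_step:
  assumes y: "y \<in> space S" and F[measurable]: "F \<in> borel_measurable paths"
  shows "(\<integral>\<^sup>+\<omega>. F \<omega> \<partial>chain y) = (\<integral>\<^sup>+z. (\<integral>\<^sup>+\<omega>. F (case_nat y \<omega>) \<partial>chain z) \<partial>K y)"
proof -
  note [measurable] = case_nat_measurable[OF y]
  let ?D = "\<lambda>z. distr (chain z) paths (case_nat y)"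
  have D: "?D \<in> S \<rightarrow>\<^sub>M prob_algebra paths"
    by (rule measurable_compose[OF chain_measurable measurable_distr_prob_space]) simp
  have D': "?D \<in> K y \<rightarrow>\<^sub>M subprob_algebra paths"
    unfolding measurable_kernel_cong[OF y] by (rule measurable_prob_algebraD[OF D])
  have Ky: "K y \<in> space (prob_algebra S)" by (rule measurable_space[OF kernel y])
  have int: "(\<integral>\<^sup>+\<omega>. F \<omega> \<partial>(K y \<bind> ?D)) = (\<integral>\<^sup>+z. (\<integral>\<^sup>+\<omega>. F (case_nat y \<omega>) \<partial>chain z) \<partial>K y)"
    if [measurable]: "F \<in> borel_measurable paths" for F
  proof (subst nn_integral_bind[OF that D'], rule nn_integral_cong)
    fix z assume "z \<in> space (K y)"
    then have z: "z \<in> space S" by (simp add: space_kernel_eq y)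
    have "case_nat y \<in> chain z \<rightarrow>\<^sub>M paths"
      using case_nat_measurable[OF y] by (simp add: measurable_cong_sets[OF sets_chain[OF z] refl])
    then show "(\<integral>\<^sup>+\<omega>. F \<omega> \<partial>?D z) = (\<integral>\<^sup>+\<omega>. F (case_nat y \<omega>) \<partial>chain z)"
      using that by (intro nn_integral_distr) auto
  qed
  have "chain y = K y \<bind> ?D"
  proof (rule path_measure_eqI)
    show "sets (K y \<bind> ?D) = sets paths"
      using Ky D by (rule sets_bind')
    show "finite_measure (chain y)"
      using prob_space_chain[OF y] by (simp add: prob_space_def)
    fix n and f :: "nat \<Rightarrow> 'a \<Rightarrow> ennreal" assume f: "\<And>i. f i \<in> borel_measurable S"
    have m: "(\<lambda>\<omega>. \<Prod>i<n. f i (\<omega> i)) \<in> borel_measurable paths"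
      if "\<And>i. f i \<in> borel_measurable S" for n and f :: "nat \<Rightarrow> 'a \<Rightarrow> ennreal"
      by (intro borel_measurable_prod_ennreal measurable_compose[OF _ that] measurable_component_singleton) auto
    show "(\<integral>\<^sup>+\<omega>. (\<Prod>i<n. f i (\<omega> i)) \<partial>chain y) = (\<integral>\<^sup>+\<omega>. (\<Prod>i<n. f i (\<omega> i)) \<partial>(K y \<bind> ?D))"
    proof (cases n)
      case 0
      then show ?thesis
        using prob_space.emeasure_space_1[OF prob_space_chain[OF y]]
          prob_space.emeasure_space_1[OF prob_space_bind'[OF Ky D]] by simp
    next
      case (Suc k)
      have "(\<integral>\<^sup>+\<omega>. (\<Prod>i<n. f i (\<omega> i)) \<partial>(K y \<bind> ?D)) =
          (\<integral>\<^sup>+z. (\<integral>\<^sup>+\<omega>. f 0 y * (\<Prod>i<k. (f \<circ> Suc) i (\<omega> i)) \<partial>chain z) \<partial>K y)"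
        unfolding int[OF m[OF f]] by (simp add: Suc prod.lessThan_Suc_shift del: prod.lessThan_Suc)
      also have "\<dots> = (\<integral>\<^sup>+z. f 0 y * cylinder k (f \<circ> Suc) z \<partial>K y)"
      proof (rule nn_integral_cong)
        fix z assume "z \<in> space (K y)"
        then have z: "z \<in> space S" by (simp add: space_kernel_eq y)
        have "(\<integral>\<^sup>+\<omega>. f 0 y * (\<Prod>i<k. (f \<circ> Suc) i (\<omega> i)) \<partial>chain z) =
           f 0 y * (\<integral>\<^sup>+\<omega>. (\<Prod>i<k. (f \<circ> Suc) i (\<omega> i)) \<partial>chain z)"
          using m[of "f \<circ> Suc" k] f
          by (intro nn_integral_cmult) (simp add: measurable_cong_sets[OF sets_chain[OF z] refl])
        also have "(\<integral>\<^sup>+\<omega>. (\<Prod>i<k. (f \<circ> Suc) i (\<omega> i)) \<partial>chain z) = cylinder k (f \<circ> Suc) z"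
          using f by (intro nn_integral_chain_cylinder z) simp
        finally show "(\<integral>\<^sup>+\<omega>. f 0 y * (\<Prod>i<k. (f \<circ> Suc) i (\<omega> i)) \<partial>chain z) = f 0 y * cylinder k (f \<circ> Suc) z" .
      qed
      also have "\<dots> = cylinder n f y"
        using Kop_cmult[OF cylinder_measurable y, of "f \<circ> Suc" "f 0 y" k] f by (simp add: Suc Kop_def)
      also have "\<dots> = (\<integral>\<^sup>+\<omega>. (\<Prod>i<n. f i (\<omega> i)) \<partial>chain y)"
        by (rule nn_integral_chain_cylinder[OF y f, symmetric])
      finally show ?thesis by simp
    qed
  qed (rule sets_chain[OF y])
  then show ?thesis using int[OF F] by simp
qed

lemma shift_measurable[measurable]: "(\<lambda>\<omega> i. \<omega> (i + n)) \<in> paths \<rightarrow>\<^sub>M paths"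
  by (rule measurable_PiM_single') (auto simp: space_PiM)

lemma nn_integral_chain_measurable[measurable (raw)]:
  "F \<in> borel_measurable paths \<Longrightarrow> (\<lambda>y. \<integral>\<^sup>+\<omega>. F \<omega> \<partial>chain y) \<in> borel_measurable S"
  by (rule measurable_compose[OF chain_measurable_subprob nn_integral_measurable_subprob_algebra])

text \<open>The Markov property at time \<open>n\<close>, with \<open>D\<close> in the role of a
  weight depending on the past. Peeling off the first step turns \<open>D\<close> into
  \<open>D (case_nat y \<omega>)\<close>, which depends on one coordinate less.\<close>

lemma nn_integral_chain_markov:
  assumes "y \<in> space S" and [measurable]: "F \<in> borel_measurable paths" "D \<in> borel_measurable paths"
    and "\<And>\<omega> \<omega>'. (\<And>i. i \<le> n \<Longrightarrow> \<omega> i = \<omega>' i) \<Longrightarrow> D \<omega> = D \<omega>'"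
  shows "(\<integral>\<^sup>+\<omega>. D \<omega> * F (\<lambda>i. \<omega> (i + n)) \<partial>chain y) =
    (\<integral>\<^sup>+\<omega>. D \<omega> * (\<integral>\<^sup>+\<omega>'. F \<omega>' \<partial>chain (\<omega> n)) \<partial>chain y)"
  using assms(1,3,4)
proof (induction n arbitrary: y D)
  case 0
  note [measurable] = case_nat_measurable[OF 0(1)] \<open>D \<in> borel_measurable paths\<close>
  \<comment> \<open>\<open>D\<close> sees only coordinate 0, so the constant path at
    \<open>y\<close> can stand for every path issued from \<open>y\<close>.\<close>
  have c: "D (case_nat y \<omega>) = D (\<lambda>_. y)" for \<omega> by (rule 0(3)) auto
  have *: "(\<integral>\<^sup>+\<omega>. D \<omega> * F \<omega> \<partial>chain y) = D (\<lambda>_. y) * (\<integral>\<^sup>+\<omega>. F \<omega> \<partial>chain y)"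
    if [measurable]: "F \<in> borel_measurable paths" for F
  proof -
    have "(\<integral>\<^sup>+\<omega>. D \<omega> * F \<omega> \<partial>chain y) =
       (\<integral>\<^sup>+z. (\<integral>\<^sup>+\<omega>. D (\<lambda>_. y) * F (case_nat y \<omega>) \<partial>chain z) \<partial>K y)"
      by (subst nn_integral_chain_first_step[OF 0(1)]) (simp_all add: c)
    also have "\<dots> = (\<integral>\<^sup>+z. D (\<lambda>_. y) * (\<integral>\<^sup>+\<omega>. F (case_nat y \<omega>) \<partial>chain z) \<partial>K y)"
      by (intro nn_integral_cong nn_integral_cmult)
        (simp add: space_kernel_eq 0 measurable_cong_sets[OF sets_chain refl])
    also have "\<dots> = D (\<lambda>_. y) * (\<integral>\<^sup>+z. (\<integral>\<^sup>+\<omega>. F (case_nat y \<omega>) \<partial>chain z) \<partial>K y)"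
      by (intro nn_integral_cmult) (simp add: measurable_kernel_cong 0)
    finally show ?thesis by (simp add: nn_integral_chain_first_step[OF 0(1) that])
  qed
  have "(\<integral>\<^sup>+\<omega>. (\<integral>\<^sup>+\<omega>'. F \<omega>' \<partial>chain (\<omega> 0)) \<partial>chain y) = (\<integral>\<^sup>+\<omega>. F \<omega> \<partial>chain y)"
  proof -
    have "(\<lambda>\<omega>. (\<integral>\<^sup>+\<omega>'. F \<omega>' \<partial>chain (\<omega> 0))) \<in> borel_measurable paths" by measurable
    then have "(\<integral>\<^sup>+\<omega>. (\<integral>\<^sup>+\<omega>'. F \<omega>' \<partial>chain (\<omega> 0)) \<partial>chain y) =
       (\<integral>\<^sup>+z. (\<integral>\<^sup>+\<omega>. (\<integral>\<^sup>+\<omega>'. F \<omega>' \<partial>chain y) \<partial>chain z) \<partial>K y)"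
      by (subst nn_integral_chain_first_step[OF 0(1)]) simp_all
    also have "\<dots> = (\<integral>\<^sup>+z. (\<integral>\<^sup>+\<omega>'. F \<omega>' \<partial>chain y) \<partial>K y)"
      using prob_space.emeasure_space_1[OF prob_space_chain]
      by (intro nn_integral_cong) (simp add: space_kernel_eq 0)
    finally show ?thesis
      using prob_space.emeasure_space_1[OF prob_space_kernel[OF 0(1)]] by simp
  qed
  then show ?case using *[of F] *[of "\<lambda>\<omega>. (\<integral>\<^sup>+\<omega>'. F \<omega>' \<partial>chain (\<omega> 0))"] by simp
next
  case (Suc n)
  note [measurable] = case_nat_measurable[OF Suc(2)] \<open>D \<in> borel_measurable paths\<close>
  have [measurable]: "(\<lambda>\<omega>. F (\<lambda>i. \<omega> (Suc (i + n)))) \<in> borel_measurable paths"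
    using measurable_compose[OF shift_measurable[of "Suc n"], of F borel] by simp
  have "(\<integral>\<^sup>+\<omega>. D \<omega> * F (\<lambda>i. \<omega> (i + Suc n)) \<partial>chain y) =
    (\<integral>\<^sup>+z. (\<integral>\<^sup>+\<omega>. D (case_nat y \<omega>) * F (\<lambda>i. \<omega> (i + n)) \<partial>chain z) \<partial>K y)"
    by (subst nn_integral_chain_first_step[OF Suc(2)]) simp_all
  also have "\<dots> = (\<integral>\<^sup>+z. (\<integral>\<^sup>+\<omega>. D (case_nat y \<omega>) * (\<integral>\<^sup>+\<omega>'. F \<omega>' \<partial>chain (\<omega> n)) \<partial>chain z) \<partial>K y)"
  proof (rule nn_integral_cong, rule Suc.IH)
    fix \<omega> \<omega>' :: "nat \<Rightarrow> 'a" assume "\<And>i. i \<le> n \<Longrightarrow> \<omega> i = \<omega>' i"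
    then show "D (case_nat y \<omega>) = D (case_nat y \<omega>')"
      by (intro Suc.prems(3)) (auto split: nat.split)
  qed (simp_all add: space_kernel_eq Suc.prems(1))
  also have "\<dots> = (\<integral>\<^sup>+\<omega>. D \<omega> * (\<integral>\<^sup>+\<omega>'. F \<omega>' \<partial>chain (\<omega> (Suc n))) \<partial>chain y)"
    by (subst nn_integral_chain_first_step[OF Suc(2)]) simp_all
  finally show ?case .
qed

lemma nn_integral_chain_component:
  assumes "y \<in> space S" and [measurable]: "h \<in> borel_measurable S"
  shows "(\<integral>\<^sup>+\<omega>. h (\<omega> n) \<partial>chain y) = (Kop ^^ n) h y"
  using assms(1)
proof (induction n arbitrary: y)
  case 0
  note [measurable] = case_nat_measurable[OF 0]
  have "(\<integral>\<^sup>+\<omega>. h (\<omega> 0) \<partial>chain y) = (\<integral>\<^sup>+z. (\<integral>\<^sup>+\<omega>. h y \<partial>chain z) \<partial>K y)"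
    by (subst nn_integral_chain_first_step[OF 0]) simp_all
  also have "\<dots> = (\<integral>\<^sup>+z. h y \<partial>K y)"
    using prob_space.emeasure_space_1[OF prob_space_chain]
    by (intro nn_integral_cong) (simp add: space_kernel_eq 0)
  finally show ?case
    using prob_space.emeasure_space_1[OF prob_space_kernel[OF 0]] by simp
next
  case (Suc n)
  note [measurable] = case_nat_measurable[OF Suc(2)]
  have "(\<integral>\<^sup>+\<omega>. h (\<omega> (Suc n)) \<partial>chain y) = (\<integral>\<^sup>+z. (\<integral>\<^sup>+\<omega>. h (\<omega> n) \<partial>chain z) \<partial>K y)"
    by (subst nn_integral_chain_first_step[OF Suc(2)]) simp_all
  also have "\<dots> = (\<integral>\<^sup>+z. (Kop ^^ n) h z \<partial>K y)"
    by (intro nn_integral_cong Suc.IH) (simp add: space_kernel_eq Suc)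
  finally show ?case by (simp add: Kop_def[of "(Kop ^^ n) h"])
qed

end

section \<open>Tail events and absolutely continuous kernels\<close>

text \<open>Completion changes a tail event only by a null set, so triviality need be checked on
  uncompleted tail events alone.\<close>

lemma trivial_events_tail_setsI:
  assumes "\<And>B. B \<in> (\<Inter>n. future_sets S n) \<Longrightarrow> B \<in> null_sets P \<or> space P - B \<in> null_sets P"
  shows "trivial_events P (tail_sets S P)"
  unfolding trivial_events_def
proof
  fix A assume "A \<in> tail_sets S P"
  then obtain B where A: "A \<subseteq> space P" and B: "B \<in> (\<Inter>n. future_sets S n)"
    and d: "(A - B) \<union> (B - A) \<in> null_sets (completion P)"
    by (auto simp: tail_sets_def)
  from assms[OF B] show "A \<in> null_sets (completion P) \<or> space P - A \<in> null_sets (completion P)"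
  proof
    assume "B \<in> null_sets P"
    then have "((A - B) \<union> (B - A)) \<union> B \<in> null_sets (completion P)"
      by (intro null_sets.Un[OF d] null_sets_completionI)
    then have "A \<in> null_sets (completion P)"
      by (rule null_sets_completion_subset[rotated]) auto
    then show ?thesis ..
  next
    assume "space P - B \<in> null_sets P"
    then have "((A - B) \<union> (B - A)) \<union> (space P - B) \<in> null_sets (completion P)"
      by (intro null_sets.Un[OF d] null_sets_completionI)
    then have "space P - A \<in> null_sets (completion P)"
      by (rule null_sets_completion_subset[rotated]) auto
    then show ?thesis ..
  qed
qed

context markov_kernel
begin

lemma shift_space: "\<omega> \<in> space paths \<Longrightarrow> (\<lambda>i. \<omega> (i + n)) \<in> space paths"
  by (simp add: space_PiM PiE_iff)

lemma component_space: "\<omega> \<in> space paths \<Longrightarrow> \<omega> n \<in> space S"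
  by (simp add: space_PiM PiE_iff)

lemma future_sets_shift:
  assumes "A \<in> future_sets S n"
  shows "\<exists>B\<in>sets paths. A = {\<omega>\<in>space paths. (\<lambda>i. \<omega> (i + n)) \<in> B}"
  using assms unfolding future_sets_def
proof (induction rule: sigma_sets.induct)
  case (Basic a)
  then obtain k X where k: "n \<le> k" "X \<in> sets S" and a: "a = (\<lambda>\<omega>. \<omega> k) -` X \<inter> space paths"
    by auto
  have "(\<lambda>\<omega>. \<omega> (k - n)) -` X \<inter> space paths \<in> sets paths"
    using k by (intro measurable_sets[of _ paths S]) auto
  moreover have "a = {\<omega>\<in>space paths. (\<lambda>i. \<omega> (i + n)) \<in> (\<lambda>\<omega>. \<omega> (k - n)) -` X \<inter> space paths}"
    using k(1) by (auto simp: a space_PiM)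
  ultimately show ?case by blast
next
  case Empty
  then show ?case by (intro bexI[of _ "{}"]) auto
next
  case (Compl a)
  then obtain B where "B \<in> sets paths" "a = {\<omega>\<in>space paths. (\<lambda>i. \<omega> (i + n)) \<in> B}" by blast
  then show ?case
    by (intro bexI[of _ "space paths - B"]) (auto simp: shift_space)
next
  case (Union a)
  then have "\<forall>i. \<exists>B. B \<in> sets paths \<and> a i = {\<omega>\<in>space paths. (\<lambda>i. \<omega> (i + n)) \<in> B}" by blast
  then obtain B where "\<forall>i. B i \<in> sets paths \<and> a i = {\<omega>\<in>space paths. (\<lambda>i. \<omega> (i + n)) \<in> B i}"
    using choice by meson
  then show ?case by (intro bexI[of _ "\<Union>i. B i"]) auto
qed

lemma shift_in_future_sets:
  assumes "B \<in> sets paths"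
  shows "{\<omega>\<in>space paths. (\<lambda>i. \<omega> (i + n)) \<in> B} \<in> future_sets S n"
proof -
  let ?F = "sigma (space paths) {(\<lambda>\<omega>. \<omega> k) -` A \<inter> space paths | k A. n \<le> k \<and> A \<in> sets S}"
  have "{(\<lambda>\<omega>. \<omega> k) -` A \<inter> space paths | k A. n \<le> k \<and> A \<in> sets S} \<subseteq> Pow (space paths)" by blast
  then have F: "sets ?F = future_sets S n" "space ?F = space paths"
    by (simp_all add: future_sets_def sets_measure_of space_measure_of_conv)
  have "(\<lambda>\<omega> i. \<omega> (i + n)) \<in> ?F \<rightarrow>\<^sub>M paths"
  proof (rule measurable_PiM_single')
    fix i show "(\<lambda>\<omega>. \<omega> (i + n)) \<in> ?F \<rightarrow>\<^sub>M S"
    proof (rule measurableI)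
      fix A assume "A \<in> sets S"
      then show "(\<lambda>\<omega>. \<omega> (i + n)) -` A \<inter> space ?F \<in> sets ?F"
        unfolding F future_sets_def by (intro sigma_sets.Basic CollectI exI[of _ "i + n"] exI[of _ A]) simp
    next
      fix \<omega> assume "\<omega> \<in> space ?F"
      then show "\<omega> (i + n) \<in> space S" unfolding F by (rule component_space)
    qed
  next
    show "(\<lambda>\<omega> i. \<omega> (i + n)) \<in> space ?F \<rightarrow> (\<Pi>\<^sub>E i\<in>UNIV. space S)"
      unfolding F by (auto simp: component_space)
  qed
  from measurable_sets[OF this assms] show ?thesis
    unfolding F by (simp add: vimage_def Int_def conj_commute)
qed

lemma future_sets_subset:
  assumes "A \<in> future_sets S n" shows "A \<in> sets paths"
proof -
  obtain B where [measurable]: "B \<in> sets paths" and A: "A = {\<omega>\<in>space paths. (\<lambda>i. \<omega> (i + n)) \<in> B}"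
    using future_sets_shift[OF assms] by blast
  have "{\<omega>\<in>space paths. (\<lambda>i. \<omega> (i + n)) \<in> B} \<in> sets paths" by measurable
  then show ?thesis unfolding A .
qed

lemma shift_surj:
  assumes "\<omega> \<in> space paths"
  shows "\<exists>\<omega>'\<in>space paths. (\<lambda>i. \<omega>' (i + n)) = \<omega>"
  \<comment> \<open>Truncated subtraction puts \<open>n\<close> copies of the first state in front
    of the path.\<close>
  using assms by (intro bexI[of _ "\<lambda>i. \<omega> (i - n)"]) (auto simp: space_PiM)

lemma emeasure_chain_shift:
  assumes y: "y \<in> space S" and B[measurable]: "B \<in> sets paths"
  shows "emeasure (chain y) {\<omega>\<in>space paths. (\<lambda>i. \<omega> (i + n)) \<in> B} = (Kop ^^ n) (\<lambda>z. emeasure (chain z) B) y"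
proof -
  have m: "{\<omega>\<in>space paths. (\<lambda>i. \<omega> (i + n)) \<in> B} \<in> sets (chain y)"
    unfolding sets_chain[OF y] by measurable
  have "emeasure (chain y) {\<omega>\<in>space paths. (\<lambda>i. \<omega> (i + n)) \<in> B} =
    (\<integral>\<^sup>+\<omega>. 1 * indicator B (\<lambda>i. \<omega> (i + n)) \<partial>chain y)"
    using m space_chain[OF y]
    by (subst nn_integral_indicator[symmetric])
      (auto simp del: nn_integral_indicator intro!: nn_integral_cong split: split_indicator)
  also have "\<dots> = (\<integral>\<^sup>+\<omega>. 1 * (\<integral>\<^sup>+\<omega>'. indicator B \<omega>' \<partial>chain (\<omega> n)) \<partial>chain y)"
    by (rule nn_integral_chain_markov[OF y]) auto
  also have "\<dots> = (\<integral>\<^sup>+\<omega>. emeasure (chain (\<omega> n)) B \<partial>chain y)"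
    by (intro nn_integral_cong) (simp add: space_chain y component_space sets_chain B)
  also have "\<dots> = (Kop ^^ n) (\<lambda>z. emeasure (chain z) B) y"
    by (rule nn_integral_chain_component[OF y]) measurable
  finally show ?thesis .
qed

end

text \<open>\<open>lam\<close> serves as a reference class of null sets and may be infinite.
  Absolute continuity at every \<open>y\<close>, not merely at almost every one, is what allows an
  almost everywhere statement to be used at a given point after one step.\<close>

locale ac_markov_kernel = markov_kernel +
  fixes lam :: "'a measure"
  assumes sets_lam[measurable_cong]: "sets lam = sets S" and space_ne: "space S \<noteq> {}"
    and ac: "y \<in> space S \<Longrightarrow> absolutely_continuous lam (K y)"
begin

lemma space_lam: "space lam = space S"
  using sets_eq_imp_space_eq[OF sets_lam] .

lemma AE_kernel:
  assumes "y \<in> space S" "AE z in lam. P z" shows "AE z in K y. P z"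
  by (rule absolutely_continuous_AE[OF _ ac[OF assms(1)] assms(2)])
    (simp add: sets_lam sets_kernel_eq[OF assms(1)])

lemma sets_path_measure: "sets (path_measure S K lam) = sets paths"
  unfolding path_measure_def
  by (rule sets_bind_measurable) (use space_ne space_lam in \<open>simp_all add: measurable_cong_sets[OF sets_lam refl]\<close>)

lemma space_path_measure: "space (path_measure S K lam) = space paths"
  using sets_eq_imp_space_eq[OF sets_path_measure] .

lemma emeasure_path_measure:
  "A \<in> sets paths \<Longrightarrow> emeasure (path_measure S K lam) A = (\<integral>\<^sup>+y. emeasure (chain y) A \<partial>lam)"
  unfolding path_measure_def
  by (rule emeasure_bind) (use space_ne space_lam in \<open>simp_all add: measurable_cong_sets[OF sets_lam refl]\<close>)

lemma null_sets_path_measure_iff: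
  assumes A[measurable]: "A \<in> sets paths"
  shows "A \<in> null_sets (path_measure S K lam) \<longleftrightarrow> (AE y in lam. emeasure (chain y) A = 0)"
proof -
  have m: "(\<lambda>y. emeasure (chain y) A) \<in> borel_measurable lam"
    unfolding measurable_cong_sets[OF sets_lam refl] by measurable
  have "A \<in> null_sets (path_measure S K lam) \<longleftrightarrow> emeasure (path_measure S K lam) A = 0"
    using A unfolding null_sets_def sets_path_measure by blast
  also have "\<dots> \<longleftrightarrow> (\<integral>\<^sup>+y. emeasure (chain y) A \<partial>lam) = 0"
    by (simp only: emeasure_path_measure[OF A])
  also have "\<dots> \<longleftrightarrow> (AE y in lam. emeasure (chain y) A = 0)"
    by (rule nn_integral_0_iff_AE[OF m])
  finally show ?thesis .
qed

lemma Kop_AE_cong: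
  assumes "y \<in> space S" "AE z in lam. f z = g z" shows "Kop f y = Kop g y"
  unfolding Kop_def by (intro nn_integral_cong_AE AE_kernel assms)

text \<open>One step at least is required: at time 0 the chain sits at \<open>y\<close>, which may
  itself belong to the exceptional null set.\<close>

lemma Kop_funpow_AE_cong:
  assumes "y \<in> space S" "AE z in lam. f z = g z" shows "(Kop ^^ Suc n) f y = (Kop ^^ Suc n) g y"
  using assms(1)
proof (induction n arbitrary: y)
  case 0
  then show ?case using Kop_AE_cong[OF _ assms(2)] by simp
next
  case (Suc n)
  have "Kop ((Kop ^^ Suc n) f) y = Kop ((Kop ^^ Suc n) g) y"
    by (rule Kop_cong) (use Suc in blast)+
  then show ?case by simp
qed

lemma AE_chain_component:
  assumes y: "y \<in> space S" and P: "AE z in lam. P z" and n: "0 < n"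
  shows "AE \<omega> in chain y. P (\<omega> n)"
proof -
  obtain N where N: "N \<in> null_sets lam" "{z\<in>space lam. \<not> P z} \<subseteq> N"
    using P unfolding eventually_ae_filter by blast
  have [measurable]: "N \<in> sets S" using N sets_lam by (auto dest: null_setsD2)
  obtain k where k: "n = Suc k" using n gr0_implies_Suc by blast
  have "(\<integral>\<^sup>+\<omega>. indicator N (\<omega> n) \<partial>chain y) = (Kop ^^ n) (indicator N) y"
    by (rule nn_integral_chain_component[OF y]) measurable
  also have "\<dots> = (Kop ^^ n) (\<lambda>_. 0) y"
    unfolding k using AE_not_in[OF N(1)] by (intro Kop_funpow_AE_cong y) (auto elim!: eventually_mono)
  finally have "(\<integral>\<^sup>+\<omega>. indicator N (\<omega> n) \<partial>chain y) = 0"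
    by (simp add: Kop_funpow_const y)
  moreover have "(\<lambda>\<omega>. indicator N (\<omega> n) :: ennreal) \<in> borel_measurable (chain y)"
    unfolding measurable_cong_sets[OF sets_chain[OF y] refl] by measurable
  ultimately have "AE \<omega> in chain y. indicator N (\<omega> n) = (0::ennreal)"
    using nn_integral_0_iff_AE by blast
  with AE_space show ?thesis
  proof eventually_elim
    case (elim \<omega>)
    then have "\<omega> n \<in> space lam" "\<omega> n \<notin> N"
      by (auto simp: indicator_def space_chain y space_PiM space_lam split: if_splits)
    then show ?case using N by blast
  qed
qed

text \<open>The constant \<open>c\<close> may depend on \<open>h\<close> and \<open>m\<close> but
  serves all starting points. A tail event yields functions \<open>h n\<close> with
  \<open>h n = (Kop ^^ k) (h (n + k))\<close>, so each is an \<open>N m\<close>-step average of a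
  later one and hence almost constant; a zero-one argument concludes.\<close>

theorem tail_boundary_trivialI:
  fixes e :: "nat \<Rightarrow> 'a \<Rightarrow> ennreal" and N :: "nat \<Rightarrow> nat"
  assumes e: "AE y in lam. (\<lambda>m. e m y) \<longlonglongrightarrow> 0"
    and bound: "\<And>m h. h \<in> borel_measurable S \<Longrightarrow> (\<And>z. z \<in> space S \<Longrightarrow> h z \<le> 1) \<Longrightarrow>
      \<exists>c. \<forall>y\<in>space S. (Kop ^^ N m) h y \<le> c + e m y \<and> c \<le> (Kop ^^ N m) h y + e m y"
  shows "tail_boundary_trivial S K lam"
  unfolding tail_boundary_trivial_def
proof (rule trivial_events_tail_setsI)
  fix B assume B: "B \<in> (\<Inter>n. future_sets S n)"
  let ?P = "path_measure S K lam"
  have Bs[measurable]: "B \<in> sets paths" using B future_sets_subset by blast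
  have Bsp: "B \<subseteq> space paths" using sets.sets_into_space[OF Bs] .
  have "\<forall>n. \<exists>X. X \<in> sets paths \<and> B = {\<omega>\<in>space paths. (\<lambda>i. \<omega> (i + n)) \<in> X}"
  proof
    fix n
    have "B \<in> future_sets S n" using B by blast
    then show "\<exists>X. X \<in> sets paths \<and> B = {\<omega>\<in>space paths. (\<lambda>i. \<omega> (i + n)) \<in> X}"
      using future_sets_shift by blast
  qed
  then obtain X where XB: "\<forall>n. X n \<in> sets paths \<and> B = {\<omega>\<in>space paths. (\<lambda>i. \<omega> (i + n)) \<in> X n}"
    using choice by meson
  have X[measurable]: "X n \<in> sets paths" and BX: "B = {\<omega>\<in>space paths. (\<lambda>i. \<omega> (i + n)) \<in> X n}" for n
    using XB by blast+
  \<comment> \<open>Surjectivity of the shift makes the event \<open>X n\<close> of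
    time-\<open>n\<close> futures unique, so the events for different times are consistent.\<close>
  have XX: "X n = {\<omega>\<in>space paths. (\<lambda>i. \<omega> (i + k)) \<in> X (n + k)}" for n k
  proof (intro set_eqI)
    fix \<omega> show "\<omega> \<in> X n \<longleftrightarrow> \<omega> \<in> {\<omega>\<in>space paths. (\<lambda>i. \<omega> (i + k)) \<in> X (n + k)}"
    proof (cases "\<omega> \<in> space paths")
      case True
      then obtain \<omega>' where \<omega>': "\<omega>' \<in> space paths" "(\<lambda>i. \<omega>' (i + n)) = \<omega>" using shift_surj by blast
      then have "\<omega> \<in> X n \<longleftrightarrow> \<omega>' \<in> B" by (subst BX[of n]) simp
      also have "\<dots> \<longleftrightarrow> (\<lambda>i. \<omega>' (i + (n + k))) \<in> X (n + k)" using \<omega>' by (subst BX[of "n + k"]) simp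
      also have "(\<lambda>i. \<omega>' (i + (n + k))) = (\<lambda>i. \<omega> (i + k))"
        unfolding \<omega>'(2)[symmetric] by (simp add: ac_simps)
      finally show ?thesis using True by simp
    next
      case False
      then show ?thesis using sets.sets_into_space[OF X[of n]] by auto
    qed
  qed
  define h where "h n z = emeasure (chain z) (X n)" for n z
  have h_meas[measurable]: "h n \<in> borel_measurable S" for n unfolding h_def by measurable
  have h_le: "h n z \<le> 1" if "z \<in> space S" for n z
    unfolding h_def by (intro prob_space.measure_le_1 prob_space_chain that)
  have h_Kop: "h n z = (Kop ^^ k) (h (n + k)) z" if "z \<in> space S" for n k z
    using emeasure_chain_shift[OF that X, where n=k] XX[of n k] by (simp add: h_def[abs_def])
  \<comment> \<open>Both values are averages over \<open>N m\<close> steps of the same function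
    \<open>h (n + N m)\<close>, hence within \<open>e m y + e m z\<close> of each other through the
    common constant.\<close>
  have h_le': "h n y \<le> h n z"
    if y: "y \<in> space S" and z: "z \<in> space S" and ey: "(\<lambda>m. e m y) \<longlonglongrightarrow> 0" and ez: "(\<lambda>m. e m z) \<longlonglongrightarrow> 0" for y z n
  proof (rule LIMSEQ_le_const)
    show "(\<lambda>m. h n z + e m z + e m y) \<longlonglongrightarrow> h n z"
      using tendsto_add[OF tendsto_add[OF tendsto_const ez] ey, of "h n z"] by simp
    have "h n y \<le> h n z + e m z + e m y" for m
    proof -
      obtain c where c: "\<forall>y\<in>space S. (Kop ^^ N m) (h (n + N m)) y \<le> c + e m y \<and> c \<le> (Kop ^^ N m) (h (n + N m)) y + e m y"
        using bound[OF h_meas h_le] by blast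
      have "h n y \<le> c + e m y" "c \<le> h n z + e m z"
        using c y z h_Kop[OF y, of n "N m"] h_Kop[OF z, of n "N m"] by auto
      then show ?thesis by (meson add_right_mono order_trans)
    qed
    then show "\<exists>M. \<forall>m\<ge>M. h n y \<le> h n z + e m z + e m y" by blast
  qed
  have XB: "X 0 = B" using XX[of 0 0] BX[of 0] by simp
  show "B \<in> null_sets ?P \<or> space ?P - B \<in> null_sets ?P"
  \<comment> \<open>If the errors vanish at no point, then \<open>e\<close> forces
    \<open>lam\<close> to be the zero measure and every event is null.\<close>
  proof (cases "\<exists>y\<in>space S. (\<lambda>m. e m y) \<longlonglongrightarrow> 0")
    case False
    from e have "AE y in lam. emeasure (chain y) B = 0"
      using AE_space by eventually_elim (use False space_lam in auto)
    then show ?thesis by (simp add: null_sets_path_measure_iff)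
  next
    case True
    then obtain y where y: "y \<in> space S" "(\<lambda>m. e m y) \<longlonglongrightarrow> 0" by blast
    interpret C: prob_space "chain y" by (rule prob_space_chain[OF y(1)])
    define c where "c = h 0 y"
    have hy: "AE z in lam. h n z = h n y" for n
      using e AE_space
      by eventually_elim (use h_le' y space_lam in \<open>auto intro!: antisym\<close>)
    \<comment> \<open>Off a null set \<open>h (Suc n)\<close> is constant, and averaging it over
      \<open>Suc n\<close> steps from \<open>y\<close> gives \<open>h 0 y\<close>; so the constant
      does not depend on the time.\<close>
    have c: "h (Suc n) y = c" for n
    proof -
      have "c = (Kop ^^ Suc n) (h (Suc n)) y"
        unfolding c_def using h_Kop[OF y(1), of 0 "Suc n"] by simp
      also have "\<dots> = (Kop ^^ Suc n) (\<lambda>_. h (Suc n) y) y"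
        by (rule Kop_funpow_AE_cong[OF y(1) hy])
      also have "\<dots> = h (Suc n) y" by (rule Kop_funpow_const[OF y(1)])
      finally show ?thesis ..
    qed
    note [measurable_cong] = sets_chain[OF y(1)]
    \<comment> \<open>Under \<open>chain y\<close> the event is independent of each finite initial
      piece of the path. Conditioning is at time \<open>Suc n\<close>, since
      \<open>h (Suc n)\<close> is constant only off a null set and a positive time avoids that set.
      Evaluating both densities on \<open>B\<close> gives \<open>c = c * c\<close>.\<close>
    have "density (chain y) (indicator B) = density (chain y) (\<lambda>_. c)"
    proof (rule path_measure_eqI)
      show "finite_measure (density (chain y) (indicator B))"
        by (rule C.finite_measure_restricted) (simp add: sets_chain[OF y(1)] Bs)
      fix n and f :: "nat \<Rightarrow> 'a \<Rightarrow> ennreal" assume f: "\<And>i. f i \<in> borel_measurable S"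
      let ?D = "\<lambda>\<omega>. \<Prod>i<n. f i (\<omega> i)"
      have D[measurable]: "?D \<in> borel_measurable paths"
        by (intro borel_measurable_prod_ennreal measurable_compose[OF _ f] measurable_component_singleton) auto
      have "(\<integral>\<^sup>+\<omega>. ?D \<omega> \<partial>density (chain y) (indicator B)) = (\<integral>\<^sup>+\<omega>. indicator B \<omega> * ?D \<omega> \<partial>chain y)"
        by (rule nn_integral_density) measurable
      also have "\<dots> = (\<integral>\<^sup>+\<omega>. ?D \<omega> * indicator (X (Suc n)) (\<lambda>i. \<omega> (i + Suc n)) \<partial>chain y)"
      proof (rule nn_integral_cong)
        fix \<omega> assume "\<omega> \<in> space (chain y)"
        then have "\<omega> \<in> B \<longleftrightarrow> (\<lambda>i. \<omega> (i + Suc n)) \<in> X (Suc n)"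
          by (subst BX[of "Suc n"]) (simp add: space_chain y)
        then show "indicator B \<omega> * ?D \<omega> = ?D \<omega> * indicator (X (Suc n)) (\<lambda>i. \<omega> (i + Suc n))"
          by (simp add: indicator_def)
      qed
      also have "\<dots> = (\<integral>\<^sup>+\<omega>. ?D \<omega> * (\<integral>\<^sup>+\<omega>'. indicator (X (Suc n)) \<omega>' \<partial>chain (\<omega> (Suc n))) \<partial>chain y)"
        by (rule nn_integral_chain_markov[OF y(1)]) (auto intro!: prod.cong)
      also have "\<dots> = (\<integral>\<^sup>+\<omega>. c * ?D \<omega> \<partial>chain y)"
      proof (rule nn_integral_cong_AE)
        have "AE \<omega> in chain y. h (Suc n) (\<omega> (Suc n)) = c"
          using AE_chain_component[OF y(1) hy[of "Suc n"], of "Suc n"] by (simp add: c)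
        with AE_space show "AE \<omega> in chain y. ?D \<omega> * (\<integral>\<^sup>+\<omega>'. indicator (X (Suc n)) \<omega>' \<partial>chain (\<omega> (Suc n))) = c * ?D \<omega>"
        proof eventually_elim
          case (elim \<omega>)
          then have "\<omega> (Suc n) \<in> space S" by (simp add: space_chain y component_space)
          then show ?case using elim by (simp add: h_def sets_chain X mult.commute)
        qed
      qed
      also have "\<dots> = (\<integral>\<^sup>+\<omega>. ?D \<omega> \<partial>density (chain y) (\<lambda>_. c))"
        by (rule nn_integral_density[symmetric]) measurable
      finally show "(\<integral>\<^sup>+\<omega>. ?D \<omega> \<partial>density (chain y) (indicator B)) = (\<integral>\<^sup>+\<omega>. ?D \<omega> \<partial>density (chain y) (\<lambda>_. c))" .
    qed (simp_all add: sets_chain y)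
    then have "emeasure (density (chain y) (indicator B)) B = emeasure (density (chain y) (\<lambda>_. c)) B" by simp
    moreover have "(\<integral>\<^sup>+x. indicator B x * indicator B x \<partial>chain y) = emeasure (chain y) B"
      by (simp add: indicator_inter_arith[symmetric] sets_chain[OF y(1)] Bs)
    ultimately have "c = c * c"
      using sets_chain[OF y(1)] by (simp add: emeasure_density nn_integral_cmult c_def h_def XB)
    moreover have "c \<noteq> top" using h_le[OF y(1), of 0] by (auto simp: c_def top_unique)
    ultimately have "c = 0 \<or> c = 1"
      by (cases c rule: ennreal_cases) (auto simp flip: ennreal_mult simp: ennreal_eq_1)
    then show ?thesis
    proof
      assume "c = 0"
      then show ?thesis using hy[of 0] by (simp add: null_sets_path_measure_iff h_def XB c_def)
    next
      assume "c = 1"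
      have "AE z in lam. emeasure (chain z) (space paths - B) = 0"
        using hy[of 0] AE_space
      proof eventually_elim
        case (elim z)
        then have z: "z \<in> space S" using space_lam by simp
        interpret Cz: prob_space "chain z" by (rule prob_space_chain[OF z])
        have "emeasure (chain z) B = 1" using elim \<open>c = 1\<close> by (simp add: h_def XB c_def)
        then show ?case
          using emeasure_compl[of B "chain z"] Cz.emeasure_space_1 by (simp add: sets_chain space_chain z Bs)
      qed
      then show ?thesis by (simp add: null_sets_path_measure_iff space_path_measure)
    qed
  qed
qed

end

section \<open>Bounded harmonic functions\<close>

text \<open>With weights \<open>2^k\<close> the expectations are still summable, so the sum of
  \<open>2^k * (v k x)\<^sup>2\<close> is finite almost everywhere; the inequality of means bounds
  \<open>\<bar>v k x\<bar>\<close> by \<open>(1/2)^k + 2^k * (v k x)\<^sup>2\<close>. This converts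
  fast mean square convergence of a sequence into almost everywhere convergence.\<close>

lemma (in prob_space) AE_summable_of_square_integrals:
  fixes v :: "nat \<Rightarrow> 'a \<Rightarrow> real"
  assumes int: "\<And>k. integrable M (\<lambda>x. (v k x)\<^sup>2)" and le: "\<And>k. (\<integral>x. (v k x)\<^sup>2 \<partial>M) \<le> C * (1/4)^k"
  shows "AE x in M. summable (\<lambda>k. \<bar>v k x\<bar>)"
proof -
  have le': "2^k * (\<integral>x. (v k x)\<^sup>2 \<partial>M) \<le> C * (1/2)^k" for k
  proof -
    have "2^k * (\<integral>x. (v k x)\<^sup>2 \<partial>M) \<le> 2^k * (C * (1/4)^k)"
      using le[of k] by (intro mult_left_mono) auto
    also have "\<dots> = C * (1/2)^k"
      by (simp add: power_divide field_simps flip: power_mult_distrib)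
    finally show ?thesis .
  qed
  have meas: "(\<lambda>x. ennreal (2^k * (v k x)\<^sup>2)) \<in> borel_measurable M" for k
    using borel_measurable_integrable[OF int[of k]] by measurable
  have "(\<integral>\<^sup>+x. (\<Sum>k. ennreal (2^k * (v k x)\<^sup>2)) \<partial>M) = (\<Sum>k. \<integral>\<^sup>+x. ennreal (2^k * (v k x)\<^sup>2) \<partial>M)"
    by (rule nn_integral_suminf[OF meas])
  also have "\<dots> = (\<Sum>k. ennreal (2^k * (\<integral>x. (v k x)\<^sup>2 \<partial>M)))"
    using int by (intro suminf_cong, subst nn_integral_eq_integral) auto
  also have "\<dots> \<le> (\<Sum>k. ennreal (C * (1/2)^k))"
    by (intro suminf_le ennreal_leI le') auto
  also have "\<dots> = ennreal (\<Sum>k. C * (1/2)^k)"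
  proof (rule suminf_ennreal2)
    show "0 \<le> C * (1/2)^k" for k
      by (rule order_trans[OF _ le'[of k]]) simp
  qed (intro summable_mult summable_geometric, simp)
  finally have "(\<integral>\<^sup>+x. (\<Sum>k. ennreal (2^k * (v k x)\<^sup>2)) \<partial>M) \<noteq> \<infinity>"
    by (auto simp: top_unique)
  then have "AE x in M. (\<Sum>k. ennreal (2^k * (v k x)\<^sup>2)) \<noteq> \<infinity>"
    using meas by (intro nn_integral_PInf_AE) auto
  then show ?thesis
  proof eventually_elim
    case (elim x)
    then have "summable (\<lambda>k. 2^k * (v k x)\<^sup>2)"
      by (intro summable_suminf_not_top) auto
    then have s: "summable (\<lambda>k. (1/2)^k + 2^k * (v k x)\<^sup>2)"
      by (intro summable_add summable_geometric) auto
    show ?case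
    proof (rule summable_comparison_test'[OF s])
      fix k
      define a :: real where "a = 2^k"
      have a: "a > 0" by (simp add: a_def)
      have "0 \<le> (a * \<bar>v k x\<bar> - 1/2)\<^sup>2" by simp
      then have "a * \<bar>v k x\<bar> \<le> 1 + a * (a * (v k x)\<^sup>2)"
        by (simp add: power2_eq_square algebra_simps)
      then have "\<bar>v k x\<bar> \<le> (1 + a * (a * (v k x)\<^sup>2)) / a"
        using a by (simp add: field_simps)
      also have "\<dots> = (1/2)^k + 2^k * (v k x)\<^sup>2"
        using a unfolding a_def by (simp add: field_simps)
      finally show "norm \<bar>v k x\<bar> \<le> (1/2)^k + 2^k * (v k x)\<^sup>2" by simp
    qed
  qed
qed

lemma convergent_if_summable_diff:
  fixes u :: "nat \<Rightarrow> real"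
  assumes "summable (\<lambda>k. \<bar>u (Suc k) - u k\<bar>)"
  shows "convergent u"
proof -
  have "summable (\<lambda>k. u (Suc k) - u k)" using assms by (rule summable_rabs_cancel)
  then have "(\<lambda>n. \<Sum>k<n. u (Suc k) - u k) \<longlonglongrightarrow> (\<Sum>k. u (Suc k) - u k)"
    by (rule summable_LIMSEQ)
  then have "(\<lambda>n. u n - u 0) \<longlonglongrightarrow> (\<Sum>k. u (Suc k) - u k)"
    by (simp add: sum_lessThan_telescope)
  from tendsto_add[OF this tendsto_const[of "u 0"]] show ?thesis
    by (auto simp: convergent_def)
qed

lemma (in prob_space) integrable_unit_interval:
  fixes u :: "'a \<Rightarrow> real"
  assumes "u \<in> borel_measurable M" "\<And>x. x \<in> space M \<Longrightarrow> \<bar>u x\<bar> \<le> 1"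
  shows "integrable M u"
  by (rule integrable_const_bound[of _ 1]) (use assms in \<open>auto intro!: AE_I2\<close>)

lemma integral_eq_enn2real:
  assumes "f \<in> borel_measurable M" "\<And>x. x \<in> space M \<Longrightarrow> 0 \<le> f x"
  shows "(\<integral>x. f x \<partial>M) = enn2real (\<integral>\<^sup>+x. ennreal (f x) \<partial>M)"
  using assms by (intro integral_eq_nn_integral AE_I2)

text \<open>Approximate minimisers of the \<open>L\<^sup>2\<close> norm form a Cauchy sequence by the parallelogram law.\<close>

lemma (in prob_space) convex_sets_AE_convergent_selection:
  fixes U :: "nat \<Rightarrow> ('a \<Rightarrow> real) set"
  assumes ne: "\<And>j. U j \<noteq> {}" and dec: "decseq U"
    and mid: "\<And>j u v. u \<in> U j \<Longrightarrow> v \<in> U j \<Longrightarrow> (\<lambda>x. (u x + v x) / 2) \<in> U j"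
    and meas: "\<And>j u. u \<in> U j \<Longrightarrow> u \<in> borel_measurable M"
    and bdd: "\<And>j u x. u \<in> U j \<Longrightarrow> x \<in> space M \<Longrightarrow> 0 \<le> u x \<and> u x \<le> 1"
  shows "\<exists>h. (\<forall>j. h j \<in> U j) \<and> (AE x in M. convergent (\<lambda>j. h j x))"
proof -
  define q where "q u = (\<integral>x. (u x)\<^sup>2 \<partial>M)" for u :: "'a \<Rightarrow> real"
  have int: "integrable M (\<lambda>x. u x * v x)" if "u \<in> U i" "v \<in> U j" for u v i j
  proof (rule integrable_unit_interval)
    show "(\<lambda>x. u x * v x) \<in> borel_measurable M" using meas that by measurable
    show "\<bar>u x * v x\<bar> \<le> 1" if "x \<in> space M" for x
      using bdd[OF \<open>u \<in> U i\<close> that] bdd[OF \<open>v \<in> U j\<close> that] by (simp add: abs_mult mult_le_one)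
  qed
  have int2: "integrable M (\<lambda>x. (u x)\<^sup>2)" if "u \<in> U i" for u i
    using int[OF that that] by (simp add: power2_eq_square)
  have q0: "0 \<le> q u" for u unfolding q_def by simp
  have q1: "q u \<le> 1" if "u \<in> U j" for u j
  proof -
    have "q u \<le> (\<integral>x. 1 \<partial>M)" unfolding q_def
      using bdd[OF that] by (intro integral_mono int2[OF that]) (auto simp: power_le_one)
    then show ?thesis by (simp add: prob_space)
  qed
  define d where "d j = (INF u\<in>U j. q u)" for j
  have bb: "bdd_below (q ` U j)" for j using q0 by (auto intro!: bdd_belowI[of _ 0])
  have d_le: "d j \<le> q u" if "u \<in> U j" for j u
    unfolding d_def by (rule cINF_lower[OF bb that])
  have d1: "d j \<le> 1" for j using ne[of j] d_le q1 by (meson ex_in_conv order_trans)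
  have d_mono: "d i \<le> d j" if "i \<le> j" for i j
    unfolding d_def using ne decseqD[OF dec that] by (intro cINF_superset_mono bb) auto
  define D where "D = (SUP j. d j)"
  have ba: "bdd_above (range d)" using d1 by (auto intro!: bdd_aboveI[of _ 1])
  have d_D: "d j \<le> D" for j unfolding D_def by (rule cSUP_upper[OF _ ba]) simp
  have "\<exists>j\<ge>k. D - (1/4)^k \<le> d j" for k
  proof -
    have "D - (1/4)^k < D" by simp
    then obtain j where "D - (1/4)^k < d j"
      unfolding D_def using less_cSUP_iff[OF _ ba] by auto
    then show ?thesis using d_mono[of j "max j k"] by (intro exI[of _ "max j k"]) auto
  qed
  \<comment> \<open>The infima \<open>d\<close> increase to \<open>D\<close>; index
    \<open>J k\<close> brings them within \<open>(1/4)^k\<close> of \<open>D\<close>. An element of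
    \<open>U (J k)\<close> with \<open>q\<close> at most \<open>D + (1/4)^k\<close> is picked
    next.\<close>
  then obtain J where J: "\<And>k. J k \<ge> k" "\<And>k. D - (1/4)^k \<le> d (J k)" by metis
  have "\<exists>u\<in>U (J k). q u \<le> D + (1/4)^k" for k
  proof -
    have "d (J k) < D + (1/4)^k" using d_D[of "J k"] by (simp add: le_less_trans)
    then obtain u where "u \<in> U (J k)" "q u < D + (1/4)^k"
      unfolding d_def using cINF_less_iff[OF ne bb] by auto
    then show ?thesis by (intro bexI[of _ u]) auto
  qed
  then obtain h where hJ: "\<And>k. h k \<in> U (J k)" and hq: "\<And>k. q (h k) \<le> D + (1/4)^k" by metis
  have hU: "h k \<in> U k" for k using hJ[of k] decseqD[OF dec J(1)[of k]] by auto
  have "AE x in M. summable (\<lambda>k. \<bar>h (Suc k) x - h k x\<bar>)"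
  proof (rule AE_summable_of_square_integrals)
    fix k
    let ?u = "h (Suc k)" and ?v = "h k" and ?w = "\<lambda>x. (h (Suc k) x + h k x) / 2"
    \<comment> \<open>\<open>J\<close> need not be monotone. The smaller index gives one convex set
      containing both functions, and their midpoint has \<open>q\<close> at least
      \<open>d i\<close>, hence at least \<open>D - (1/4)^k\<close>.\<close>
    define i where "i = min (J k) (J (Suc k))"
    have i: "?u \<in> U i" "?v \<in> U i"
      using hJ[of k] hJ[of "Suc k"] decseqD[OF dec, of i "J k"] decseqD[OF dec, of i "J (Suc k)"]
      by (auto simp: i_def)
    have wU: "?w \<in> U i" by (rule mid[OF i])
    have "D - (1/4)^k \<le> d i"
    proof -
      have "(1/4::real)^Suc k \<le> (1/4)^k" by (rule power_decreasing) auto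
      then have "D - (1/4)^k \<le> d (J (Suc k))" using J(2)[of "Suc k"] by linarith
      then show ?thesis using J(2)[of k] by (auto simp: i_def min_def)
    qed
    then have w: "D - (1/4)^k \<le> q ?w" using d_le[OF wU] by linarith
    have eq: "(\<lambda>x. (?u x - ?v x)\<^sup>2) = (\<lambda>x. 2 * (?u x)\<^sup>2 + 2 * (?v x)\<^sup>2 - 4 * (?w x)\<^sup>2)"
      by (auto simp: power2_eq_square field_simps)
    show "integrable M (\<lambda>x. (?u x - ?v x)\<^sup>2)"
      unfolding eq using int2[OF i(1)] int2[OF i(2)] int2[OF wU]
      by (intro Bochner_Integration.integrable_diff Bochner_Integration.integrable_add) auto
    have "(\<integral>x. (?u x - ?v x)\<^sup>2 \<partial>M) = 2 * q ?u + 2 * q ?v - 4 * q ?w"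
      unfolding eq q_def using int2[OF i(1)] int2[OF i(2)] int2[OF wU] by simp
    also have "\<dots> \<le> 2 * (D + (1/4)^Suc k) + 2 * (D + (1/4)^k) - 4 * (D - (1/4)^k)"
      using hq[of k] hq[of "Suc k"] w by (intro diff_mono add_mono mult_left_mono) auto
    also have "\<dots> \<le> 8 * (1/4)^k" by simp
    finally show "(\<integral>x. (?u x - ?v x)\<^sup>2 \<partial>M) \<le> 8 * (1/4)^k" .
  qed
  then have "AE x in M. convergent (\<lambda>j. h j x)"
    by eventually_elim (rule convergent_if_summable_diff)
  with hU show ?thesis by blast
qed

locale prob_markov_kernel = ac_markov_kernel + lam: prob_space lam
begin

abbreviation P :: "(nat \<Rightarrow> 'a) measure" where
  "P \<equiv> path_measure S K lam"

lemma nn_integral_path_measure: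
  "F \<in> borel_measurable paths \<Longrightarrow> (\<integral>\<^sup>+\<omega>. F \<omega> \<partial>P) = (\<integral>\<^sup>+y. (\<integral>\<^sup>+\<omega>. F \<omega> \<partial>chain y) \<partial>lam)"
  unfolding path_measure_def
  by (rule nn_integral_bind[where B=paths]) (simp_all add: measurable_cong_sets[OF sets_lam refl])

lemma prob_space_P: "prob_space P"
proof
  have "emeasure P (space P) = (\<integral>\<^sup>+y. emeasure (chain y) (space paths) \<partial>lam)"
    by (simp add: space_path_measure emeasure_path_measure)
  also have "\<dots> = (\<integral>\<^sup>+y. 1 \<partial>lam)"
    using prob_space.emeasure_space_1[OF prob_space_chain]
    by (intro nn_integral_cong) (simp add: space_lam space_chain)
  finally show "emeasure P (space P) = 1" by (simp add: lam.emeasure_space_1)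
qed

lemma measurable_P: "measurable P M = measurable paths M"
  by (rule measurable_cong_sets[OF sets_path_measure refl])

text \<open>\<open>P\<close> need not be shift invariant, but the law of the shifted path is
  absolutely continuous with respect to \<open>P\<close>, because the transitions are absolutely
  continuous with respect to \<open>lam\<close>.\<close>

lemma AE_P_shift:
  assumes "AE \<omega> in P. Q \<omega>" shows "AE \<omega> in P. Q (\<lambda>i. \<omega> (i + n))"
proof -
  obtain N where N: "N \<in> null_sets P" "{\<omega>\<in>space P. \<not> Q \<omega>} \<subseteq> N"
    using assms unfolding eventually_ae_filter by blast
  have Ns[measurable]: "N \<in> sets paths" using N sets_path_measure by (auto dest: null_setsD2)
  have N0: "AE z in lam. emeasure (chain z) N = 0"
    using N(1) by (simp add: null_sets_path_measure_iff)
  let ?M = "{\<omega>\<in>space paths. (\<lambda>i. \<omega> (i + n)) \<in> N}"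
  have M: "?M \<in> sets paths" by measurable
  have "AE y in lam. emeasure (chain y) ?M = 0"
  proof (cases n)
    case 0
    then have "?M = N" using sets.sets_into_space[OF Ns] by auto
    then show ?thesis using N0 by simp
  next
    case (Suc k)
    have "emeasure (chain y) ?M = 0" if "y \<in> space S" for y
      unfolding emeasure_chain_shift[OF that Ns] unfolding Suc
      by (subst Kop_funpow_AE_cong[OF that N0]) (rule Kop_funpow_const[OF that])
    then show ?thesis by (intro AE_I2) (simp add: space_lam)
  qed
  then have "?M \<in> null_sets P" using null_sets_path_measure_iff[OF M] by simp
  then have "AE \<omega> in P. \<omega> \<notin> ?M" by (rule AE_not_in)
  with AE_space show ?thesis
  proof eventually_elim
    case (elim \<omega>)
    then have "(\<lambda>i. \<omega> (i + n)) \<in> space P - N" by (simp add: space_path_measure shift_space)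
    then show ?case using N(2) by blast
  qed
qed

lemma AE_P_AE_chain:
  assumes "AE \<omega> in P. Q \<omega>" shows "AE y in lam. AE \<omega> in chain y. Q \<omega>"
proof -
  obtain N where N: "N \<in> null_sets P" "{\<omega>\<in>space P. \<not> Q \<omega>} \<subseteq> N"
    using assms unfolding eventually_ae_filter by blast
  have Ns[measurable]: "N \<in> sets paths" using N sets_path_measure by (auto dest: null_setsD2)
  have "AE z in lam. emeasure (chain z) N = 0"
    using N(1) by (simp add: null_sets_path_measure_iff)
  with AE_space show ?thesis
  proof eventually_elim
    case (elim z)
    then have "N \<in> null_sets (chain z)" by (simp add: null_sets_def sets_chain space_lam)
    then show ?case
      by (rule AE_I') (use N(2) elim(1) in \<open>auto simp: space_chain space_lam space_path_measure\<close>)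
  qed
qed


text \<open>A single event is tested: that the limit of \<open>h\<close> along the path exceeds the
  mean \<open>c\<close> of \<open>h\<close>. Triviality puts the limit on one side of
  \<open>c\<close> almost everywhere, and since its own mean is \<open>c\<close> it equals
  \<open>c\<close>. The assumption \<open>triv\<close> concerns strictly invariant events only, so
  the test event has to be corrected on a null set.\<close>

lemma harmonic_AE_const:
  fixes h :: "'a \<Rightarrow> real"
  assumes h[measurable]: "h \<in> borel_measurable S"
    and bdd: "\<And>y. y \<in> space S \<Longrightarrow> 0 \<le> h y \<and> h y \<le> 1"
    and harm: "\<And>y. y \<in> space S \<Longrightarrow> (\<integral>z. h z \<partial>K y) = h y"
    and triv: "\<And>B. B \<in> sets paths \<Longrightarrow> (\<And>\<omega>. \<omega> \<in> space paths \<Longrightarrow> (\<lambda>i. \<omega> (Suc i)) \<in> B \<longleftrightarrow> \<omega> \<in> B) \<Longrightarrow>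
      (AE y in lam. emeasure (chain y) B = 0) \<or> (AE y in lam. emeasure (chain y) (space paths - B) = 0)"
  shows "AE y in lam. h y = (\<integral>y. h y \<partial>lam)"
proof -
  interpret P: prob_space P by (rule prob_space_P)
  define X where "X n \<omega> = h (\<omega> n)" for n :: nat and \<omega>
  have X_meas[measurable]: "X n \<in> borel_measurable paths" for n unfolding X_def by measurable
  have X_bdd: "0 \<le> X n \<omega>" "X n \<omega> \<le> 1" if "\<omega> \<in> space paths" for n \<omega>
    using bdd[OF component_space[OF that]] by (auto simp: X_def)
  have bexp: "integrable P F" if "F \<in> borel_measurable paths" "\<And>\<omega>. \<omega> \<in> space paths \<Longrightarrow> \<bar>F \<omega>\<bar> \<le> 1" for F :: "_ \<Rightarrow> real"
    using that by (intro P.integrable_unit_interval) (auto simp: measurable_P space_path_measure)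
  define g where "g z = ennreal (h z)" for z
  have g_meas[measurable]: "g \<in> borel_measurable S" unfolding g_def by measurable
  have Kg: "Kop g y = g y" if y: "y \<in> space S" for y
  proof -
    interpret Ky: prob_space "K y" by (rule prob_space_kernel[OF y])
    have "integrable (K y) h"
      by (intro Ky.integrable_unit_interval) (simp_all add: bdd measurable_kernel_cong[OF y] space_kernel_eq[OF y])
    then have "(\<integral>\<^sup>+z. ennreal (h z) \<partial>K y) = ennreal (\<integral>z. h z \<partial>K y)"
      by (intro nn_integral_eq_integral AE_I2) (simp_all add: bdd space_kernel_eq[OF y])
    then show ?thesis by (simp add: Kop_def g_def harm[OF y])
  qed
  have Kng: "(Kop ^^ n) g y = g y" if "y \<in> space S" for n y
    using that
  proof (induction n arbitrary: y)
    case (Suc n)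
    have "Kop ((Kop ^^ n) g) y = Kop g y" by (rule Kop_cong[OF Suc.prems Suc.IH])
    then show ?case using Kg[OF Suc.prems] by simp
  qed simp
  have EX: "(\<integral>\<omega>. X n \<omega> \<partial>chain y) = h y" if y: "y \<in> space S" for n y
  proof -
    have "(\<integral>\<^sup>+\<omega>. ennreal (X n \<omega>) \<partial>chain y) = g y"
      using nn_integral_chain_component[OF y g_meas, of n] Kng[OF y] by (simp add: X_def g_def)
    moreover have "(\<integral>\<omega>. X n \<omega> \<partial>chain y) = enn2real (\<integral>\<^sup>+\<omega>. ennreal (X n \<omega>) \<partial>chain y)"
      by (rule integral_eq_enn2real)
        (simp_all add: X_bdd measurable_cong_sets[OF sets_chain[OF y] refl] space_chain[OF y])
    ultimately show ?thesis using bdd[OF y] by (simp add: g_def)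
  qed
  have EXP: "(\<integral>\<omega>. X n \<omega> \<partial>P) = (\<integral>y. h y \<partial>lam)" for n
  proof -
    have "(\<integral>\<^sup>+\<omega>. ennreal (X n \<omega>) \<partial>P) = (\<integral>\<^sup>+y. (\<integral>\<^sup>+\<omega>. ennreal (X n \<omega>) \<partial>chain y) \<partial>lam)"
      by (rule nn_integral_path_measure) measurable
    also have "\<dots> = (\<integral>\<^sup>+y. g y \<partial>lam)"
      using nn_integral_chain_component[OF _ g_meas, of _ n] Kng
      by (intro nn_integral_cong) (simp add: X_def g_def space_lam)
    finally have "(\<integral>\<^sup>+\<omega>. ennreal (X n \<omega>) \<partial>P) = (\<integral>\<^sup>+y. ennreal (h y) \<partial>lam)" by (simp only: g_def)
    moreover have "(\<integral>\<omega>. X n \<omega> \<partial>P) = enn2real (\<integral>\<^sup>+\<omega>. ennreal (X n \<omega>) \<partial>P)"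
      by (rule integral_eq_enn2real) (simp_all add: X_bdd measurable_P space_path_measure)
    moreover have "(\<integral>y. h y \<partial>lam) = enn2real (\<integral>\<^sup>+y. ennreal (h y) \<partial>lam)"
      by (rule integral_eq_enn2real) (simp_all add: bdd space_lam measurable_cong_sets[OF sets_lam refl])
    ultimately show ?thesis by simp
  qed
  define b where "b m = (\<integral>\<omega>. (X m \<omega>)\<^sup>2 \<partial>P)" for m
  \<comment> \<open>Conditioning at time \<open>m\<close> replaces \<open>X (m + j)\<close> by
    \<open>X m\<close>. It follows that the mean square of an increment is a difference of second
    moments \<open>b\<close>.\<close>
  have prod: "(\<integral>\<omega>. X m \<omega> * X (m + j) \<omega> \<partial>P) = b m" for m j
  proof -
    have *: "(\<integral>\<^sup>+\<omega>. ennreal (X m \<omega> * X (m + j) \<omega>) \<partial>chain y) = (\<integral>\<^sup>+\<omega>. ennreal ((X m \<omega>)\<^sup>2) \<partial>chain y)"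
      if y: "y \<in> space S" for y
    proof -
      have "(\<integral>\<^sup>+\<omega>. ennreal (X m \<omega> * X (m + j) \<omega>) \<partial>chain y) = (\<integral>\<^sup>+\<omega>. ennreal (X m \<omega>) * ennreal (X j (\<lambda>i. \<omega> (i + m))) \<partial>chain y)"
        using X_bdd by (intro nn_integral_cong) (simp add: space_chain[OF y] X_def ennreal_mult ac_simps)
      also have "\<dots> = (\<integral>\<^sup>+\<omega>. ennreal (X m \<omega>) * (\<integral>\<^sup>+\<omega>'. ennreal (X j \<omega>') \<partial>chain (\<omega> m)) \<partial>chain y)"
        by (rule nn_integral_chain_markov[OF y]) (auto simp: X_def)
      also have "\<dots> = (\<integral>\<^sup>+\<omega>. ennreal ((X m \<omega>)\<^sup>2) \<partial>chain y)"
      proof (rule nn_integral_cong)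
        fix \<omega> assume "\<omega> \<in> space (chain y)"
        then have \<omega>: "\<omega> \<in> space paths" by (simp add: space_chain[OF y])
        have "(\<integral>\<^sup>+\<omega>'. ennreal (X j \<omega>') \<partial>chain (\<omega> m)) = ennreal (X m \<omega>)"
          using nn_integral_chain_component[OF component_space[OF \<omega>] g_meas, of m j] Kng[OF component_space[OF \<omega>], of j m]
          by (simp add: X_def g_def)
        then show "ennreal (X m \<omega>) * (\<integral>\<^sup>+\<omega>'. ennreal (X j \<omega>') \<partial>chain (\<omega> m)) = ennreal ((X m \<omega>)\<^sup>2)"
          using X_bdd[OF \<omega>] by (simp add: power2_eq_square ennreal_mult)
      qed
      finally show ?thesis .
    qed
    have "(\<integral>\<^sup>+\<omega>. ennreal (X m \<omega> * X (m + j) \<omega>) \<partial>P) = (\<integral>\<^sup>+y. (\<integral>\<^sup>+\<omega>. ennreal (X m \<omega> * X (m + j) \<omega>) \<partial>chain y) \<partial>lam)"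
      by (rule nn_integral_path_measure) measurable
    also have "\<dots> = (\<integral>\<^sup>+y. (\<integral>\<^sup>+\<omega>. ennreal ((X m \<omega>)\<^sup>2) \<partial>chain y) \<partial>lam)"
      by (rule nn_integral_cong) (simp add: space_lam *)
    also have "\<dots> = (\<integral>\<^sup>+\<omega>. ennreal ((X m \<omega>)\<^sup>2) \<partial>P)"
      by (rule nn_integral_path_measure[symmetric]) measurable
    finally have "(\<integral>\<^sup>+\<omega>. ennreal (X m \<omega> * X (m + j) \<omega>) \<partial>P) = (\<integral>\<^sup>+\<omega>. ennreal ((X m \<omega>)\<^sup>2) \<partial>P)" .
    moreover have "(\<integral>\<omega>. X m \<omega> * X (m + j) \<omega> \<partial>P) = enn2real (\<integral>\<^sup>+\<omega>. ennreal (X m \<omega> * X (m + j) \<omega>) \<partial>P)"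
      by (rule integral_eq_enn2real) (simp_all add: X_bdd measurable_P space_path_measure)
    moreover have "b m = enn2real (\<integral>\<^sup>+\<omega>. ennreal ((X m \<omega>)\<^sup>2) \<partial>P)"
      unfolding b_def by (rule integral_eq_enn2real) (simp_all add: X_bdd measurable_P space_path_measure)
    ultimately show ?thesis by simp
  qed
  have intXX: "integrable P (\<lambda>\<omega>. X p \<omega> * X q \<omega>)" for p q
    using X_bdd by (intro bexp) (auto simp: abs_mult intro!: mult_le_one)
  have int2: "integrable P (\<lambda>\<omega>. (X p \<omega>)\<^sup>2)" for p
    using intXX[of p p] by (simp add: power2_eq_square)
  have expand: "(\<lambda>\<omega>. (X q \<omega> - X p \<omega>)\<^sup>2) = (\<lambda>\<omega>. (X q \<omega>)\<^sup>2 + (X p \<omega>)\<^sup>2 - 2 * (X p \<omega> * X q \<omega>))" for p q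
    by (auto simp: power2_eq_square algebra_simps)
  have intd: "integrable P (\<lambda>\<omega>. (X q \<omega> - X p \<omega>)\<^sup>2)" for p q
    unfolding expand using int2[of p] int2[of q] intXX[of p q]
    by (intro Bochner_Integration.integrable_diff Bochner_Integration.integrable_add) auto
  have diff: "(\<integral>\<omega>. (X q \<omega> - X p \<omega>)\<^sup>2 \<partial>P) = b q - b p" if "p \<le> q" for p q
    unfolding expand using int2[of p] int2[of q] intXX[of p q] prod[of p "q - p"] that
    by (simp add: b_def)
  have b_mono: "b p \<le> b q" if "p \<le> q" for p q
  proof -
    have "0 \<le> (\<integral>\<omega>. (X q \<omega> - X p \<omega>)\<^sup>2 \<partial>P)" by (rule Bochner_Integration.integral_nonneg) simp
    then show ?thesis using diff[OF that] by simp
  qed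
  have b1: "b m \<le> 1" for m
  proof -
    have "b m \<le> (\<integral>\<omega>. 1 \<partial>P)" unfolding b_def
      using X_bdd by (intro integral_mono int2) (auto simp: space_path_measure power_le_one)
    then show ?thesis by (simp add: P.prob_space)
  qed
  have "incseq b" using b_mono by (simp add: incseq_def)
  then obtain \<beta> where \<beta>: "b \<longlonglongrightarrow> \<beta>" "\<And>i. b i \<le> \<beta>"
    using incseq_convergent[of b 1] b1 by blast
  have "\<exists>n. \<beta> - b n \<le> (1/4)^k" for k
  proof -
    have "\<forall>\<^sub>F n in sequentially. \<beta> - (1/4)^k < b n"
      by (rule order_tendstoD(1)[OF \<beta>(1)]) simp
    then obtain n where "\<beta> - (1/4)^k < b n" by (auto simp: eventually_sequentially)
    then show ?thesis by (intro exI[of _ n]) linarith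
  qed
  \<comment> \<open>The times \<open>n k\<close> need not increase, so \<open>diff_le\<close> bounds
    increments in either order.\<close>
  then obtain n where n: "\<And>k. \<beta> - b (n k) \<le> (1/4)^k" by metis
  have diff_le: "(\<integral>\<omega>. (X q \<omega> - X p \<omega>)\<^sup>2 \<partial>P) \<le> max (\<beta> - b p) (\<beta> - b q)" for p q
  proof (cases "p \<le> q")
    case True
    then show ?thesis using diff[OF True] \<beta>(2)[of q] by simp
  next
    case False
    then have "(\<integral>\<omega>. (X q \<omega> - X p \<omega>)\<^sup>2 \<partial>P) = b p - b q"
      using diff[of q p] by (simp add: power2_commute)
    then show ?thesis using \<beta>(2)[of p] by simp
  qed
  have small: "(1/4::real)^Suc k \<le> (1/4)^k" for k by (rule power_decreasing) auto
  have "AE \<omega> in P. summable (\<lambda>k. \<bar>X (n (Suc k)) \<omega> - X (n k) \<omega>\<bar>)"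
  proof (rule P.AE_summable_of_square_integrals[OF intd])
    show "(\<integral>\<omega>. (X (n (Suc k)) \<omega> - X (n k) \<omega>)\<^sup>2 \<partial>P) \<le> 1 * (1/4)^k" for k
      using diff_le[of "n (Suc k)" "n k"] n[of k] n[of "Suc k"] small[of k] by linarith
  qed
  then have conv: "AE \<omega> in P. convergent (\<lambda>k. X (n k) \<omega>)"
    by eventually_elim (rule convergent_if_summable_diff)
  have "AE \<omega> in P. summable (\<lambda>k. \<bar>X (Suc (n k)) \<omega> - X (n k) \<omega>\<bar>)"
  proof (rule P.AE_summable_of_square_integrals[OF intd])
    show "(\<integral>\<omega>. (X (Suc (n k)) \<omega> - X (n k) \<omega>)\<^sup>2 \<partial>P) \<le> 1 * (1/4)^k" for k
      using diff_le[of "Suc (n k)" "n k"] n[of k] b_mono[of "n k" "Suc (n k)"] by linarith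
  qed
  \<comment> \<open>Convergence is known only along the times \<open>n k\<close>; invariance of the
    limit under one shift needs the values at \<open>n k\<close> and \<open>Suc (n k)\<close> to
    merge.\<close>
  then have close: "AE \<omega> in P. (\<lambda>k. X (Suc (n k)) \<omega> - X (n k) \<omega>) \<longlonglongrightarrow> 0"
    by eventually_elim (auto dest!: summable_LIMSEQ_zero simp: tendsto_rabs_zero_iff)
  define H where "H \<omega> = lim (\<lambda>k. X (n k) \<omega>)" for \<omega>
  have H_meas[measurable]: "H \<in> borel_measurable paths"
    unfolding H_def by (rule borel_measurable_lim_metric) measurable
  have H_lim: "AE \<omega> in P. (\<lambda>k. X (n k) \<omega>) \<longlonglongrightarrow> H \<omega>"
    using conv by eventually_elim (simp add: H_def convergent_LIMSEQ_iff)
  have H_shift1: "AE \<omega> in P. H (\<lambda>i. \<omega> (i + 1)) = H \<omega>"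
    using H_lim close
  proof eventually_elim
    case (elim \<omega>)
    from tendsto_add[OF elim] have "(\<lambda>k. X (n k) (\<lambda>i. \<omega> (i + 1))) \<longlonglongrightarrow> H \<omega>"
      by (simp add: X_def)
    then show ?case unfolding H_def by (rule limI)
  qed
  have H_shift: "AE \<omega> in P. H (\<lambda>i. \<omega> (i + m)) = H \<omega>" for m
  proof (induction m)
    case (Suc m)
    show ?case using Suc AE_P_shift[OF H_shift1, of m]
      by eventually_elim (simp add: ac_simps)
  qed simp
  define c where "c = (\<integral>y. h y \<partial>lam)"
  define E where "E = {\<omega>\<in>space paths. c < H \<omega>}"
  have E[measurable]: "E \<in> sets paths" unfolding E_def by measurable
  \<comment> \<open>\<open>E\<close> is invariant only mod 0. Requiring infinitely many shifts of
    the path to lie in \<open>E\<close> gives a strictly invariant event that differs from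
    \<open>E\<close> by a null set.\<close>
  define E' where "E' = {\<omega>\<in>space paths. \<forall>m. \<exists>k\<ge>m. (\<lambda>i. \<omega> (i + k)) \<in> E}"
  have E'[measurable]: "E' \<in> sets paths" unfolding E'_def by measurable
  have E'_inv: "(\<lambda>i. \<omega> (Suc i)) \<in> E' \<longleftrightarrow> \<omega> \<in> E'" if \<omega>: "\<omega> \<in> space paths" for \<omega>
  proof -
    have s: "(\<lambda>i. \<omega> (Suc i)) \<in> space paths" using shift_space[OF \<omega>, of 1] by simp
    have "(\<forall>m. \<exists>k\<ge>m. (\<lambda>i. \<omega> (Suc (i + k))) \<in> E) \<longleftrightarrow> (\<forall>m. \<exists>k\<ge>m. (\<lambda>i. \<omega> (i + k)) \<in> E)" (is "?L \<longleftrightarrow> ?R")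
    proof (intro iffI allI)
      fix m assume ?L
      then obtain k where "k \<ge> m" "(\<lambda>i. \<omega> (Suc (i + k))) \<in> E" by blast
      then show "\<exists>k\<ge>m. (\<lambda>i. \<omega> (i + k)) \<in> E" by (intro exI[of _ "Suc k"]) simp
    next
      fix m assume ?R
      then obtain k where k: "k \<ge> Suc m" "(\<lambda>i. \<omega> (i + k)) \<in> E" by blast
      then obtain j where "k = Suc j" by (cases k) auto
      then show "\<exists>k\<ge>m. (\<lambda>i. \<omega> (Suc (i + k))) \<in> E" using k by (intro exI[of _ j]) simp
    qed
    then show ?thesis using \<omega> s by (simp add: E'_def)
  qed
  have "AE \<omega> in P. \<forall>m. H (\<lambda>i. \<omega> (i + m)) = H \<omega>"
    using H_shift by (simp add: AE_all_countable)
  with AE_space have EE': "AE \<omega> in P. \<omega> \<in> E' \<longleftrightarrow> c < H \<omega>"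
  proof eventually_elim
    case (elim \<omega>)
    then have \<omega>: "\<omega> \<in> space paths" by (simp add: space_path_measure)
    then show ?case using elim(2) shift_space[OF \<omega>] by (auto simp: E'_def E_def)
  qed
  have H_bdd: "AE \<omega> in P. 0 \<le> H \<omega> \<and> H \<omega> \<le> 1"
    using H_lim AE_space
  proof eventually_elim
    case (elim \<omega>)
    then have "\<omega> \<in> space paths" by (simp add: space_path_measure)
    then show ?case
      using LIMSEQ_le_const[OF elim(1), of 0] LIMSEQ_le_const2[OF elim(1), of 1] X_bdd by blast
  qed
  have "AE \<omega> in P. norm (H \<omega>) \<le> 1"
    using H_bdd by eventually_elim auto
  then have H_int: "integrable P H"
    by (rule P.integrable_const_bound) (simp add: measurable_P)
  have "(\<lambda>k. \<integral>\<omega>. X (n k) \<omega> \<partial>P) \<longlonglongrightarrow> (\<integral>\<omega>. H \<omega> \<partial>P)"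
    using X_bdd H_lim
    by (intro integral_dominated_convergence[where w="\<lambda>_. 1"]) (auto simp: measurable_P space_path_measure intro!: AE_I2)
  then have EH: "(\<integral>\<omega>. H \<omega> \<partial>P) = c"
    unfolding EXP c_def using LIMSEQ_unique tendsto_const by blast
  have Hc: "AE \<omega> in P. H \<omega> = c"
  proof -
    have "E' \<in> null_sets P \<or> space paths - E' \<in> null_sets P"
      using triv[OF E' E'_inv] by (simp add: null_sets_path_measure_iff)
    then show ?thesis
    proof
      assume "E' \<in> null_sets P"
      then have le: "AE \<omega> in P. 0 \<le> c - H \<omega>"
        using EE' by (auto dest!: AE_not_in elim!: eventually_elim2)
      have "(\<integral>\<omega>. c - H \<omega> \<partial>P) = 0" using H_int EH by (simp add: P.prob_space)
      then have "AE \<omega> in P. c - H \<omega> = 0"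
        using integral_nonneg_eq_0_iff_AE[OF _ le] H_int by simp
      then show ?thesis by eventually_elim simp
    next
      assume "space paths - E' \<in> null_sets P"
      then have "AE \<omega> in P. \<omega> \<notin> space paths - E'" by (rule AE_not_in)
      with EE' AE_space have le: "AE \<omega> in P. 0 \<le> H \<omega> - c"
        by eventually_elim (auto simp: space_path_measure)
      have "(\<integral>\<omega>. H \<omega> - c \<partial>P) = 0" using H_int EH by (simp add: P.prob_space)
      then have "AE \<omega> in P. H \<omega> - c = 0"
        using integral_nonneg_eq_0_iff_AE[OF _ le] H_int by simp
      then show ?thesis by eventually_elim simp
    qed
  qed
  have "AE \<omega> in P. (\<lambda>k. X (n k) \<omega>) \<longlonglongrightarrow> c"
    using H_lim Hc by eventually_elim simp
  \<comment> \<open>Under \<open>chain y\<close> every \<open>X (n k)\<close> has mean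
    \<open>h y\<close>, and by dominated convergence these means tend to \<open>c\<close>.\<close>
  from AE_P_AE_chain[OF this] AE_space show ?thesis
  proof eventually_elim
    case (elim y)
    then have y: "y \<in> space S" by (simp add: space_lam)
    interpret Cy: prob_space "chain y" by (rule prob_space_chain[OF y])
    have "(\<lambda>k. \<integral>\<omega>. X (n k) \<omega> \<partial>chain y) \<longlonglongrightarrow> (\<integral>\<omega>. c \<partial>chain y)"
      using X_bdd elim(1)
      by (intro integral_dominated_convergence[where w="\<lambda>_. 1"])
        (auto simp: measurable_cong_sets[OF sets_chain[OF y] refl] space_chain[OF y] intro!: AE_I2)
    then have "(\<lambda>k. h y) \<longlonglongrightarrow> c" by (simp add: EX[OF y] Cy.prob_space)
    then show ?case unfolding c_def[symmetric] by (rule LIMSEQ_unique[OF tendsto_const])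
  qed
qed

end

section \<open>Cesaro averages of Liouville chains\<close>

text \<open>The uses of this lemma depend only on the class of null sets, so an infinite measure may
  be traded for a probability measure. The density is a strictly positive integrable function,
  normalised.\<close>

lemma (in sigma_finite_measure) equivalent_prob_space:
  assumes "emeasure M (space M) \<noteq> 0"
  shows "\<exists>\<mu>. prob_space \<mu> \<and> sets \<mu> = sets M \<and> (\<forall>Q. (AE x in \<mu>. Q x) \<longleftrightarrow> (AE x in M. Q x))"
proof -
  obtain h where h[measurable]: "h \<in> borel_measurable M" and fin: "integral\<^sup>N M h \<noteq> \<infinity>"
    and pos: "\<forall>x\<in>space M. 0 < h x \<and> h x < \<infinity>"
    using Ex_finite_integrable_function by blast
  define c where "c = integral\<^sup>N M h"
  have c0: "c \<noteq> 0"
  proof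
    assume "c = 0"
    then have "AE x in M. h x = 0" unfolding c_def by (subst (asm) nn_integral_0_iff_AE) auto
    then have "AE x in M. False" using AE_space by eventually_elim (use pos in auto)
    then show False using assms by (simp add: AE_iff_null null_sets_def)
  qed
  have ct: "c \<noteq> \<infinity>" using fin by (simp add: c_def)
  let ?\<mu> = "density M (\<lambda>x. h x / c)"
  have "emeasure ?\<mu> (space ?\<mu>) = (\<integral>\<^sup>+x. h x / c \<partial>M)"
    by (simp add: emeasure_density cong: nn_integral_cong)
  also have "\<dots> = c / c" by (simp add: nn_integral_divide c_def)
  also have "\<dots> = 1" using c0 ct by (simp add: ennreal_divide_self less_top)
  finally have "prob_space ?\<mu>" by (rule prob_spaceI)
  moreover have "(AE x in ?\<mu>. Q x) \<longleftrightarrow> (AE x in M. Q x)" for Q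
  proof -
    have "(AE x in ?\<mu>. Q x) \<longleftrightarrow> (AE x in M. 0 < h x / c \<longrightarrow> Q x)"
      by (rule AE_density) measurable
    also have "\<dots> \<longleftrightarrow> (AE x in M. Q x)"
    proof (rule AE_cong)
      fix x assume "x \<in> space M"
      then have "0 < h x / c" using pos ct by (simp add: ennreal_zero_less_divide less_top)
      then show "(0 < h x / c \<longrightarrow> Q x) \<longleftrightarrow> Q x" by simp
    qed
    finally show ?thesis .
  qed
  ultimately show ?thesis by (intro exI[of _ ?\<mu>]) simp
qed

lemma (in markov_kernel) integral_Kop_funpow:
  assumes y: "y \<in> space S" and [measurable]: "A \<in> sets S"
  shows "(\<integral>z. enn2real ((Kop ^^ k) (indicator A) z) \<partial>K y) = enn2real ((Kop ^^ Suc k) (indicator A) y)"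
proof -
  have "(\<integral>z. enn2real ((Kop ^^ k) (indicator A) z) \<partial>K y) =
      enn2real (\<integral>\<^sup>+z. ennreal (enn2real ((Kop ^^ k) (indicator A) z)) \<partial>K y)"
    by (rule integral_eq_enn2real) (simp_all add: measurable_kernel_cong[OF y])
  also have "(\<integral>\<^sup>+z. ennreal (enn2real ((Kop ^^ k) (indicator A) z)) \<partial>K y) = (\<integral>\<^sup>+z. (Kop ^^ k) (indicator A) z \<partial>K y)"
  proof (rule nn_integral_cong)
    fix z assume "z \<in> space (K y)"
    then have "(Kop ^^ k) (indicator A) z \<le> 1"
      by (intro Kop_funpow_le_1) (auto simp: space_kernel_eq y indicator_def)
    also have "(1::ennreal) < top" by simp
    finally show "ennreal (enn2real ((Kop ^^ k) (indicator A) z)) = (Kop ^^ k) (indicator A) z" by simp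
  qed
  finally show ?thesis by (simp add: Kop_def[of "(Kop ^^ k) (indicator A)" y])
qed

text \<open>Times 1 to \<open>n\<close> are averaged. Time 0 would contribute a point mass and
  destroy absolute continuity.\<close>

definition (in markov_kernel) cesaro :: "nat \<Rightarrow> 'a set \<Rightarrow> 'a \<Rightarrow> real" where
  "cesaro n A y = (\<Sum>k<n. enn2real ((Kop ^^ Suc k) (indicator A) y)) / n"

context ac_markov_kernel
begin

text \<open>A strictly invariant event is its own preimage under every power of the shift, hence
  belongs to all the future sigma-algebras and is an exit event.\<close>

lemma poisson_boundary_trivial_invariant:
  assumes triv: "poisson_boundary_trivial S K lam" and B: "B \<in> sets paths"
    and inv: "\<And>\<omega>. \<omega> \<in> space paths \<Longrightarrow> (\<lambda>i. \<omega> (Suc i)) \<in> B \<longleftrightarrow> \<omega> \<in> B"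
  shows "(AE y in lam. emeasure (chain y) B = 0) \<or> (AE y in lam. emeasure (chain y) (space paths - B) = 0)"
proof -
  let ?P = "path_measure S K lam"
  have Bsp: "B \<subseteq> space paths" using sets.sets_into_space[OF B] .
  have inv': "(\<lambda>i. \<omega> (i + n)) \<in> B \<longleftrightarrow> \<omega> \<in> B" if \<omega>: "\<omega> \<in> space paths" for \<omega> n
  proof (induction n)
    case (Suc n)
    show ?case using inv[OF shift_space[OF \<omega>, of n]] Suc by simp
  qed simp
  have "B \<in> future_sets S n" for n
  proof -
    have "{\<omega>\<in>space paths. (\<lambda>i. \<omega> (i + n)) \<in> B} = B" using Bsp inv' by blast
    then show ?thesis using shift_in_future_sets[OF B, of n] by simp
  qed
  then have "B \<in> tail_sets S ?P"
    unfolding tail_sets_def by (auto simp: space_path_measure intro!: bexI[of _ B] dest: subsetD[OF Bsp])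
  moreover have "(\<lambda>\<omega> n. \<omega> (Suc n)) -` B \<inter> space ?P = B"
    using Bsp inv by (auto simp: space_path_measure)
  ultimately have "B \<in> exit_sets S ?P" by (simp add: exit_sets_def)
  then have "B \<in> null_sets (completion ?P) \<or> space ?P - B \<in> null_sets (completion ?P)"
    using triv unfolding poisson_boundary_trivial_def trivial_events_def by blast
  then show ?thesis
    using B by (simp add: null_sets_completion_iff sets_path_measure space_path_measure null_sets_path_measure_iff)
qed

text \<open>If the Cesaro averages stayed apart, a limit of them in the sense of convex selection would be a
  nonconstant bounded harmonic function.\<close>

lemma cesaro_diff_le:
  assumes fin: "sigma_finite_measure lam" and triv: "poisson_boundary_trivial S K lam"
    and y: "y \<in> space S" and y': "y' \<in> space S" and \<delta>: "0 < \<delta>"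
  shows "\<exists>n0. \<forall>n\<ge>n0. \<forall>A\<in>sets S. cesaro n A y - cesaro n A y' \<le> \<delta>"
proof (rule ccontr)
  assume "\<nexists>n0. \<forall>n\<ge>n0. \<forall>A\<in>sets S. cesaro n A y - cesaro n A y' \<le> \<delta>"
  then have far: "\<exists>n\<ge>n0. \<exists>A\<in>sets S. \<delta> < cesaro n A y - cesaro n A y'" for n0
    by (auto simp: not_le)
  \<comment> \<open>A zero reference measure would force the probability measure \<open>K y\<close>
    to vanish.\<close>
  have "emeasure lam (space lam) \<noteq> 0"
  proof
    assume "emeasure lam (space lam) = 0"
    then have "AE z in lam. False" by (simp add: AE_iff_null null_sets_def)
    then have F: "AE z in K y. False" by (rule AE_kernel[OF y])
    interpret Ky: prob_space "K y" by (rule prob_space_kernel[OF y])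
    from F show False by simp
  qed
  then obtain \<mu> where \<mu>: "prob_space \<mu>" "sets \<mu> = sets lam"
    and AE: "\<And>Q. (AE x in \<mu>. Q x) \<longleftrightarrow> (AE x in lam. Q x)"
    using sigma_finite_measure.equivalent_prob_space[OF fin] by blast
  have sets_\<mu>: "sets \<mu> = sets S" using \<mu>(2) sets_lam by simp
  have null: "A \<in> null_sets lam" if "A \<in> null_sets \<mu>" for A
  proof -
    have "A \<in> sets lam" using that \<mu>(2) by auto
    then show ?thesis using that AE[of "\<lambda>x. x \<notin> A"] \<mu>(2) by (simp add: AE_iff_null_sets)
  qed
  interpret m: prob_space \<mu> by fact
  interpret m: prob_markov_kernel S K \<mu>
  proof
    show "absolutely_continuous \<mu> (K z)" if "z \<in> space S" for z
      using ac[OF that] null by (auto simp: absolutely_continuous_def)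
  qed (simp_all add: sets_\<mu> space_ne)
  define U where "U j = {u \<in> borel_measurable S. (\<forall>z\<in>space S. 0 \<le> u z \<and> u z \<le> 1) \<and>
    (\<forall>z\<in>space S. \<bar>(\<integral>x. u x \<partial>K z) - u z\<bar> \<le> 1 / real (Suc j)) \<and> \<delta> \<le> u y - u y'}" for j
  have int: "integrable (K z) u" if z: "z \<in> space S" and "u \<in> U j" for z u j
  proof -
    interpret Kz: prob_space "K z" by (rule prob_space_kernel[OF z])
    show ?thesis using that(2)
      by (intro Kz.integrable_unit_interval) (auto simp: U_def measurable_kernel_cong[OF z] space_kernel_eq[OF z])
  qed
  have "\<exists>h. (\<forall>j. h j \<in> U j) \<and> (AE x in \<mu>. convergent (\<lambda>j. h j x))"
  proof (rule m.convex_sets_AE_convergent_selection)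
    show "U j \<noteq> {}" for j
    proof -
      obtain n A where n: "n \<ge> Suc j" and A[measurable]: "A \<in> sets S" and d: "\<delta> < cesaro n A y - cesaro n A y'"
        using far by blast
      define u where "u = cesaro n A"
      let ?f = "\<lambda>k z. enn2real ((Kop ^^ k) (indicator A) z)"
      have f01: "0 \<le> ?f k z" "?f k z \<le> 1" if "z \<in> space S" for k z
      proof -
        have "(Kop ^^ k) (indicator A) z \<le> 1"
          by (rule Kop_funpow_le_1[OF that]) (auto simp: indicator_def)
        then show "?f k z \<le> 1" by (metis enn2real_1 enn2real_mono ennreal_one_less_top)
      qed simp
      have "u \<in> borel_measurable S" unfolding u_def cesaro_def by measurable
      moreover have "0 \<le> u z \<and> u z \<le> 1" if "z \<in> space S" for z
      proof -
        have "(\<Sum>k<n. ?f (Suc k) z) \<le> (\<Sum>k<n. 1)" by (intro sum_mono f01 that)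
        moreover have "0 \<le> (\<Sum>k<n. ?f (Suc k) z)" by (intro sum_nonneg f01 that)
        ultimately show ?thesis using n by (simp add: u_def cesaro_def divide_le_eq)
      qed
      moreover have "\<bar>(\<integral>x. u x \<partial>K z) - u z\<bar> \<le> 1 / real (Suc j)" if z: "z \<in> space S" for z
      proof -
        interpret Kz: prob_space "K z" by (rule prob_space_kernel[OF z])
        have fi: "integrable (K z) (?f k)" for k
          using f01 by (intro Kz.integrable_unit_interval) (simp_all add: measurable_kernel_cong[OF z] space_kernel_eq[OF z])
        have "(\<integral>x. u x \<partial>K z) = (\<Sum>k<n. \<integral>x. ?f (Suc k) x \<partial>K z) / n"
          unfolding u_def cesaro_def using fi by (simp add: Bochner_Integration.integral_sum del: funpow.simps)
        also have "\<dots> = (\<Sum>k<n. ?f (Suc (Suc k)) z) / n"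
          by (simp only: integral_Kop_funpow[OF z A])
        \<comment> \<open>Applying the kernel moves all times of the average by one, so only the two
          extreme terms survive and the error is at most \<open>1 / n\<close>.\<close>
        finally have "(\<integral>x. u x \<partial>K z) - u z = (\<Sum>k<n. ?f (Suc (Suc k)) z - ?f (Suc k) z) / n"
          by (simp only: u_def cesaro_def sum_subtractf diff_divide_distrib)
        also have "\<dots> = (?f (Suc n) z - ?f (Suc 0) z) / n"
          by (simp only: sum_lessThan_telescope[of "\<lambda>k. ?f (Suc k) z" n])
        finally have "\<bar>(\<integral>x. u x \<partial>K z) - u z\<bar> = \<bar>?f (Suc n) z - ?f (Suc 0) z\<bar> / n" by simp
        also have "\<bar>?f (Suc n) z - ?f (Suc 0) z\<bar> \<le> 1"
          using f01[OF z, of "Suc n"] f01[OF z, of "Suc 0"] by linarith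
        then have "\<bar>?f (Suc n) z - ?f (Suc 0) z\<bar> / n \<le> 1 / n"
          by (rule divide_right_mono) simp
        also have "\<dots> \<le> 1 / real (Suc j)" using n by (simp add: frac_le)
        finally show ?thesis .
      qed
      ultimately have "u \<in> U j" using d by (simp add: U_def u_def)
      then show ?thesis by blast
    qed
    show "decseq U"
    proof (rule decseq_SucI, rule subsetI)
      fix j u assume "u \<in> U (Suc j)"
      moreover have "1 / real (Suc (Suc j)) \<le> 1 / real (Suc j)" by (simp add: frac_le)
      ultimately show "u \<in> U j" unfolding U_def by (auto intro: order_trans)
    qed
    show "(\<lambda>x. (u x + v x) / 2) \<in> U j" if u: "u \<in> U j" and v: "v \<in> U j" for j u v
    proof -
      have "\<bar>(\<integral>x. (u x + v x) / 2 \<partial>K z) - (u z + v z) / 2\<bar> \<le> 1 / real (Suc j)" if z: "z \<in> space S" for z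
      proof -
        have "(\<integral>x. (u x + v x) / 2 \<partial>K z) = ((\<integral>x. u x \<partial>K z) + (\<integral>x. v x \<partial>K z)) / 2"
          using int[OF z u] int[OF z v] by simp
        moreover have "\<bar>(\<integral>x. u x \<partial>K z) - u z\<bar> \<le> 1 / real (Suc j)" "\<bar>(\<integral>x. v x \<partial>K z) - v z\<bar> \<le> 1 / real (Suc j)"
          using u v z by (auto simp: U_def)
        ultimately show ?thesis by (simp only: abs_le_iff) (simp add: field_simps)
      qed
      moreover have "0 \<le> (u z + v z) / 2 \<and> (u z + v z) / 2 \<le> 1" if "z \<in> space S" for z
      proof -
        have "0 \<le> u z \<and> u z \<le> 1" "0 \<le> v z \<and> v z \<le> 1" using u v that by (auto simp: U_def)
        then show ?thesis by (simp add: field_simps)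
      qed
      moreover have "\<delta> \<le> (u y + v y) / 2 - (u y' + v y') / 2"
      proof -
        have "\<delta> \<le> u y - u y'" "\<delta> \<le> v y - v y'" using u v by (auto simp: U_def)
        then show ?thesis by (simp add: field_simps)
      qed
      moreover have "(\<lambda>x. (u x + v x) / 2) \<in> borel_measurable S" using u v by (auto simp: U_def)
      ultimately show ?thesis unfolding U_def by blast
    qed
    show "u \<in> borel_measurable \<mu>" if "u \<in> U j" for j u
      using that by (simp add: U_def measurable_cong_sets[OF sets_\<mu> refl])
    show "0 \<le> u x \<and> u x \<le> 1" if "u \<in> U j" "x \<in> space \<mu>" for j u x
      using that by (auto simp: U_def m.space_lam)
  qed
  then obtain h where hU: "\<And>j. h j \<in> U j" and conv: "AE x in \<mu>. convergent (\<lambda>j. h j x)" by blast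
  have h_meas[measurable]: "h j \<in> borel_measurable S" for j using hU[of j] by (simp add: U_def)
  have h01: "0 \<le> h j z" "h j z \<le> 1" if "z \<in> space S" for j z using hU[of j] that by (auto simp: U_def)
  define H where "H z = lim (\<lambda>j. h j z)" for z
  have H_meas[measurable]: "H \<in> borel_measurable S"
    unfolding H_def by (rule borel_measurable_lim_metric) measurable
  \<comment> \<open>\<open>K z\<close> ignores null sets, so the integrals of \<open>h j\<close>
    converge for every \<open>z\<close>; since \<open>h j z\<close> differs from its integral by at
    most \<open>1 / Suc j\<close>, the sequence converges at every point, including \<open>y\<close>
    and \<open>y'\<close>.\<close>
  have hH: "(\<lambda>j. h j z) \<longlonglongrightarrow> (\<integral>x. H x \<partial>K z)" if z: "z \<in> space S" for z
  proof -
    interpret Kz: prob_space "K z" by (rule prob_space_kernel[OF z])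
    have "AE x in K z. (\<lambda>j. h j x) \<longlonglongrightarrow> H x"
      using m.AE_kernel[OF z conv] by eventually_elim (simp add: H_def convergent_LIMSEQ_iff)
    then have 1: "(\<lambda>j. \<integral>x. h j x \<partial>K z) \<longlonglongrightarrow> (\<integral>x. H x \<partial>K z)"
      using h01 by (intro integral_dominated_convergence[where w="\<lambda>_. 1"])
        (auto simp: measurable_kernel_cong[OF z] space_kernel_eq[OF z] intro!: AE_I2)
    have 2: "(\<lambda>j. (\<integral>x. h j x \<partial>K z) - h j z) \<longlonglongrightarrow> 0"
    proof (rule Lim_null_comparison)
      show "\<forall>\<^sub>F j in sequentially. norm ((\<integral>x. h j x \<partial>K z) - h j z) \<le> 1 / real (Suc j)"
        using hU z by (intro always_eventually allI) (auto simp: U_def)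
      show "(\<lambda>j. 1 / real (Suc j)) \<longlonglongrightarrow> 0" by (rule LIMSEQ_Suc[OF lim_1_over_n])
    qed
    from tendsto_diff[OF 1 2] show ?thesis by simp
  qed
  have Hz: "H z = (\<integral>x. H x \<partial>K z)" if z: "z \<in> space S" for z
    unfolding H_def[of z] by (rule limI[OF hH[OF z]])
  have hH': "(\<lambda>j. h j z) \<longlonglongrightarrow> H z" if z: "z \<in> space S" for z
    using hH[OF z] Hz[OF z] by simp
  have "AE z in \<mu>. H z = (\<integral>z. H z \<partial>\<mu>)"
  proof (rule m.harmonic_AE_const[OF H_meas])
    show "0 \<le> H z \<and> H z \<le> 1" if "z \<in> space S" for z
      using LIMSEQ_le_const[OF hH'[OF that], of 0] LIMSEQ_le_const2[OF hH'[OF that], of 1] h01[OF that] by blast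
    show "(\<integral>z. H z \<partial>K z') = H z'" if "z' \<in> space S" for z'
      using Hz[OF that] by simp
    show "(AE z in \<mu>. emeasure (chain z) B = 0) \<or> (AE z in \<mu>. emeasure (chain z) (space paths - B) = 0)"
      if "B \<in> sets paths" "\<And>\<omega>. \<omega> \<in> space paths \<Longrightarrow> (\<lambda>i. \<omega> (Suc i)) \<in> B \<longleftrightarrow> \<omega> \<in> B" for B
      unfolding AE by (rule poisson_boundary_trivial_invariant[OF triv that])
  qed
  \<comment> \<open>\<open>H\<close> is harmonic at every point, so it equals its
    \<open>K z\<close>-average everywhere and almost everywhere constancy becomes constancy.\<close>
  then have const: "H z = (\<integral>z. H z \<partial>\<mu>)" if z: "z \<in> space S" for z
  proof -
    interpret Kz: prob_space "K z" by (rule prob_space_kernel[OF z])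
    have "H z = (\<integral>x. H x \<partial>K z)" by (rule Hz[OF z])
    also have "\<dots> = (\<integral>x. (\<integral>z. H z \<partial>\<mu>) \<partial>K z)"
      using m.AE_kernel[OF z \<open>AE z in \<mu>. H z = (\<integral>z. H z \<partial>\<mu>)\<close>]
      by (intro integral_cong_AE) (auto simp: measurable_kernel_cong[OF z])
    finally show ?thesis by (simp add: Kz.prob_space)
  qed
  have "(\<lambda>j. h j y - h j y') \<longlonglongrightarrow> H y - H y'"
    by (intro tendsto_diff hH' y y')
  moreover have "\<delta> \<le> h j y - h j y'" for j using hU[of j] by (simp add: U_def)
  ultimately have "\<delta> \<le> H y - H y'" by (intro LIMSEQ_le_const) auto
  then show False using const[OF y] const[OF y'] \<delta> by simp
qed

end

section \<open>Distances determined by a countable algebra\<close>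

text \<open>The algebra consists of the sets determined by finitely many members of an enumeration of the generator.\<close>

lemma countable_generating_algebra:
  assumes B: "countable B" "B \<subseteq> Pow \<Omega>"
  shows "\<exists>\<A>. countable \<A> \<and> algebra \<Omega> \<A> \<and> sigma_sets \<Omega> \<A> = sigma_sets \<Omega> B"
proof -
  define b where "b = from_nat_into (insert {} B)"
  have b: "range b = insert {} B"
    unfolding b_def using B(1) by (intro range_from_nat_into) auto
  define pat where "pat n x = map (\<lambda>i. x \<in> b i) [0..<n]" for n :: nat and x
  define A where "A = (\<lambda>(n, qs). {x\<in>\<Omega>. pat n x \<in> set qs})"
  have take_pat: "take n (pat m x) = pat n x" if "n \<le> m" for n m x
    using that by (simp add: pat_def take_map min_def)
  have pat_in: "pat n x \<in> set (List.n_lists n [True, False])" for n x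
    by (auto simp: set_n_lists pat_def)
  have "range A \<subseteq> sigma_sets \<Omega> B"
  proof (clarify)
    fix n and qs :: "bool list list"
    interpret sigma_algebra \<Omega> "sigma_sets \<Omega> B" by (rule sigma_algebra_sigma_sets[OF B(2)])
    have bs: "b i \<in> sigma_sets \<Omega> B" for i
    proof -
      have "b i \<in> insert {} B" using b by blast
      then show ?thesis by (auto intro: sigma_sets.Basic sigma_sets.Empty)
    qed
    have one: "{x\<in>\<Omega>. pat n x = q} \<in> sigma_sets \<Omega> B" for q
    proof (cases "length q = n")
      case True
      have "{x\<in>\<Omega>. pat n x = q} = \<Omega> \<inter> (\<Inter>i\<in>{..<n}. if q ! i then b i else \<Omega> - b i)"
        using True by (auto simp: pat_def list_eq_iff_nth_eq split: if_splits)
      moreover have "\<Omega> \<inter> (\<Inter>i\<in>{..<n}. if q ! i then b i else \<Omega> - b i) \<in> sigma_sets \<Omega> B"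
      proof (cases "n = 0")
        case False
        then show ?thesis using bs by (intro Int finite_INT) auto
      qed simp
      ultimately show ?thesis by simp
    next
      case False
      then have "{x\<in>\<Omega>. pat n x = q} = {}" by (auto simp: pat_def)
      then show ?thesis by (simp only: sigma_sets.Empty)
    qed
    have "A (n, qs) = (\<Union>q\<in>set qs. {x\<in>\<Omega>. pat n x = q})" by (auto simp: A_def)
    also have "\<dots> \<in> sigma_sets \<Omega> B" using one by (intro finite_UN) auto
    finally show "A (n, qs) \<in> sigma_sets \<Omega> B" .
  qed
  moreover have "B \<subseteq> range A"
  proof
    fix X assume "X \<in> B"
    then obtain j where j: "X = b j" using b by blast
    have "pat (Suc j) x ! j \<longleftrightarrow> x \<in> X" for x by (simp add: pat_def j nth_append del: upt_Suc)
    then have "X = A (Suc j, filter (\<lambda>q. q ! j) (List.n_lists (Suc j) [True, False]))"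
      using \<open>X \<in> B\<close> B(2) pat_in[of "Suc j"] by (auto simp: A_def simp del: List.n_lists.simps)
    then show "X \<in> range A" by blast
  qed
  moreover have "algebra \<Omega> (range A)"
    unfolding algebra_iff_Un
  proof (intro conjI ballI)
    show "range A \<subseteq> Pow \<Omega>" by (auto simp: A_def)
    have "{} = A (0, [])" by (simp add: A_def)
    then show "{} \<in> range A" by blast
    show "\<Omega> - X \<in> range A" if "X \<in> range A" for X
    proof -
      obtain n qs where X: "X = A (n, qs)" using \<open>X \<in> range A\<close> by auto
      have "\<Omega> - X = A (n, filter (\<lambda>q. q \<notin> set qs) (List.n_lists n [True, False]))"
        using pat_in[of n] by (auto simp: X A_def)
      then show ?thesis by blast
    qed
    show "X \<union> Y \<in> range A" if XY: "X \<in> range A" "Y \<in> range A" for X Y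
    proof -
      obtain n qs m rs where X: "X = A (n, qs)" and Y: "Y = A (m, rs)" using XY by auto
      let ?k = "max n m"
      have "X \<union> Y = A (?k, filter (\<lambda>q. take n q \<in> set qs \<or> take m q \<in> set rs) (List.n_lists ?k [True, False]))"
        using pat_in[of ?k] by (auto simp: X Y A_def take_pat)
      then show ?thesis by blast
    qed
  qed
  moreover have "countable (range A)" by (rule countable_image) simp
  ultimately have "countable (range A) \<and> algebra \<Omega> (range A) \<and> sigma_sets \<Omega> (range A) = sigma_sets \<Omega> B"
    using sigma_sets_mono[of "range A" \<Omega> B] sigma_sets_mono'[of B "range A" \<Omega>] by blast
  then show ?thesis by blast
qed

text \<open>One \<open>Y\<close> has to serve both measures, since their values on \<open>X\<close>
  will be compared through their values on \<open>Y\<close>. The sets approximable to every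
  precision are closed under complements and countable unions.\<close>

lemma finite_measure_algebra_approximation:
  assumes "algebra \<Omega> \<A>" and M: "finite_measure M" and N: "finite_measure N"
    and sM: "sets M = sigma_sets \<Omega> \<A>" and sN: "sets N = sigma_sets \<Omega> \<A>"
    and X: "X \<in> sigma_sets \<Omega> \<A>" and e: "0 < (e::real)"
  shows "\<exists>Y\<in>\<A>. measure M ((X - Y) \<union> (Y - X)) < e \<and> measure N ((X - Y) \<union> (Y - X)) < e"
proof -
  interpret \<A>: algebra \<Omega> \<A> by fact
  interpret M: finite_measure M by fact
  interpret N: finite_measure N by fact
  have spM: "space M = \<Omega>"
    using sM \<A>.space_closed by (metis sets_eq_imp_space_eq sets_measure_of space_measure_of)
  have spN: "space N = \<Omega>" using sM sN spM by (metis sets_eq_imp_space_eq)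
  note s = sM sN
  have \<A>s: "Y \<in> sigma_sets \<Omega> \<A>" if "Y \<in> \<A>" for Y using that by (rule sigma_sets.Basic)
  interpret S: sigma_algebra \<Omega> "sigma_sets \<Omega> \<A>" by (rule sigma_algebra_sigma_sets[OF \<A>.space_closed])
  have "\<forall>e>0. \<exists>Y\<in>\<A>. measure M ((X - Y) \<union> (Y - X)) < e \<and> measure N ((X - Y) \<union> (Y - X)) < e"
    using X
  proof (induction rule: sigma_sets.induct)
    case (Basic a)
    then show ?case by (auto intro!: bexI[of _ a])
  next
    case Empty
    then show ?case by (auto intro!: bexI[of _ "{}"])
  next
    case (Compl a)
    have a: "a \<subseteq> \<Omega>" using Compl(1) S.space_closed by blast
    show ?case
    proof (intro allI impI)
      fix e :: real assume "0 < e"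
      then obtain Y where Y: "Y \<in> \<A>" "measure M ((a - Y) \<union> (Y - a)) < e" "measure N ((a - Y) \<union> (Y - a)) < e"
        using Compl.IH by blast
      have "(\<Omega> - a - (\<Omega> - Y)) \<union> (\<Omega> - Y - (\<Omega> - a)) = (a - Y) \<union> (Y - a)"
        using a Y(1) \<A>.space_closed by blast
      then show "\<exists>Y\<in>\<A>. measure M ((\<Omega> - a - Y) \<union> (Y - (\<Omega> - a))) < e \<and> measure N ((\<Omega> - a - Y) \<union> (Y - (\<Omega> - a))) < e"
        using Y by (intro bexI[of _ "\<Omega> - Y"]) auto
    qed
  next
    case (Union a)
    show ?case
    proof (intro allI impI)
      fix e :: real assume e: "0 < e"
      have tail: "\<exists>n0. \<forall>n\<ge>n0. measure Q ((\<Union>i. a i) - (\<Union>i<n. a i)) < e / 2"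
        if Q: "finite_measure Q" "sets Q = sigma_sets \<Omega> \<A>" for Q
      proof -
        interpret Q: finite_measure Q by fact
        have "(\<lambda>n. measure Q ((\<Union>i. a i) - (\<Union>i<n. a i))) \<longlonglongrightarrow> measure Q (\<Inter>n. (\<Union>i. a i) - (\<Union>i<n. a i))"
        proof (rule Q.finite_Lim_measure_decseq)
          show "range (\<lambda>n. (\<Union>i. a i) - (\<Union>i<n. a i)) \<subseteq> sets Q"
            using Union(1) Q(2) by auto
          show "decseq (\<lambda>n. (\<Union>i. a i) - (\<Union>i<n. a i))"
            by (auto simp: decseq_def)
        qed
        also have "(\<Inter>n. (\<Union>i. a i) - (\<Union>i<n. a i)) = {}" by auto
        finally have "\<forall>\<^sub>F n in sequentially. measure Q ((\<Union>i. a i) - (\<Union>i<n. a i)) < e / 2"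
          using e by (intro order_tendstoD(2)) auto
        then show ?thesis by (simp add: eventually_sequentially)
      qed
      obtain n1 n2 where n1: "\<forall>n\<ge>n1. measure M ((\<Union>i. a i) - (\<Union>i<n. a i)) < e / 2"
        and n2: "\<forall>n\<ge>n2. measure N ((\<Union>i. a i) - (\<Union>i<n. a i)) < e / 2"
        using tail[OF M sM] tail[OF N sN] by blast
      \<comment> \<open>Half of \<open>e\<close> pays for the tail of the union, the other half is
        shared among \<open>n\<close> sets; \<open>max 1\<close> keeps the share
        \<open>e / (2 * n)\<close> positive.\<close>
      define n where "n = max 1 (max n1 n2)"
      have n: "measure M ((\<Union>i. a i) - (\<Union>i<n. a i)) < e / 2" "measure N ((\<Union>i. a i) - (\<Union>i<n. a i)) < e / 2" "n > 0"
        using n1 n2 by (auto simp: n_def)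
      have "\<forall>i. \<exists>Y. Y \<in> \<A> \<and> measure M ((a i - Y) \<union> (Y - a i)) < e / (2 * n) \<and> measure N ((a i - Y) \<union> (Y - a i)) < e / (2 * n)"
        using Union.IH e n(3) by (metis divide_pos_pos mult_pos_pos of_nat_0_less_iff zero_less_numeral)
      then obtain Y where Y: "\<And>i. Y i \<in> \<A>" "\<And>i. measure M ((a i - Y i) \<union> (Y i - a i)) < e / (2 * n)"
          "\<And>i. measure N ((a i - Y i) \<union> (Y i - a i)) < e / (2 * n)"
        by metis
      let ?Y = "\<Union>i<n. Y i"
      have le: "measure Q (((\<Union>i. a i) - ?Y) \<union> (?Y - (\<Union>i. a i))) < e"
        if Q: "finite_measure Q" "sets Q = sigma_sets \<Omega> \<A>" and t: "measure Q ((\<Union>i. a i) - (\<Union>i<n. a i)) < e / 2"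
          and q: "\<And>i. measure Q ((a i - Y i) \<union> (Y i - a i)) < e / (2 * n)" for Q
      proof -
        interpret Q: finite_measure Q by fact
        have ms: "(a i - Y i) \<union> (Y i - a i) \<in> sets Q" for i using Union(1) Y(1) \<A>s by (simp add: Q(2) S.Diff S.Un)
        have "(\<Union>i. a i) \<in> sets Q" using Union(1) Q(2) by (intro sets.countable_UN) auto
        moreover have "(\<Union>i<n. a i) \<in> sets Q" using Union(1) Q(2) by (intro sets.finite_UN) auto
        ultimately have tQ: "(\<Union>i. a i) - (\<Union>i<n. a i) \<in> sets Q" by (rule sets.Diff)
        have "measure Q (((\<Union>i. a i) - ?Y) \<union> (?Y - (\<Union>i. a i))) \<le>
          measure Q (((\<Union>i. a i) - (\<Union>i<n. a i)) \<union> (\<Union>i<n. (a i - Y i) \<union> (Y i - a i)))"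
        proof (rule Q.finite_measure_mono)
          note tQ
          moreover have "(\<Union>i<n. (a i - Y i) \<union> (Y i - a i)) \<in> sets Q" using ms by (intro sets.finite_UN) auto
          ultimately show "((\<Union>i. a i) - (\<Union>i<n. a i)) \<union> (\<Union>i<n. (a i - Y i) \<union> (Y i - a i)) \<in> sets Q"
            by (rule sets.Un)
        qed auto
        also have "\<dots> \<le> measure Q ((\<Union>i. a i) - (\<Union>i<n. a i)) + measure Q (\<Union>i<n. (a i - Y i) \<union> (Y i - a i))"
        proof (rule measure_Un_le)
          show "(\<Union>i. a i) - (\<Union>i<n. a i) \<in> sets Q" by (rule tQ)
          show "(\<Union>i<n. (a i - Y i) \<union> (Y i - a i)) \<in> sets Q" using ms by (intro sets.finite_UN) auto
        qed
        also have "measure Q (\<Union>i<n. (a i - Y i) \<union> (Y i - a i)) \<le> (\<Sum>i<n. measure Q ((a i - Y i) \<union> (Y i - a i)))"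
          using ms by (intro Q.finite_measure_subadditive_finite) auto
        also have "\<dots> \<le> (\<Sum>i<n. e / (2 * n))" using q by (intro sum_mono less_imp_le)
        also have "\<dots> = e / 2" using n(3) by simp
        finally show ?thesis using t by simp
      qed
      have "?Y \<in> \<A>" using Y(1) by (intro \<A>.finite_UN) auto
      then show "\<exists>Y\<in>\<A>. measure M (((\<Union>i. a i) - Y) \<union> (Y - (\<Union>i. a i))) < e \<and> measure N (((\<Union>i. a i) - Y) \<union> (Y - (\<Union>i. a i))) < e"
        using le[OF M sM n(1) Y(2)] le[OF N sN n(2) Y(3)] by blast
    qed
  qed
  then show ?thesis using e by blast
qed

text \<open>For a generating algebra and probability measures this agrees with total variation up to
  a factor between 1 and 2. Over a countable algebra the supremum is countable, hence measurable in
  parameters.\<close>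

definition sup_dist :: "'a set set \<Rightarrow> 'a measure \<Rightarrow> 'a measure \<Rightarrow> ennreal" where
  "sup_dist \<A> \<alpha> \<beta> = (SUP A\<in>\<A>. ennreal \<bar>measure \<alpha> A - measure \<beta> A\<bar>)"

lemma sup_dist_commute: "sup_dist \<A> \<alpha> \<beta> = sup_dist \<A> \<beta> \<alpha>"
  by (simp add: sup_dist_def abs_minus_commute)

locale countably_generated_pair =
  fixes \<A> :: "'a set set" and \<alpha> \<beta> :: "'a measure"
  assumes alg: "algebra (space \<alpha>) \<A>" and gen: "sets \<alpha> = sigma_sets (space \<alpha>) \<A>"
    and sets_eq: "sets \<beta> = sets \<alpha>" and prob_\<alpha>: "prob_space \<alpha>" and prob_\<beta>: "prob_space \<beta>"
begin

sublocale \<alpha>: prob_space \<alpha> by (rule prob_\<alpha>)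
sublocale \<beta>: prob_space \<beta> by (rule prob_\<beta>)

lemma space_eq: "space \<beta> = space \<alpha>" using sets_eq_imp_space_eq[OF sets_eq] .

lemma measure_diff_le_sup_dist:
  assumes X: "X \<in> sets \<alpha>" shows "ennreal \<bar>measure \<alpha> X - measure \<beta> X\<bar> \<le> sup_dist \<A> \<alpha> \<beta>"
proof (rule ennreal_le_epsilon)
  fix e :: real assume "0 < e"
  then obtain Y where Y: "Y \<in> \<A>" "measure \<alpha> ((X - Y) \<union> (Y - X)) < e / 2" "measure \<beta> ((X - Y) \<union> (Y - X)) < e / 2"
    using finite_measure_algebra_approximation[OF alg \<alpha>.finite_measure_axioms \<beta>.finite_measure_axioms, of X "e / 2"]
      gen sets_eq X by auto
  have Ys: "Y \<in> sets \<alpha>" using Y(1) gen by (auto intro: sigma_sets.Basic)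
  have d: "\<bar>measure Q X - measure Q Y\<bar> \<le> measure Q ((X - Y) \<union> (Y - X))"
    if Q: "prob_space Q" "sets Q = sets \<alpha>" for Q
  proof -
    interpret Q: prob_space Q by fact
    have s: "X \<in> sets Q" "Y \<in> sets Q" using Q X Ys by auto
    have "measure Q X = measure Q (X - Y) + measure Q (X \<inter> Y)"
      using s Q.finite_measure_Union[of "X - Y" "X \<inter> Y"] by (simp add: Un_Diff_Int Diff_Int_distrib) (metis Diff_disjoint Int_Diff Un_Diff_Int inf_commute sets.Diff sets.Int)
    moreover have "measure Q Y = measure Q (Y - X) + measure Q (X \<inter> Y)"
      using s Q.finite_measure_Union[of "Y - X" "Y \<inter> X"] by (simp add: Un_Diff_Int Int_commute) (metis Diff_disjoint Int_Diff Un_Diff_Int inf_commute sets.Diff sets.Int)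
    moreover have "measure Q ((X - Y) \<union> (Y - X)) = measure Q (X - Y) + measure Q (Y - X)"
      using s by (intro Q.finite_measure_Union) auto
    ultimately show ?thesis using measure_nonneg[of Q "X - Y"] measure_nonneg[of Q "Y - X"] by linarith
  qed
  have "\<bar>measure \<alpha> X - measure \<beta> X\<bar> \<le> \<bar>measure \<alpha> Y - measure \<beta> Y\<bar> + e"
    using d[OF prob_\<alpha> refl] d[OF prob_\<beta> sets_eq] Y(2,3) by linarith
  then have "ennreal \<bar>measure \<alpha> X - measure \<beta> X\<bar> \<le> ennreal (\<bar>measure \<alpha> Y - measure \<beta> Y\<bar> + e)"
    by (rule ennreal_leI)
  also have "\<dots> = ennreal \<bar>measure \<alpha> Y - measure \<beta> Y\<bar> + ennreal e"
    using \<open>0 < e\<close> by (intro ennreal_plus) auto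
  also have "\<dots> \<le> sup_dist \<A> \<alpha> \<beta> + ennreal e"
    unfolding sup_dist_def by (intro add_right_mono SUP_upper Y(1))
  finally show "ennreal \<bar>measure \<alpha> X - measure \<beta> X\<bar> \<le> sup_dist \<A> \<alpha> \<beta> + ennreal e" .
qed

lemma sup_dist_le_tv_dist: "sup_dist \<A> \<alpha> \<beta> \<le> tv_dist \<alpha> \<beta>"
  unfolding sup_dist_def
proof (rule SUP_least)
  fix A assume "A \<in> \<A>"
  then have A: "A \<in> sets \<alpha>" using gen by (auto intro: sigma_sets.Basic)
  show "ennreal \<bar>measure \<alpha> A - measure \<beta> A\<bar> \<le> tv_dist \<alpha> \<beta>"
  proof (cases "A = {} \<or> A = space \<alpha>")
    case True
    then have "measure \<alpha> A - measure \<beta> A = 0" using \<alpha>.prob_space \<beta>.prob_space space_eq by auto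
    then show ?thesis by simp
  next
    case False
    let ?P = "{A, space \<alpha> - A}"
    have P: "partition_on (space \<alpha>) ?P"
      using False sets.sets_into_space[OF A] by (auto simp: partition_on_def disjoint_def)
    have ne: "A \<noteq> space \<alpha> - A" using False by blast
    have "ennreal \<bar>measure \<alpha> A - measure \<beta> A\<bar> \<le> ennreal (\<Sum>A\<in>?P. \<bar>measure \<alpha> A - measure \<beta> A\<bar>)"
      using ne by (intro ennreal_leI) simp
    also have "\<dots> \<le> tv_dist \<alpha> \<beta>"
      unfolding tv_dist_def using A P by (intro SUP_upper) auto
    finally show ?thesis .
  qed
qed

text \<open>The pieces of a partition on which \<open>\<alpha>\<close> dominates are merged into one
  set, the remaining ones into another; each of the two sets costs at most one supremum.\<close>

lemma tv_dist_le_sup_dist: "tv_dist \<alpha> \<beta> \<le> 2 * sup_dist \<A> \<alpha> \<beta>"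
  unfolding tv_dist_def
proof (rule SUP_least)
  fix P assume "P \<in> {P. finite P \<and> P \<subseteq> sets \<alpha> \<and> partition_on (space \<alpha>) P}"
  then have P: "finite P" "P \<subseteq> sets \<alpha>" "disjoint P" by (auto simp: partition_on_def)
  define P1 where "P1 = {A\<in>P. measure \<alpha> A \<ge> measure \<beta> A}"
  define P2 where "P2 = {A\<in>P. measure \<alpha> A < measure \<beta> A}"
  have PP: "P = P1 \<union> P2" "P1 \<inter> P2 = {}" by (auto simp: P1_def P2_def)
  have m: "measure Q (\<Union>R) = (\<Sum>A\<in>R. measure Q A)" if "R \<subseteq> P" "prob_space Q" "sets Q = sets \<alpha>" for Q R
  proof -
    interpret Q: prob_space Q by fact
    have "disjoint_family_on (\<lambda>A. A) R"
      unfolding disjoint_family_on_def using disjointD[OF P(3)] that(1) by blast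
    then have "measure Q (\<Union>A\<in>R. A) = (\<Sum>A\<in>R. measure Q A)"
      using that P(2) finite_subset[OF \<open>R \<subseteq> P\<close> P(1)]
      by (intro Q.finite_measure_finite_Union) auto
    then show ?thesis by simp
  qed
  have U: "\<Union>P1 \<in> sets \<alpha>" "\<Union>P2 \<in> sets \<alpha>"
    using P by (auto simp: P1_def P2_def intro!: sets.finite_Union)
  have "(\<Sum>A\<in>P. \<bar>measure \<alpha> A - measure \<beta> A\<bar>) =
      (\<Sum>A\<in>P1. \<bar>measure \<alpha> A - measure \<beta> A\<bar>) + (\<Sum>A\<in>P2. \<bar>measure \<alpha> A - measure \<beta> A\<bar>)"
    using P(1) PP(2) unfolding PP(1) by (intro sum.union_disjoint) (auto simp: PP(1))
  also have "(\<Sum>A\<in>P1. \<bar>measure \<alpha> A - measure \<beta> A\<bar>) = (\<Sum>A\<in>P1. measure \<alpha> A - measure \<beta> A)"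
    by (intro sum.cong) (auto simp: P1_def)
  also have "\<dots> = measure \<alpha> (\<Union>P1) - measure \<beta> (\<Union>P1)"
    using m[of P1 \<alpha>] m[of P1 \<beta>] PP(1) prob_\<alpha> prob_\<beta> sets_eq by (simp add: sum_subtractf)
  also have "(\<Sum>A\<in>P2. \<bar>measure \<alpha> A - measure \<beta> A\<bar>) = (\<Sum>A\<in>P2. measure \<beta> A - measure \<alpha> A)"
    by (intro sum.cong) (auto simp: P2_def)
  also have "\<dots> = measure \<beta> (\<Union>P2) - measure \<alpha> (\<Union>P2)"
    using m[of P2 \<alpha>] m[of P2 \<beta>] PP(1) prob_\<alpha> prob_\<beta> sets_eq by (simp add: sum_subtractf)
  finally have "(\<Sum>A\<in>P. \<bar>measure \<alpha> A - measure \<beta> A\<bar>) \<le>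
    \<bar>measure \<alpha> (\<Union>P1) - measure \<beta> (\<Union>P1)\<bar> + \<bar>measure \<alpha> (\<Union>P2) - measure \<beta> (\<Union>P2)\<bar>" by linarith
  then have "ennreal (\<Sum>A\<in>P. \<bar>measure \<alpha> A - measure \<beta> A\<bar>) \<le>
    ennreal (\<bar>measure \<alpha> (\<Union>P1) - measure \<beta> (\<Union>P1)\<bar> + \<bar>measure \<alpha> (\<Union>P2) - measure \<beta> (\<Union>P2)\<bar>)"
    by (rule ennreal_leI)
  also have "\<dots> = ennreal \<bar>measure \<alpha> (\<Union>P1) - measure \<beta> (\<Union>P1)\<bar> + ennreal \<bar>measure \<alpha> (\<Union>P2) - measure \<beta> (\<Union>P2)\<bar>"
    by (rule ennreal_plus) auto
  also have "\<dots> \<le> sup_dist \<A> \<alpha> \<beta> + sup_dist \<A> \<alpha> \<beta>"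
    by (intro add_mono measure_diff_le_sup_dist U)
  finally show "ennreal (\<Sum>A\<in>P. \<bar>measure \<alpha> A - measure \<beta> A\<bar>) \<le> 2 * sup_dist \<A> \<alpha> \<beta>"
    by (simp add: mult_2)
qed

text \<open>The integrand is compared with \<open>card {i. i < n * h x}\<close>, a sum of indicators exceeding it by at most \<open>1\<close>.\<close>

lemma nn_integral_le_sup_dist:
  assumes h[measurable]: "h \<in> borel_measurable \<alpha>" and h1: "\<And>x. x \<in> space \<alpha> \<Longrightarrow> h x \<le> 1"
  shows "(\<integral>\<^sup>+x. h x \<partial>\<alpha>) \<le> (\<integral>\<^sup>+x. h x \<partial>\<beta>) + sup_dist \<A> \<alpha> \<beta>"
proof (rule ennreal_le_epsilon)
  fix e :: real assume e: "0 < e"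
  note [measurable_cong] = sets_eq
  obtain n0 :: nat where n0: "1 / e < n0" using reals_Archimedean2 by blast
  define n where "n = Suc n0"
  have n: "0 < n" "1 / real n \<le> e"
  proof -
    show "0 < n" by (simp add: n_def)
    have "1 / e < n" using n0 by (simp add: n_def)
    then show "1 / real n \<le> e" using e \<open>0 < n\<close> by (simp add: field_simps)
  qed
  define A where "A i = {x\<in>space \<alpha>. of_nat i < of_nat n * h x}" for i
  have As[measurable]: "A i \<in> sets \<alpha>" for i unfolding A_def by measurable
  have As': "A i \<in> sets \<beta>" for i using As sets_eq by simp
  have cnt: "of_nat n * h x \<le> (\<Sum>i<n. indicator (A i) x) \<and> (\<Sum>i<n. indicator (A i) x) \<le> of_nat n * h x + 1"
    if x: "x \<in> space \<alpha>" for x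
  proof -
    have "h x < top" using h1[OF x] by (rule le_less_trans) simp
    then obtain r where r: "h x = ennreal r" "0 \<le> r" by (cases "h x") auto
    have r1: "r \<le> 1" using h1[OF x] r by simp
    define s where "s = real n * r"
    have s: "0 \<le> s" "s \<le> n" using r r1 by (auto simp: s_def mult_left_le)
    have nh: "of_nat n * h x = ennreal s"
      using r by (simp add: s_def ennreal_mult ennreal_of_nat_eq_real_of_nat)
    have "(\<Sum>i<n. indicator (A i) x :: ennreal) = of_nat (card {i. i < n \<and> real i < s})"
    proof -
      have "x \<in> A i \<longleftrightarrow> real i < s" for i
      proof -
        have "x \<in> A i \<longleftrightarrow> (of_nat i :: ennreal) < of_nat n * h x"
          by (simp only: A_def mem_Collect_eq x simp_thms)
        then show ?thesis unfolding nh by (simp add: ennreal_of_nat_eq_real_of_nat ennreal_less_iff)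
      qed
      then have "(\<Sum>i<n. indicator (A i) x :: ennreal) = (\<Sum>i<n. if real i < s then 1 else 0)"
        by (intro sum.cong) (auto simp: indicator_def)
      also have "\<dots> = of_nat (card ({..<n} \<inter> {i. real i < s}))" by (simp add: sum.If_cases)
      also have "{..<n} \<inter> {i. real i < s} = {i. i < n \<and> real i < s}" by auto
      finally show ?thesis .
    qed
    \<comment> \<open>As \<open>s \<le> n\<close>, the bound \<open>i < n\<close> is automatic, and
      the count is the ceiling of \<open>s\<close>, between \<open>s\<close> and
      \<open>s + 1\<close>.\<close>
    also have "{i. i < n \<and> real i < s} = {..<nat \<lceil>s\<rceil>}"
    proof -
      have "i < n \<and> real i < s \<longleftrightarrow> i < nat \<lceil>s\<rceil>" for i
      proof -
        have "i < nat \<lceil>s\<rceil> \<longleftrightarrow> real i < s" by (simp add: zless_nat_eq_int_zless less_ceiling_iff)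
        moreover have "real i < s \<Longrightarrow> i < n" using s by linarith
        ultimately show ?thesis by blast
      qed
      then show ?thesis by auto
    qed
    finally have eq: "(\<Sum>i<n. indicator (A i) x :: ennreal) = ennreal (real (nat \<lceil>s\<rceil>))"
      by (simp add: ennreal_of_nat_eq_real_of_nat)
    have "s \<le> real (nat \<lceil>s\<rceil>)" "real (nat \<lceil>s\<rceil>) \<le> s + 1" using s by linarith+
    then have "ennreal s \<le> ennreal (real (nat \<lceil>s\<rceil>))" "ennreal (real (nat \<lceil>s\<rceil>)) \<le> ennreal (s + 1)"
      by (auto intro: ennreal_leI simp del: of_nat_nat)
    moreover have "ennreal (s + 1) = ennreal s + 1" using s by simp
    ultimately show ?thesis unfolding eq nh by (simp only: simp_thms)
  qed
  have "of_nat n * (\<integral>\<^sup>+x. h x \<partial>\<alpha>) = (\<integral>\<^sup>+x. of_nat n * h x \<partial>\<alpha>)"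
    by (rule nn_integral_cmult[symmetric]) measurable
  also have "\<dots> \<le> (\<integral>\<^sup>+x. (\<Sum>i<n. indicator (A i) x) \<partial>\<alpha>)" using cnt by (intro nn_integral_mono) blast
  also have "\<dots> = (\<Sum>i<n. emeasure \<alpha> (A i))"
    by (subst nn_integral_sum) simp_all
  also have "\<dots> \<le> (\<Sum>i<n. emeasure \<beta> (A i) + sup_dist \<A> \<alpha> \<beta>)"
  proof (rule sum_mono)
    fix i
    have "measure \<alpha> (A i) \<le> measure \<beta> (A i) + \<bar>measure \<alpha> (A i) - measure \<beta> (A i)\<bar>" by linarith
    then have "ennreal (measure \<alpha> (A i)) \<le> ennreal (measure \<beta> (A i)) + ennreal \<bar>measure \<alpha> (A i) - measure \<beta> (A i)\<bar>"
      by (metis abs_ge_zero ennreal_leI ennreal_plus measure_nonneg)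
    then show "emeasure \<alpha> (A i) \<le> emeasure \<beta> (A i) + sup_dist \<A> \<alpha> \<beta>"
      unfolding \<alpha>.emeasure_eq_measure \<beta>.emeasure_eq_measure
      by (rule order_trans) (intro add_left_mono measure_diff_le_sup_dist As)
  qed
  also have "\<dots> = (\<integral>\<^sup>+x. (\<Sum>i<n. indicator (A i) x) \<partial>\<beta>) + of_nat n * sup_dist \<A> \<alpha> \<beta>"
    using As' by (subst nn_integral_sum) (simp_all add: sum.distrib)
  also have "\<dots> \<le> (\<integral>\<^sup>+x. of_nat n * h x + 1 \<partial>\<beta>) + of_nat n * sup_dist \<A> \<alpha> \<beta>"
    using cnt space_eq by (intro add_right_mono nn_integral_mono) simp
  also have "(\<integral>\<^sup>+x. of_nat n * h x + 1 \<partial>\<beta>) = of_nat n * (\<integral>\<^sup>+x. h x \<partial>\<beta>) + 1"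
    by (subst nn_integral_add) (simp_all add: nn_integral_cmult \<beta>.emeasure_space_1)
  also have "1 = of_nat n * ennreal (1 / n)"
    using n(1) by (simp add: ennreal_of_nat_eq_real_of_nat flip: ennreal_mult)
  finally have "of_nat n * (\<integral>\<^sup>+x. h x \<partial>\<alpha>) \<le> of_nat n * ((\<integral>\<^sup>+x. h x \<partial>\<beta>) + sup_dist \<A> \<alpha> \<beta> + ennreal (1 / n))"
    by (simp add: distrib_left ac_simps)
  then have "(\<integral>\<^sup>+x. h x \<partial>\<alpha>) \<le> (\<integral>\<^sup>+x. h x \<partial>\<beta>) + sup_dist \<A> \<alpha> \<beta> + ennreal (1 / n)"
    using n(1) by (subst (asm) ennreal_mult_le_mult_iff) auto
  also have "\<dots> \<le> (\<integral>\<^sup>+x. h x \<partial>\<beta>) + sup_dist \<A> \<alpha> \<beta> + ennreal e"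
    by (intro add_left_mono ennreal_leI n)
  finally show "(\<integral>\<^sup>+x. h x \<partial>\<alpha>) \<le> (\<integral>\<^sup>+x. h x \<partial>\<beta>) + sup_dist \<A> \<alpha> \<beta> + ennreal e" .
qed

end

section \<open>Equivariant kernels on a measured groupoid\<close>

context measured_groupoid
begin

abbreviation arr :: "'a measure" where "arr \<equiv> arrows G"

abbreviation star :: "'a measure" where "star \<equiv> star_measure G lam kap"

section \<open>Null sets and measurability on the space of arrows\<close>

lemma space_arr: "space arr = mor G"
  by (simp add: mor_def)

lemma object_mor: "x \<in> objects G \<Longrightarrow> x \<in> mor G"
  using objects_subset by blast

lemma space_obj: "space (obj_space G) = objects G"
  using objects_subset by (auto simp: obj_space_def space_restrict_space space_arr)

lemma space_kap: "space kap = objects G"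
  using sets_eq_imp_space_eq[OF sets_kap] space_obj by simp

lemma fibred_lam: "fibred_system G lam"
  using haar by (simp add: haar_system_def)

lemma lam_invariant: "g \<in> mor G \<Longrightarrow> translate G g (lam (source G g)) = lam (target G g)"
  using haar by (simp add: haar_system_def)

lemma fibred_systemD:
  assumes "fibred_system G \<theta>" "x \<in> objects G"
  shows "sets (\<theta> x) = sets arr" "space (\<theta> x) = mor G" "AE g in \<theta> x. g \<in> fibre G x"
proof -
  show "sets (\<theta> x) = sets arr" "AE g in \<theta> x. g \<in> fibre G x"
    using assms by (simp_all add: fibred_system_def)
  then show "space (\<theta> x) = mor G" using sets_eq_imp_space_eq space_arr by metis
qed

lemma fibred_system_measurable:
  fixes f :: "'a \<Rightarrow> ennreal"
  assumes "fibred_system G \<theta>" "f \<in> borel_measurable arr"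
  shows "(\<lambda>x. \<integral>\<^sup>+g. f g \<partial>\<theta> x) \<in> borel_measurable (obj_space G)"
  using assms by (simp add: fibred_system_def)

lemma sets_star: "sets star = sets arr"
  unfolding star_measure_def by (simp add: sets.space_closed)

lemma space_star: "space star = mor G"
  using sets_eq_imp_space_eq[OF sets_star] space_arr by simp

lemma measurable_lam:
  assumes A: "A \<in> sets arr" shows "(\<lambda>x. emeasure (lam x) A) \<in> borel_measurable kap"
proof -
  have "(\<lambda>x. \<integral>\<^sup>+g. indicator A g \<partial>lam x) \<in> borel_measurable kap"
    using fibred_system_measurable[OF fibred_lam, of "indicator A"] A
    by (simp add: measurable_cong_sets[OF sets_kap refl])
  then show ?thesis
    by (subst (asm) measurable_cong[of kap _ "\<lambda>x. emeasure (lam x) A"])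
      (use A fibred_systemD(1)[OF fibred_lam] space_kap in auto)
qed

lemma emeasure_star:
  assumes "A \<in> sets arr" shows "emeasure star A = (\<integral>\<^sup>+x. emeasure (lam x) A \<partial>kap)"
proof (rule emeasure_measure_of[OF star_measure_def])
  show "sets arr \<subseteq> Pow (space arr)" by (rule sets.space_closed)
  show "positive (sets star) (\<lambda>A. \<integral>\<^sup>+x. emeasure (lam x) A \<partial>kap)" by (simp add: positive_def)
  show "countably_additive (sets star) (\<lambda>A. \<integral>\<^sup>+x. emeasure (lam x) A \<partial>kap)"
  proof (rule countably_additiveI)
    fix A :: "nat \<Rightarrow> 'a set"
    assume A: "range A \<subseteq> sets star" "disjoint_family A"
    then have As: "A i \<in> sets arr" for i by (auto simp: sets_star)
    have "(\<Sum>i. \<integral>\<^sup>+x. emeasure (lam x) (A i) \<partial>kap) = (\<integral>\<^sup>+x. (\<Sum>i. emeasure (lam x) (A i)) \<partial>kap)"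
      by (intro nn_integral_suminf[symmetric] measurable_lam As)
    also have "\<dots> = (\<integral>\<^sup>+x. emeasure (lam x) (\<Union>i. A i) \<partial>kap)"
    proof (rule nn_integral_cong)
      fix x assume "x \<in> space kap"
      then have "sets (lam x) = sets arr" using fibred_systemD(1)[OF fibred_lam] space_kap by simp
      then show "(\<Sum>i. emeasure (lam x) (A i)) = emeasure (lam x) (\<Union>i. A i)"
        using As A(2) by (intro suminf_emeasure) auto
    qed
    finally show "(\<Sum>i. \<integral>\<^sup>+x. emeasure (lam x) (A i) \<partial>kap) = (\<integral>\<^sup>+x. emeasure (lam x) (\<Union>i. A i) \<partial>kap)" .
  qed
qed (simp add: sets_star assms)

lemma null_sets_star_iff:
  assumes "A \<in> sets arr" shows "A \<in> null_sets star \<longleftrightarrow> (AE x in kap. emeasure (lam x) A = 0)"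
proof -
  have "A \<in> null_sets star \<longleftrightarrow> emeasure star A = 0" using assms by (simp add: null_sets_def sets_star)
  also have "\<dots> \<longleftrightarrow> (\<integral>\<^sup>+x. emeasure (lam x) A \<partial>kap) = 0" by (simp only: emeasure_star[OF assms])
  also have "\<dots> \<longleftrightarrow> (AE x in kap. emeasure (lam x) A = 0)"
    by (rule nn_integral_0_iff_AE[OF measurable_lam[OF assms]])
  finally show ?thesis .
qed

lemma AE_star_AE_lam:
  assumes "AE g in star. Q g" shows "AE x in kap. AE g in lam x. Q g"
proof -
  obtain N where N: "N \<in> null_sets star" "{g\<in>space star. \<not> Q g} \<subseteq> N"
    using assms unfolding eventually_ae_filter by blast
  then have Ns: "N \<in> sets arr" by (auto simp: sets_star[symmetric])
  from N(1) null_sets_star_iff[OF Ns] have "AE x in kap. emeasure (lam x) N = 0" by simp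
  with AE_space show ?thesis
  proof eventually_elim
    case (elim x)
    then have x: "x \<in> objects G" by (simp add: space_kap)
    note D = fibred_systemD[OF fibred_lam x]
    have "N \<in> null_sets (lam x)" using elim(2) Ns by (simp add: null_sets_def D)
    then show ?case by (rule AE_I') (use N(2) in \<open>auto simp: D space_star\<close>)
  qed
qed

text \<open>\<open>lam x\<close> is carried by the fibre over \<open>x\<close>, so it gives no mass
  to a set missing that fibre. This is the passage from null sets of objects to null sets of
  arrows.\<close>

lemma AE_lam_target_imp_star:
  assumes A: "A \<in> sets arr" and AE: "AE x in kap. \<forall>g\<in>fibre G x. g \<notin> A"
  shows "A \<in> null_sets star"
  unfolding null_sets_star_iff[OF A] using AE AE_space
proof eventually_elim
  case (elim x)
  then have x: "x \<in> objects G" by (simp add: space_kap)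
  note D = fibred_systemD[OF fibred_lam x]
  have "AE g in lam x. g \<notin> A" using D(3) by eventually_elim (use elim in auto)
  then show ?case using AE_iff_measurable[of A "lam x" "\<lambda>g. g \<notin> A"] A D sets.sets_into_space[OF A]
    by (auto simp: space_arr)
qed

text \<open>Taken from the Rokhlin property of \<open>star\<close>, whose sigma-algebra is that of
  the arrows.\<close>

lemma countable_separating_generator:
  "\<exists>B. countable B \<and> B \<subseteq> Pow (mor G) \<and> sets arr = sigma_sets (mor G) B \<and>
    (\<forall>x\<in>mor G. \<forall>y\<in>mor G. x \<noteq> y \<longrightarrow> (\<exists>b\<in>B. (x \<in> b) \<noteq> (y \<in> b)))"
proof -
  have "\<exists>B. countable B \<and> sets star = sigma_sets (space star) B \<and>
     (\<forall>x\<in>space star. \<forall>y\<in>space star. x \<noteq> y \<longrightarrow> (\<exists>b\<in>B. (x \<in> b) \<noteq> (y \<in> b)))"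
    using rokhlin_arrows unfolding lebesgue_rokhlin_def by (elim conjE)
  then obtain B where B: "countable B" "sets arr = sigma_sets (mor G) B"
    and sep: "\<forall>x\<in>mor G. \<forall>y\<in>mor G. x \<noteq> y \<longrightarrow> (\<exists>b\<in>B. (x \<in> b) \<noteq> (y \<in> b))"
    unfolding space_star sets_star by (elim exE conjE)
  have "B \<subseteq> sets arr" unfolding B(2) by (rule subsetI) (rule sigma_sets.Basic)
  then have "B \<subseteq> Pow (mor G)" using sets.space_closed[of arr] unfolding space_arr by (rule order_trans)
  with B sep show ?thesis by (intro exI[of _ B] conjI)
qed

text \<open>Countable separation of points writes the complement of the diagonal as a countable
  union of measurable rectangles. Measurability of the fibres and of the composable pairs rests on
  this.\<close>

lemma diagonal_sets: "{p \<in> space (arr \<Otimes>\<^sub>M arr). fst p = snd p} \<in> sets (arr \<Otimes>\<^sub>M arr)"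
proof -
  obtain B where B: "countable B" "sets arr = sigma_sets (mor G) B" "B \<subseteq> Pow (mor G)"
    "\<forall>x\<in>mor G. \<forall>y\<in>mor G. x \<noteq> y \<longrightarrow> (\<exists>b\<in>B. (x \<in> b) \<noteq> (y \<in> b))"
    using countable_separating_generator by (elim exE conjE)
  have Bs: "b \<in> sets arr" if "b \<in> B" for b using that B(2) by (simp add: sigma_sets.Basic)
  let ?U = "\<Union>b\<in>B. (b \<times> (mor G - b)) \<union> ((mor G - b) \<times> b)"
  have sp: "mor G \<in> sets arr" using sets.top[of arr] by (simp add: space_arr)
  have "?U \<in> sets (arr \<Otimes>\<^sub>M arr)"
    by (rule sets.countable_UN''[OF B(1)]) (intro sets.Un pair_measureI sets.Diff sp Bs)
  moreover have "{p \<in> space (arr \<Otimes>\<^sub>M arr). fst p = snd p} = space (arr \<Otimes>\<^sub>M arr) - ?U"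
  proof (intro set_eqI iffI)
    fix p assume p: "p \<in> space (arr \<Otimes>\<^sub>M arr) - ?U"
    then have ab: "fst p \<in> mor G" "snd p \<in> mor G" by (simp_all add: space_pair_measure space_arr mem_Times_iff)
    have "fst p = snd p"
    proof (rule ccontr)
      assume "fst p \<noteq> snd p"
      then obtain b where b: "b \<in> B" "(fst p \<in> b) \<noteq> (snd p \<in> b)" using B(4) ab by blast
      then have "(fst p, snd p) \<in> (b \<times> (mor G - b)) \<union> ((mor G - b) \<times> b)" using ab by blast
      then have "p \<in> (b \<times> (mor G - b)) \<union> ((mor G - b) \<times> b)" by simp
      then show False using p b(1) by blast
    qed
    then show "p \<in> {p \<in> space (arr \<Otimes>\<^sub>M arr). fst p = snd p}" using p by simp
  next
    fix p assume p: "p \<in> {p \<in> space (arr \<Otimes>\<^sub>M arr). fst p = snd p}"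
    then have "p \<notin> ?U" by (simp add: mem_Times_iff)
    then show "p \<in> space (arr \<Otimes>\<^sub>M arr) - ?U" using p by simp
  qed
  ultimately show ?thesis by simp
qed

lemma equality_sets:
  assumes f[measurable]: "f \<in> N \<rightarrow>\<^sub>M arr" and g[measurable]: "g \<in> N \<rightarrow>\<^sub>M arr"
  shows "{x\<in>space N. f x = g x} \<in> sets N"
proof -
  have "(\<lambda>x. (f x, g x)) -` {p \<in> space (arr \<Otimes>\<^sub>M arr). fst p = snd p} \<inter> space N \<in> sets N"
    by (rule measurable_sets[OF _ diagonal_sets]) measurable
  also have "(\<lambda>x. (f x, g x)) -` {p \<in> space (arr \<Otimes>\<^sub>M arr). fst p = snd p} \<inter> space N = {x\<in>space N. f x = g x}"
    using measurable_space[OF f] measurable_space[OF g] by (auto simp: space_pair_measure)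
  finally show ?thesis .
qed

lemma target_arr[measurable]: "target G \<in> arr \<rightarrow>\<^sub>M arr"
  using measurable_compose[OF target_measurable unit_measurable] .

lemma source_arr[measurable]: "source G \<in> arr \<rightarrow>\<^sub>M arr"
  using measurable_compose[OF source_measurable unit_measurable] .

lemma fibre_sets[measurable]: "x \<in> mor G \<Longrightarrow> fibre G x \<in> sets arr"
  using equality_sets[OF target_arr measurable_const[of x]] by (simp add: fibre_def space_arr)

lemma composable_sets[measurable]: "composable G \<in> sets (arr \<Otimes>\<^sub>M arr)"
proof -
  have "{p\<in>space (arr \<Otimes>\<^sub>M arr). source G (fst p) = target G (snd p)} \<in> sets (arr \<Otimes>\<^sub>M arr)"
    by (rule equality_sets) measurable
  also have "{p\<in>space (arr \<Otimes>\<^sub>M arr). source G (fst p) = target G (snd p)} = composable G"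
    by (auto simp: composable_def space_pair_measure space_arr)
  finally show ?thesis .
qed

text \<open>The dual of \<open>translate\<close>: integrating \<open>f\<close> against the translate
  of \<open>\<alpha>\<close> is integrating \<open>lshift g f\<close> against
  \<open>\<alpha>\<close>. The value 0 off composable pairs mirrors the restriction in
  \<open>translate\<close>.\<close>

definition lshift :: "'a \<Rightarrow> ('a \<Rightarrow> ennreal) \<Rightarrow> 'a \<Rightarrow> ennreal" where
  "lshift g f h = (if (g, h) \<in> composable G then f (gmult G g h) else 0)"

lemma lshift_pair_measurable:
  assumes [measurable]: "f \<in> borel_measurable arr"
  shows "(\<lambda>(g, h). lshift g f h) \<in> borel_measurable (arr \<Otimes>\<^sub>M arr)"
proof -
  have "(\<lambda>p. f (case p of (g, h) \<Rightarrow> gmult G g h)) \<in> borel_measurable (restrict_space (arr \<Otimes>\<^sub>M arr) (composable G))"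
    by (rule measurable_compose[OF mult_measurable assms])
  then have "(\<lambda>p. if p \<in> composable G then f (case p of (g, h) \<Rightarrow> gmult G g h) else 0) \<in> borel_measurable (arr \<Otimes>\<^sub>M arr)"
    by (subst (asm) measurable_restrict_space_iff[where c=0]) auto
  also have "(\<lambda>p. if p \<in> composable G then f (case p of (g, h) \<Rightarrow> gmult G g h) else 0) = (\<lambda>(g, h). lshift g f h)"
    by (auto simp: lshift_def fun_eq_iff)
  finally show ?thesis .
qed

lemma lshift_measurable[measurable]:
  assumes "f \<in> borel_measurable arr" "g \<in> mor G"
  shows "lshift g f \<in> borel_measurable arr"
  using measurable_Pair2[OF lshift_pair_measurable[OF assms(1)], of g] assms(2) by (simp add: space_arr)

lemma composable_iff: "g \<in> mor G \<Longrightarrow> (g, h) \<in> composable G \<longleftrightarrow> h \<in> fibre G (source G g)"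
  by (auto simp: composable_def fibre_def)

lemma sets_translate[simp]: "sets (translate G g \<alpha>) = sets arr"
  by (simp add: translate_def)

lemma nn_integral_translate:
  assumes g: "g \<in> mor G" and \<alpha>: "sets \<alpha> = sets arr" and f: "f \<in> borel_measurable arr"
  shows "(\<integral>\<^sup>+h. f h \<partial>translate G g \<alpha>) = (\<integral>\<^sup>+h. lshift g f h \<partial>\<alpha>)"
proof -
  let ?F = "fibre G (source G g)"
  have F: "?F \<in> sets arr" using g object_mor source_object by (intro fibre_sets) auto
  have F': "?F \<inter> space \<alpha> \<in> sets \<alpha>" using F sets.sets_into_space[OF F] \<alpha> sets_eq_imp_space_eq[OF \<alpha>]
    by (auto simp: Int_absorb2)
  have gm: "gmult G g \<in> restrict_space arr ?F \<rightarrow>\<^sub>M arr"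
  proof -
    have "(\<lambda>h. (g, h)) \<in> restrict_space arr ?F \<rightarrow>\<^sub>M restrict_space (arr \<Otimes>\<^sub>M arr) (composable G)"
    proof (rule measurable_restrict_space2)
      show "(\<lambda>h. (g, h)) \<in> space (restrict_space arr ?F) \<rightarrow> composable G"
        by (auto simp: space_restrict_space composable_iff[OF g])
      have "(\<lambda>h. (g, h)) \<in> arr \<rightarrow>\<^sub>M arr \<Otimes>\<^sub>M arr" using g by (simp add: space_arr)
      then show "(\<lambda>h. (g, h)) \<in> restrict_space arr ?F \<rightarrow>\<^sub>M arr \<Otimes>\<^sub>M arr" by (rule measurable_restrict_space1)
    qed
    from measurable_compose[OF this mult_measurable] show ?thesis by simp
  qed
  have m: "gmult G g \<in> restrict_space \<alpha> ?F \<rightarrow>\<^sub>M arr"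
    unfolding measurable_cong_sets[OF sets_restrict_space_cong[OF \<alpha>] refl] by (rule gm)
  have "(\<integral>\<^sup>+h. f h \<partial>translate G g \<alpha>) = (\<integral>\<^sup>+h. f (gmult G g h) \<partial>restrict_space \<alpha> ?F)"
    unfolding translate_def by (rule nn_integral_distr[OF m]) (use f in simp)
  also have "\<dots> = (\<integral>\<^sup>+h. f (gmult G g h) * indicator ?F h \<partial>\<alpha>)"
    by (rule nn_integral_restrict_space[OF F'])
  also have "\<dots> = (\<integral>\<^sup>+h. lshift g f h \<partial>\<alpha>)"
    by (intro nn_integral_cong) (simp add: lshift_def composable_iff[OF g] indicator_def)
  finally show ?thesis .
qed

lemma measure_eqI_nn_integral:
  assumes "sets \<alpha> = sets arr" "sets \<beta> = sets arr"
    and "\<And>f. f \<in> borel_measurable arr \<Longrightarrow> (\<integral>\<^sup>+x. f x \<partial>\<alpha>) = (\<integral>\<^sup>+x. f x \<partial>\<beta>)"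
  shows "\<alpha> = \<beta>"
proof (rule measure_eqI)
  show "emeasure \<alpha> A = emeasure \<beta> A" if "A \<in> sets \<alpha>" for A
    using assms(3)[of "indicator A"] that assms(1,2) by simp
qed (use assms in simp)

section \<open>Equivariant absolutely continuous kernels: compositions, mixtures, extension from
  objects\<close>

definition ac_chain :: "('a \<Rightarrow> 'a measure) \<Rightarrow> bool" where
  "ac_chain \<pi> \<longleftrightarrow> equivariant_chain G \<pi> \<and> abs_cont_transitions G lam \<pi>"

lemma ac_chainD:
  assumes "ac_chain \<pi>"
  shows "\<pi> \<in> arr \<rightarrow>\<^sub>M prob_algebra arr"
    and "\<And>g. g \<in> mor G \<Longrightarrow> sets (\<pi> g) = sets arr"
    and "\<And>g. g \<in> mor G \<Longrightarrow> space (\<pi> g) = mor G"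
    and "\<And>g. g \<in> mor G \<Longrightarrow> prob_space (\<pi> g)"
    and "\<And>g. g \<in> mor G \<Longrightarrow> AE h in \<pi> g. h \<in> fibre G (target G g)"
    and "\<And>g h. (g, h) \<in> composable G \<Longrightarrow> \<pi> (gmult G g h) = translate G g (\<pi> h)"
    and "\<And>g. g \<in> mor G \<Longrightarrow> absolutely_continuous (lam (target G g)) (\<pi> g)"
proof -
  show m: "\<pi> \<in> arr \<rightarrow>\<^sub>M prob_algebra arr"
    using assms by (simp add: ac_chain_def equivariant_chain_def)
  show s: "sets (\<pi> g) = sets arr" and p: "prob_space (\<pi> g)" if "g \<in> mor G" for g
    using measurable_space[OF m, of g] that by (auto simp: space_arr space_prob_algebra)
  show "space (\<pi> g) = mor G" if "g \<in> mor G" for g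
    using sets_eq_imp_space_eq[OF s[OF that]] space_arr by simp
  show "AE h in \<pi> g. h \<in> fibre G (target G g)" if g: "g \<in> mor G" for g
  proof -
    interpret prob_space "\<pi> g" by (rule p[OF g])
    have "fibre G (target G g) \<in> sets (\<pi> g)"
      using g object_mor target_object by (simp add: s[OF g] fibre_sets)
    moreover have "emeasure (\<pi> g) (fibre G (target G g)) = 1"
      using assms g by (simp add: ac_chain_def equivariant_chain_def)
    ultimately show ?thesis using AE_in_set_eq_1 by (simp add: emeasure_eq_measure)
  qed
  show "\<pi> (gmult G g h) = translate G g (\<pi> h)" if "(g, h) \<in> composable G" for g h
    using assms that by (auto simp: ac_chain_def equivariant_chain_def)
  show "absolutely_continuous (lam (target G g)) (\<pi> g)" if "g \<in> mor G" for g
    using assms that by (simp add: ac_chain_def abs_cont_transitions_def)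
qed

lemma composableD:
  assumes "(g, h) \<in> composable G"
  shows "g \<in> mor G" "h \<in> mor G" "source G g = target G h" "gmult G g h \<in> mor G"
    "target G (gmult G g h) = target G g" "source G (gmult G g h) = source G h"
  using assms mult_closed source_mult target_mult by (auto simp: composable_def)

text \<open>Concentration on the fibre comes out of absolute continuity, because the Haar measure
  gives no mass to the complement of the fibre. Equivariance is tested dually, on functions.\<close>

lemma ac_chainI:
  assumes m: "\<pi> \<in> arr \<rightarrow>\<^sub>M prob_algebra arr"
    and e: "\<And>g h f. (g, h) \<in> composable G \<Longrightarrow> f \<in> borel_measurable arr \<Longrightarrow>
      (\<integral>\<^sup>+k. f k \<partial>\<pi> (gmult G g h)) = (\<integral>\<^sup>+k. lshift g f k \<partial>\<pi> h)"
    and ac: "\<And>g N. g \<in> mor G \<Longrightarrow> N \<in> sets arr \<Longrightarrow> emeasure (lam (target G g)) N = 0 \<Longrightarrow> emeasure (\<pi> g) N = 0"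
  shows "ac_chain \<pi>"
proof -
  have s: "sets (\<pi> g) = sets arr" and p: "prob_space (\<pi> g)" if "g \<in> mor G" for g
    using measurable_space[OF m, of g] that by (auto simp: space_arr space_prob_algebra)
  have "emeasure (\<pi> g) (fibre G (target G g)) = 1" if g: "g \<in> mor G" for g
  proof -
    interpret prob_space "\<pi> g" by (rule p[OF g])
    let ?F = "fibre G (target G g)"
    note D = fibred_systemD[OF fibred_lam target_object[OF g]]
    have F: "?F \<in> sets arr" using g object_mor target_object by (simp add: fibre_sets)
    then have N: "mor G - ?F \<in> sets arr" using sets.top[of arr] by (simp add: space_arr sets.Diff)
    have "AE h in lam (target G g). h \<notin> mor G - ?F" using D(3) by eventually_elim simp
    then have "emeasure (lam (target G g)) (mor G - ?F) = 0"
      using AE_iff_measurable[of "mor G - ?F" "lam (target G g)" "\<lambda>h. h \<notin> mor G - ?F"] N D(1,2) by auto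
    then have "emeasure (\<pi> g) (mor G - ?F) = 0" by (rule ac[OF g N])
    then show ?thesis
      using emeasure_compl[of "mor G - ?F" "\<pi> g"] N emeasure_space_1 sets_eq_imp_space_eq[OF s[OF g]]
      by (simp add: s[OF g] space_arr Diff_Diff_Int Int_absorb1 fibre_def subset_eq)
  qed
  moreover have "\<pi> (gmult G g h) = translate G g (\<pi> h)" if gh: "(g, h) \<in> composable G" for g h
  proof (rule measure_eqI_nn_integral)
    note D = composableD[OF gh]
    show "sets (\<pi> (gmult G g h)) = sets arr" by (rule s[OF D(4)])
    show "(\<integral>\<^sup>+k. f k \<partial>\<pi> (gmult G g h)) = (\<integral>\<^sup>+k. f k \<partial>translate G g (\<pi> h))"
      if "f \<in> borel_measurable arr" for f
      using nn_integral_translate[OF D(1) s[OF D(2)] that] e[OF gh that] by simp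
  qed simp
  moreover have "absolutely_continuous (lam (target G g)) (\<pi> g)" if g: "g \<in> mor G" for g
    unfolding absolutely_continuous_def
  proof
    fix N assume "N \<in> null_sets (lam (target G g))"
    then have N: "N \<in> sets arr" "emeasure (lam (target G g)) N = 0"
      using fibred_systemD(1)[OF fibred_lam target_object[OF g]] by auto
    then show "N \<in> null_sets (\<pi> g)" using ac[OF g N] by (simp add: null_sets_def s[OF g])
  qed
  ultimately show ?thesis
    using m by (auto simp: ac_chain_def equivariant_chain_def abs_cont_transitions_def)
qed

lemma ac_chain_nn_integral_mult:
  assumes "ac_chain \<pi>" "(g, h) \<in> composable G" "f \<in> borel_measurable arr"
  shows "(\<integral>\<^sup>+k. f k \<partial>\<pi> (gmult G g h)) = (\<integral>\<^sup>+k. lshift g f k \<partial>\<pi> h)"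
  using composableD[OF assms(2)] ac_chainD(2)[OF assms(1)] assms(3)
  by (simp add: ac_chainD(6)[OF assms(1,2)] nn_integral_translate)

lemma ac_chain_null:
  assumes \<pi>: "ac_chain \<pi>" and g: "g \<in> mor G" and N: "N \<in> sets arr" and N0: "emeasure (lam (target G g)) N = 0"
  shows "emeasure (\<pi> g) N = 0"
proof -
  have "N \<in> null_sets (lam (target G g))"
    using N N0 fibred_systemD(1)[OF fibred_lam target_object[OF g]] by (simp add: null_sets_def)
  then show ?thesis using ac_chainD(7)[OF \<pi> g] by (auto simp: absolutely_continuous_def)
qed

lemma fibreD: "h \<in> fibre G x \<Longrightarrow> h \<in> mor G \<and> target G h = x"
  by (simp add: fibre_def)

text \<open>\<open>\<pi> h\<close> is carried by arrows composable with \<open>g\<close>, so the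
  equivariance of \<open>\<rho>\<close> applies at almost every intermediate point.\<close>

lemma ac_chain_comp:
  assumes \<pi>: "ac_chain \<pi>" and \<rho>: "ac_chain \<rho>"
  shows "ac_chain (\<lambda>g. \<pi> g \<bind> \<rho>)"
proof (rule ac_chainI)
  show m: "(\<lambda>g. \<pi> g \<bind> \<rho>) \<in> arr \<rightarrow>\<^sub>M prob_algebra arr"
    using ac_chainD(1)[OF \<pi>] ac_chainD(1)[OF \<rho>] by (rule measurable_bind_prob_space)
  have \<rho>m: "\<rho> \<in> \<pi> g \<rightarrow>\<^sub>M subprob_algebra arr" if "g \<in> mor G" for g
    using measurable_prob_algebraD[OF ac_chainD(1)[OF \<rho>]]
    by (simp add: measurable_cong_sets[OF ac_chainD(2)[OF \<pi> that] refl])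
  have int: "(\<integral>\<^sup>+k. f k \<partial>(\<pi> g \<bind> \<rho>)) = (\<integral>\<^sup>+k. (\<integral>\<^sup>+l. f l \<partial>\<rho> k) \<partial>\<pi> g)"
    if "g \<in> mor G" "f \<in> borel_measurable arr" for g f
    by (rule nn_integral_bind[OF that(2) \<rho>m[OF that(1)]])
  have zero: "emeasure (\<pi> g \<bind> \<rho>) N = 0"
    if g: "g \<in> mor G" and N: "N \<in> sets arr" and z: "\<And>k. k \<in> fibre G (target G g) \<Longrightarrow> emeasure (\<rho> k) N = 0" for g N
  proof -
    have "emeasure (\<pi> g \<bind> \<rho>) N = (\<integral>\<^sup>+k. emeasure (\<rho> k) N \<partial>\<pi> g)"
      using g ac_chainD(3)[OF \<pi> g] N by (intro emeasure_bind[OF _ \<rho>m[OF g]]) auto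
    also have "\<dots> = (\<integral>\<^sup>+k. 0 \<partial>\<pi> g)"
    proof (rule nn_integral_cong_AE)
      show "AE k in \<pi> g. emeasure (\<rho> k) N = 0"
        using ac_chainD(5)[OF \<pi> g] by eventually_elim (rule z)
    qed
    finally show ?thesis by simp
  qed
  show "emeasure (\<pi> g \<bind> \<rho>) N = 0"
    if g: "g \<in> mor G" and N: "N \<in> sets arr" and N0: "emeasure (lam (target G g)) N = 0" for g N
    by (rule zero[OF g N]) (use N0 in \<open>auto dest!: fibreD intro!: ac_chain_null[OF \<rho> _ N]\<close>)
  show "(\<integral>\<^sup>+k. f k \<partial>(\<pi> (gmult G g h) \<bind> \<rho>)) = (\<integral>\<^sup>+k. lshift g f k \<partial>(\<pi> h \<bind> \<rho>))"
    if gh: "(g, h) \<in> composable G" and f: "f \<in> borel_measurable arr" for g h f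
  proof -
    note D = composableD[OF gh]
    have fm: "(\<lambda>k. \<integral>\<^sup>+l. f l \<partial>\<rho> k) \<in> borel_measurable arr"
      by (rule measurable_compose[OF measurable_prob_algebraD[OF ac_chainD(1)[OF \<rho>]] nn_integral_measurable_subprob_algebra[OF f]])
    have "(\<integral>\<^sup>+k. f k \<partial>(\<pi> (gmult G g h) \<bind> \<rho>)) = (\<integral>\<^sup>+k. (\<integral>\<^sup>+l. f l \<partial>\<rho> k) \<partial>\<pi> (gmult G g h))"
      by (rule int[OF D(4) f])
    also have "\<dots> = (\<integral>\<^sup>+k. lshift g (\<lambda>k. \<integral>\<^sup>+l. f l \<partial>\<rho> k) k \<partial>\<pi> h)"
      by (rule ac_chain_nn_integral_mult[OF \<pi> gh fm])
    also have "\<dots> = (\<integral>\<^sup>+k. (\<integral>\<^sup>+l. lshift g f l \<partial>\<rho> k) \<partial>\<pi> h)"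
    proof (rule nn_integral_cong_AE)
      show "AE k in \<pi> h. lshift g (\<lambda>k. \<integral>\<^sup>+l. f l \<partial>\<rho> k) k = (\<integral>\<^sup>+l. lshift g f l \<partial>\<rho> k)"
        using ac_chainD(5)[OF \<pi> D(2)]
      proof eventually_elim
        case (elim k)
        then have "(g, k) \<in> composable G" using D by (simp add: composable_iff)
        then show ?case using ac_chain_nn_integral_mult[OF \<rho> _ f] by (simp add: lshift_def)
      qed
    qed
    also have "\<dots> = (\<integral>\<^sup>+k. lshift g f k \<partial>(\<pi> h \<bind> \<rho>))"
      using f by (intro int[symmetric] D(2) lshift_measurable D(1))
    finally show ?thesis .
  qed
qed

text \<open>A random index is drawn from \<open>p\<close> anew at each use of the kernel. Uniform
  \<open>p\<close> produces Cesaro averages, geometric \<open>p\<close> the chain with trivial tail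
  boundary.\<close>

definition mixture :: "nat pmf \<Rightarrow> (nat \<Rightarrow> 'a \<Rightarrow> 'a measure) \<Rightarrow> 'a \<Rightarrow> 'a measure" where
  "mixture p \<kappa> g = measure_pmf p \<bind> (\<lambda>k. \<kappa> k g)"

lemma nn_integral_mixture:
  assumes \<kappa>: "\<And>k. ac_chain (\<kappa> k)" and g: "g \<in> mor G" and f: "f \<in> borel_measurable arr"
  shows "(\<integral>\<^sup>+h. f h \<partial>mixture p \<kappa> g) = (\<integral>\<^sup>+k. (\<integral>\<^sup>+h. f h \<partial>\<kappa> k g) \<partial>measure_pmf p)"
  unfolding mixture_def
proof (rule nn_integral_bind[OF f])
  have "(\<lambda>k. \<kappa> k g) \<in> count_space UNIV \<rightarrow>\<^sub>M subprob_algebra arr"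
    using measurable_space[OF measurable_prob_algebraD[OF ac_chainD(1)[OF \<kappa>]], of g] g by (auto simp: space_arr)
  then show "(\<lambda>k. \<kappa> k g) \<in> measure_pmf p \<rightarrow>\<^sub>M subprob_algebra arr" by simp
qed

lemma ac_chain_mixture:
  assumes \<kappa>: "\<And>k. ac_chain (\<kappa> k)"
  shows "ac_chain (mixture p \<kappa>)"
proof (rule ac_chainI)
  have "(\<lambda>p. \<kappa> (snd p) (fst p)) \<in> arr \<Otimes>\<^sub>M count_space UNIV \<rightarrow>\<^sub>M prob_algebra arr"
    by (rule measurable_compose_countable'[where f="\<lambda>k p. \<kappa> k (fst p)" and g=snd and I=UNIV])
      (use measurable_compose[OF measurable_fst ac_chainD(1)[OF \<kappa>]] in simp_all)
  then have "(\<lambda>(g, k). \<kappa> k g) \<in> arr \<Otimes>\<^sub>M count_space UNIV \<rightarrow>\<^sub>M prob_algebra arr"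
    by (simp add: split_beta')
  moreover have "measure_pmf p \<in> space (prob_algebra (count_space UNIV))"
    by (simp add: space_prob_algebra prob_space_measure_pmf)
  ultimately show m: "mixture p \<kappa> \<in> arr \<rightarrow>\<^sub>M prob_algebra arr"
    unfolding mixture_def[abs_def] by (intro measurable_bind_prob_space2[of _ _ "count_space UNIV"] measurable_const)
  have s: "sets (mixture p \<kappa> g) = sets arr" if "g \<in> mor G" for g
    using measurable_space[OF m, of g] that by (auto simp: space_arr space_prob_algebra)
  have zero: "emeasure (mixture p \<kappa> g) N = 0"
    if g: "g \<in> mor G" and N: "N \<in> sets arr" and z: "\<And>k. emeasure (\<kappa> k g) N = 0" for g N
  proof -
    have "emeasure (mixture p \<kappa> g) N = (\<integral>\<^sup>+h. indicator N h \<partial>mixture p \<kappa> g)" using N s[OF g] by simp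
    also have "\<dots> = (\<integral>\<^sup>+k. (\<integral>\<^sup>+h. indicator N h \<partial>\<kappa> k g) \<partial>measure_pmf p)"
      by (rule nn_integral_mixture[OF \<kappa> g]) (use N in simp)
    also have "\<dots> = 0" using N ac_chainD(2)[OF \<kappa> g] z by simp
    finally show ?thesis .
  qed
  show "emeasure (mixture p \<kappa> g) N = 0"
    if g: "g \<in> mor G" and N: "N \<in> sets arr" and N0: "emeasure (lam (target G g)) N = 0" for g N
    by (rule zero[OF g N ac_chain_null[OF \<kappa> g N N0]])
  show "(\<integral>\<^sup>+k. f k \<partial>mixture p \<kappa> (gmult G g h)) = (\<integral>\<^sup>+k. lshift g f k \<partial>mixture p \<kappa> h)"
    if gh: "(g, h) \<in> composable G" and f: "f \<in> borel_measurable arr" for g h f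
    using composableD[OF gh] f
    by (simp add: nn_integral_mixture[OF \<kappa>] ac_chain_nn_integral_mult[OF \<kappa> gh] lshift_measurable)
qed

text \<open>A system on the objects extends uniquely by equivariance: the law at \<open>g\<close>
  must be the translate by \<open>g\<close> of the law at its source. Equivariance of the extension
  is associativity of the product.\<close>

lemma ac_chain_of_system:
  assumes \<theta>: "fibred_system G \<theta>" and p: "\<And>x. x \<in> objects G \<Longrightarrow> prob_space (\<theta> x)"
    and ac: "\<And>x. x \<in> objects G \<Longrightarrow> absolutely_continuous (lam x) (\<theta> x)"
  shows "ac_chain (\<lambda>g. translate G g (\<theta> (source G g)))"
proof (rule ac_chainI)
  have \<theta>s: "sets (\<theta> (source G g)) = sets arr" if "g \<in> mor G" for g
    using fibred_systemD(1)[OF \<theta> source_object[OF that]] .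
  have int: "(\<integral>\<^sup>+h. f h \<partial>translate G g (\<theta> (source G g))) = (\<integral>\<^sup>+h. lshift g f h \<partial>\<theta> (source G g))"
    if "g \<in> mor G" "f \<in> borel_measurable arr" for g f
    by (rule nn_integral_translate[OF that(1) \<theta>s[OF that(1)] that(2)])
  have AEc: "AE h in \<theta> (source G g). (g, h) \<in> composable G" if "g \<in> mor G" for g
    using fibred_systemD(3)[OF \<theta> source_object[OF that]] by (simp add: composable_iff[OF that])
  have \<theta>m: "\<theta> \<in> obj_space G \<rightarrow>\<^sub>M subprob_algebra arr"
  proof (rule measurable_subprob_algebra)
    show "subprob_space (\<theta> a)" "sets (\<theta> a) = sets arr" if "a \<in> space (obj_space G)" for a
      using that fibred_systemD(1)[OF \<theta>] p by (auto simp: space_obj intro: prob_space_imp_subprob_space)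
    fix A assume A: "A \<in> sets arr"
    have "(\<lambda>x. \<integral>\<^sup>+g. indicator A g \<partial>\<theta> x) \<in> borel_measurable (obj_space G)"
      by (rule fibred_system_measurable[OF \<theta>]) (use A in simp)
    then show "(\<lambda>a. emeasure (\<theta> a) A) \<in> borel_measurable (obj_space G)"
      by (subst (asm) measurable_cong[of _ _ "\<lambda>x. emeasure (\<theta> x) A"])
        (use A fibred_systemD(1)[OF \<theta>] space_obj in auto)
  qed
  have \<theta>sm: "(\<lambda>g. \<theta> (source G g)) \<in> arr \<rightarrow>\<^sub>M subprob_algebra arr"
    by (rule measurable_compose[OF source_measurable \<theta>m])
  have prob: "prob_space (translate G g (\<theta> (source G g)))" if g: "g \<in> mor G" for g
  proof
    interpret prob_space "\<theta> (source G g)" by (rule p[OF source_object[OF g]])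
    have "emeasure (translate G g (\<theta> (source G g))) (space (translate G g (\<theta> (source G g)))) =
      (\<integral>\<^sup>+h. 1 \<partial>translate G g (\<theta> (source G g)))" by simp
    also have "\<dots> = (\<integral>\<^sup>+h. lshift g (\<lambda>_. 1) h \<partial>\<theta> (source G g))" by (rule int[OF g]) simp
    also have "\<dots> = (\<integral>\<^sup>+h. 1 \<partial>\<theta> (source G g))"
      using AEc[OF g] by (intro nn_integral_cong_AE) (auto simp: lshift_def elim!: eventually_mono)
    finally show "emeasure (translate G g (\<theta> (source G g))) (space (translate G g (\<theta> (source G g)))) = 1"
      by (simp add: emeasure_space_1)
  qed
  show m: "(\<lambda>g. translate G g (\<theta> (source G g))) \<in> arr \<rightarrow>\<^sub>M prob_algebra arr"
  proof (rule measurable_prob_algebraI)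
    show "prob_space (translate G g (\<theta> (source G g)))" if "g \<in> space arr" for g
      using prob that by (simp add: space_arr)
    show "(\<lambda>g. translate G g (\<theta> (source G g))) \<in> arr \<rightarrow>\<^sub>M subprob_algebra arr"
    proof (rule measurable_subprob_algebra)
      show "subprob_space (translate G a (\<theta> (source G a)))" if "a \<in> space arr" for a
        using prob that by (auto simp: space_arr intro: prob_space_imp_subprob_space)
      fix A assume A: "A \<in> sets arr"
      have "(\<lambda>g. \<integral>\<^sup>+h. lshift g (indicator A) h \<partial>\<theta> (source G g)) \<in> borel_measurable arr"
        by (rule nn_integral_measurable_subprob_algebra2[OF lshift_pair_measurable \<theta>sm]) (use A in simp)
      moreover have "(\<integral>\<^sup>+h. lshift g (indicator A) h \<partial>\<theta> (source G g)) = emeasure (translate G g (\<theta> (source G g))) A"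
        if "g \<in> space arr" for g
        using int[of g "indicator A"] that A by (simp add: space_arr)
      ultimately show "(\<lambda>a. emeasure (translate G a (\<theta> (source G a))) A) \<in> borel_measurable arr"
        by (simp cong: measurable_cong)
    qed simp
  qed
  have zero: "emeasure (translate G g (\<theta> (source G g))) N = 0"
    if g: "g \<in> mor G" and N: "N \<in> sets arr" and z: "AE h in \<theta> (source G g). (g, h) \<in> composable G \<longrightarrow> gmult G g h \<notin> N" for g N
  proof -
    have "emeasure (translate G g (\<theta> (source G g))) N = (\<integral>\<^sup>+h. lshift g (indicator N) h \<partial>\<theta> (source G g))"
      using int[OF g, of "indicator N"] N by simp
    also have "\<dots> = (\<integral>\<^sup>+h. 0 \<partial>\<theta> (source G g))"
      using z by (intro nn_integral_cong_AE) (auto simp: lshift_def elim!: eventually_mono)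
    finally show ?thesis by simp
  qed
  show "emeasure (translate G g (\<theta> (source G g))) N = 0"
    if g: "g \<in> mor G" and N: "N \<in> sets arr" and N0: "emeasure (lam (target G g)) N = 0" for g N
  proof (rule zero[OF g N])
    have ls: "sets (lam (source G g)) = sets arr" by (rule fibred_systemD(1)[OF fibred_lam source_object[OF g]])
    \<comment> \<open>Left invariance of the Haar system pulls a null set over the target back to a
      null set over the source, where \<open>\<theta>\<close> is absolutely continuous.\<close>
    have "(\<integral>\<^sup>+h. lshift g (indicator N) h \<partial>lam (source G g)) = (\<integral>\<^sup>+h. indicator N h \<partial>translate G g (lam (source G g)))"
      using N by (intro nn_integral_translate[symmetric] g ls) simp
    also have "\<dots> = 0"
      using N N0 fibred_systemD(1)[OF fibred_lam target_object[OF g]] by (simp add: lam_invariant[OF g])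
    finally have "AE h in lam (source G g). lshift g (indicator N) h = 0"
      using N by (subst (asm) nn_integral_0_iff_AE)
        (auto simp: measurable_cong_sets[OF ls refl] intro!: lshift_measurable g)
    then have "AE h in \<theta> (source G g). lshift g (indicator N) h = 0"
      by (rule absolutely_continuous_AE[rotated 2]) (simp_all add: ls \<theta>s g ac source_object)
    then show "AE h in \<theta> (source G g). (g, h) \<in> composable G \<longrightarrow> gmult G g h \<notin> N"
      by eventually_elim (auto simp: lshift_def indicator_def split: if_splits)
  qed
  show "(\<integral>\<^sup>+k. f k \<partial>translate G (gmult G g h) (\<theta> (source G (gmult G g h)))) =
      (\<integral>\<^sup>+k. lshift g f k \<partial>translate G h (\<theta> (source G h)))"
    if gh: "(g, h) \<in> composable G" and f: "f \<in> borel_measurable arr" for g h f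
  proof -
    note D = composableD[OF gh]
    have "lshift (gmult G g h) f k = lshift h (lshift g f) k" for k
    proof (cases "(h, k) \<in> composable G")
      case True
      note E = composableD[OF True]
      have "(gmult G g h, k) \<in> composable G" "(g, gmult G h k) \<in> composable G"
        using D E by (auto simp: composable_def)
      then show ?thesis using True mult_assoc[OF gh True] by (simp add: lshift_def)
    next
      case False
      then have "(gmult G g h, k) \<notin> composable G" using D by (auto simp: composable_def)
      then show ?thesis using False by (simp add: lshift_def)
    qed
    then have "lshift (gmult G g h) f = lshift h (lshift g f)" by (simp add: fun_eq_iff)
    then show ?thesis
      using int[OF D(4) f] int[OF D(2) lshift_measurable[OF f D(1)]] by (simp only: D(6))
  qed
qed

end

section \<open>Amenability from the Liouville property\<close>

context measured_groupoid
begin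

lemma object_in_fibre: "x \<in> objects G \<Longrightarrow> x \<in> fibre G x"
  by (simp add: fibre_def object_mor target_identity)

lemma ac_chain_markov_kernel: "ac_chain \<pi> \<Longrightarrow> markov_kernel arr \<pi>"
  by (rule markov_kernel.intro) (rule ac_chainD(1))

lemma space_fibre_space: "x \<in> objects G \<Longrightarrow> space (fibre_space G x) = fibre G x"
  by (auto simp: fibre_space_def space_restrict_space space_arr fibre_def)

lemma fibre_sets_object: "x \<in> objects G \<Longrightarrow> fibre G x \<in> sets arr"
  by (intro fibre_sets object_mor)

lemma fibre_ac_markov_kernel:
  assumes \<pi>: "ac_chain \<pi>" and x: "x \<in> objects G"
  shows "ac_markov_kernel (fibre_space G x) (fibre_chain G \<pi> x) (restrict_space (lam x) (fibre G x))"
proof -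
  let ?F = "fibre G x"
  have F: "?F \<in> sets arr" by (rule fibre_sets_object[OF x])
  have \<pi>F: "?F \<inter> space (\<pi> g) \<in> sets (\<pi> g)" "?F \<in> sets (\<pi> g)" if "g \<in> mor G" for g
    using F that by (auto simp: ac_chainD(2,3)[OF \<pi> that] fibre_def Int_absorb2 intro!: sets.Int_space_eq2)
  have prob: "prob_space (fibre_chain G \<pi> x g)" if g: "g \<in> ?F" for g
  proof
    have gm: "g \<in> mor G" "target G g = x" using fibreD[OF g] by auto
    interpret prob_space "\<pi> g" by (rule ac_chainD(4)[OF \<pi> gm(1)])
    have "emeasure (\<pi> g) ?F = 1"
      using ac_chainD(5)[OF \<pi> gm(1)] AE_in_set_eq_1[OF \<pi>F(2)[OF gm(1)]] by (simp add: gm emeasure_eq_measure)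
    moreover have "space (restrict_space (\<pi> g) ?F) = ?F"
      using ac_chainD(3)[OF \<pi> gm(1)] by (auto simp: space_restrict_space fibre_def)
    ultimately show "emeasure (fibre_chain G \<pi> x g) (space (fibre_chain G \<pi> x g)) = 1"
      by (simp add: fibre_chain_def emeasure_restrict_space[OF \<pi>F(1)[OF gm(1)]])
  qed
  interpret markov_kernel "fibre_space G x" "fibre_chain G \<pi> x"
  proof
    show "fibre_chain G \<pi> x \<in> fibre_space G x \<rightarrow>\<^sub>M prob_algebra (fibre_space G x)"
    proof (rule measurable_prob_algebraI)
      show "prob_space (fibre_chain G \<pi> x g)" if "g \<in> space (fibre_space G x)" for g
        using that by (simp add: space_fibre_space[OF x] prob)
      have "\<pi> \<in> fibre_space G x \<rightarrow>\<^sub>M subprob_algebra arr"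
        unfolding fibre_space_def by (rule measurable_restrict_space1[OF measurable_prob_algebraD[OF ac_chainD(1)[OF \<pi>]]])
      then show "fibre_chain G \<pi> x \<in> fibre_space G x \<rightarrow>\<^sub>M subprob_algebra (fibre_space G x)"
        unfolding fibre_chain_def[abs_def] fibre_space_def[of G x]
        by (intro restrict_space_measurable) (use F object_in_fibre[OF x] in \<open>auto simp: fibre_space_def\<close>)
    qed
  qed
  note lamD = fibred_systemD[OF fibred_lam x]
  show ?thesis
  proof
    show "sets (restrict_space (lam x) ?F) = sets (fibre_space G x)"
      unfolding fibre_space_def by (rule sets_restrict_space_cong[OF lamD(1)])
    show "space (fibre_space G x) \<noteq> {}"
      using object_in_fibre[OF x] by (auto simp: space_fibre_space[OF x])
    show "absolutely_continuous (restrict_space (lam x) ?F) (fibre_chain G \<pi> x g)"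
      if "g \<in> space (fibre_space G x)" for g
    proof -
      have gm: "g \<in> mor G" "target G g = x" using fibreD that by (auto simp: space_fibre_space[OF x])
      have "null_sets (lam x) \<subseteq> null_sets (\<pi> g)"
        using ac_chainD(7)[OF \<pi> gm(1)] by (simp add: absolutely_continuous_def gm)
      then show ?thesis
        using F \<pi>F(2)[OF gm(1)] lamD(1)
        by (auto simp: absolutely_continuous_def fibre_chain_def null_sets_restrict_space)
    qed
  qed
qed

text \<open>Boundaries live on the fibres, whereas compositions and mixtures are formed on all
  arrows. Since \<open>\<pi> g\<close> is carried by the fibre of \<open>g\<close>, the iterates of
  both operators agree there.\<close>

lemma Kop_fibre:
  assumes \<pi>: "ac_chain \<pi>" and x: "x \<in> objects G" and g: "g \<in> fibre G x"
    and h: "\<And>k. k \<in> fibre G x \<Longrightarrow> h k = h' k"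
  shows "(markov_kernel.Kop (fibre_chain G \<pi> x) ^^ n) h g = (markov_kernel.Kop \<pi> ^^ n) h' g"
proof -
  interpret A: markov_kernel arr \<pi> by (rule ac_chain_markov_kernel[OF \<pi>])
  interpret F: ac_markov_kernel "fibre_space G x" "fibre_chain G \<pi> x" "restrict_space (lam x) (fibre G x)"
    by (rule fibre_ac_markov_kernel[OF \<pi> x])
  have F: "fibre G x \<in> sets arr" by (rule fibre_sets_object[OF x])
  show ?thesis using g
  proof (induction n arbitrary: g)
    case 0
    then show ?case by (simp add: h)
  next
    case (Suc n)
    have gm: "g \<in> mor G" "target G g = x" using fibreD[OF Suc.prems] by auto
    have F': "fibre G x \<inter> space (\<pi> g) \<in> sets (\<pi> g)"
      using F by (simp add: ac_chainD(2,3)[OF \<pi> gm(1)] sets.Int_space_eq2 flip: space_arr)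
    have "F.Kop ((F.Kop ^^ n) h) g = (\<integral>\<^sup>+k. (F.Kop ^^ n) h k * indicator (fibre G x) k \<partial>\<pi> g)"
      unfolding F.Kop_def[of "(F.Kop ^^ n) h"] fibre_chain_def by (rule nn_integral_restrict_space[OF F'])
    also have "\<dots> = (\<integral>\<^sup>+k. (A.Kop ^^ n) h' k \<partial>\<pi> g)"
    proof (rule nn_integral_cong_AE)
      show "AE k in \<pi> g. (F.Kop ^^ n) h k * indicator (fibre G x) k = (A.Kop ^^ n) h' k"
        using ac_chainD(5)[OF \<pi> gm(1)] by eventually_elim (simp add: gm Suc.IH)
    qed
    finally show ?case by (simp add: A.Kop_def[of "(A.Kop ^^ n) h'"])
  qed
qed

definition gen_alg :: "'a set set" where
  "gen_alg = (SOME \<A>. countable \<A> \<and> algebra (mor G) \<A> \<and> sets arr = sigma_sets (mor G) \<A>)"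

lemma gen_alg: "countable gen_alg" "algebra (mor G) gen_alg" "sets arr = sigma_sets (mor G) gen_alg"
proof -
  obtain B where B: "countable B" "B \<subseteq> Pow (mor G)" "sets arr = sigma_sets (mor G) B"
    using countable_separating_generator by (elim exE conjE)
  have "\<exists>\<A>. countable \<A> \<and> algebra (mor G) \<A> \<and> sets arr = sigma_sets (mor G) \<A>"
    using countable_generating_algebra[OF B(1,2)] B(3) by (elim exE conjE) (metis)
  then have "countable gen_alg \<and> algebra (mor G) gen_alg \<and> sets arr = sigma_sets (mor G) gen_alg"
    unfolding gen_alg_def by (rule someI_ex)
  then show "countable gen_alg" "algebra (mor G) gen_alg" "sets arr = sigma_sets (mor G) gen_alg" by blast+
qed

lemma countably_generated_pairI:
  assumes "prob_space \<alpha>" "prob_space \<beta>" "sets \<alpha> = sets arr" "sets \<beta> = sets arr"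
  shows "countably_generated_pair gen_alg \<alpha> \<beta>"
proof -
  have "space \<alpha> = mor G" using sets_eq_imp_space_eq[OF assms(3)] space_arr by simp
  then show ?thesis using assms gen_alg by (simp add: countably_generated_pair_def)
qed

text \<open>The law at \<open>g\<close> is compared with the law at the unit of the same fibre. For
  equivariant \<open>\<pi>\<close> the former is the translate by \<open>g\<close> of the law at the
  source, so this is the quantity in amenability, measured on \<open>gen_alg\<close>.\<close>

definition defect :: "('a \<Rightarrow> 'a measure) \<Rightarrow> 'a \<Rightarrow> ennreal" where
  "defect \<pi> g = sup_dist gen_alg (\<pi> g) (\<pi> (target G g))"

lemma defect_measurable[measurable]:
  assumes \<pi>: "ac_chain \<pi>" shows "defect \<pi> \<in> borel_measurable arr"
  unfolding defect_def[abs_def] sup_dist_def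
proof (rule borel_measurable_SUP[OF gen_alg(1)])
  fix A assume "A \<in> gen_alg"
  then have A: "A \<in> sets arr" unfolding gen_alg(3) by (rule sigma_sets.Basic)
  have m: "(\<lambda>g. measure (\<pi> g) A) \<in> borel_measurable arr"
    by (rule measurable_compose[OF measurable_prob_algebraD[OF ac_chainD(1)[OF \<pi>]] measurable_measure_subprob_algebra[OF A]])
  have "(\<lambda>g. measure (\<pi> (target G g)) A) \<in> borel_measurable arr"
    by (rule measurable_compose[OF target_arr m])
  with m show "(\<lambda>g. ennreal \<bar>measure (\<pi> g) A - measure (\<pi> (target G g)) A\<bar>) \<in> borel_measurable arr"
    by measurable
qed

lemma target_mor: "g \<in> mor G \<Longrightarrow> target G g \<in> mor G"
  using target_object object_mor by blast

lemma defect_pair: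
  assumes "ac_chain \<pi>" "g \<in> mor G"
  shows "countably_generated_pair gen_alg (\<pi> g) (\<pi> (target G g))"
  using assms by (intro countably_generated_pairI ac_chainD target_mor)

lemma defect_le_1:
  assumes \<pi>: "ac_chain \<pi>" and g: "g \<in> mor G" shows "defect \<pi> g \<le> 1"
  unfolding defect_def sup_dist_def
proof (rule SUP_least)
  fix A assume "A \<in> gen_alg"
  interpret p: prob_space "\<pi> g" by (rule ac_chainD(4)[OF \<pi> g])
  interpret q: prob_space "\<pi> (target G g)" by (rule ac_chainD(4)[OF \<pi> target_mor[OF g]])
  have "\<bar>measure (\<pi> g) A - measure (\<pi> (target G g)) A\<bar> \<le> 1"
    using p.prob_le_1[of A] q.prob_le_1[of A] measure_nonneg[of "\<pi> g" A] measure_nonneg[of "\<pi> (target G g)" A] by linarith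
  then show "ennreal \<bar>measure (\<pi> g) A - measure (\<pi> (target G g)) A\<bar> \<le> 1" by simp
qed

text \<open>The arrows whose target lies in a \<open>kap\<close>-null set form a
  \<open>star\<close>-null set. Fibrewise information thereby reaches every test measure of
  amenability.\<close>

lemma AE_kap_AE_target:
  assumes AE: "AE x in kap. Q x" and m: "sets m = sets arr" and ac: "absolutely_continuous star m"
  shows "AE g in m. Q (target G g)"
proof -
  obtain N where N: "N \<in> null_sets kap" "{x\<in>space kap. \<not> Q x} \<subseteq> N"
    using AE unfolding eventually_ae_filter by blast
  have "N \<in> sets (obj_space G)" using N(1) by (auto simp: sets_kap[symmetric])
  then have M: "target G -` N \<inter> mor G \<in> sets arr"
    using measurable_sets[OF target_measurable, of N] by (simp add: space_arr)
  have "target G -` N \<inter> mor G \<in> null_sets star"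
    using AE_not_in[OF N(1)] by (intro AE_lam_target_imp_star M) (auto simp: fibre_def elim!: eventually_mono)
  then have "target G -` N \<inter> mor G \<in> null_sets m" using ac by (auto simp: absolutely_continuous_def)
  then show ?thesis
  proof (rule AE_I')
    have "space m = mor G" using sets_eq_imp_space_eq[OF m] space_arr by simp
    then show "{g \<in> space m. \<not> Q (target G g)} \<subseteq> target G -` N \<inter> mor G"
      using N(2) target_object by (auto simp: space_kap)
  qed
qed

text \<open>\<open>kpow \<pi> k\<close> makes \<open>k + 1\<close> steps, so that all of them are
  absolutely continuous.\<close>

primrec kpow :: "('a \<Rightarrow> 'a measure) \<Rightarrow> nat \<Rightarrow> 'a \<Rightarrow> 'a measure" where
  "kpow \<pi> 0 = \<pi>"
| "kpow \<pi> (Suc k) = (\<lambda>g. \<pi> g \<bind> kpow \<pi> k)"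

lemma ac_chain_kpow: "ac_chain \<pi> \<Longrightarrow> ac_chain (kpow \<pi> k)"
  by (induction k) (simp_all add: ac_chain_comp)

lemma nn_integral_kpow:
  assumes \<pi>: "ac_chain \<pi>" and "g \<in> mor G" and f: "f \<in> borel_measurable arr"
  shows "(\<integral>\<^sup>+h. f h \<partial>kpow \<pi> k g) = (markov_kernel.Kop \<pi> ^^ Suc k) f g"
  using assms(2)
proof (induction k arbitrary: g)
  interpret markov_kernel arr \<pi> by (rule ac_chain_markov_kernel[OF \<pi>])
  case 0
  show ?case by (simp add: Kop_def)
next
  interpret markov_kernel arr \<pi> by (rule ac_chain_markov_kernel[OF \<pi>])
  case (Suc k)
  have m: "kpow \<pi> k \<in> \<pi> g \<rightarrow>\<^sub>M subprob_algebra arr"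
    using measurable_prob_algebraD[OF ac_chainD(1)[OF ac_chain_kpow[OF \<pi>, of k]]]
    by (simp add: measurable_cong_sets[OF ac_chainD(2)[OF \<pi> Suc.prems] refl])
  have "(\<integral>\<^sup>+h. f h \<partial>kpow \<pi> (Suc k) g) = (\<integral>\<^sup>+l. (\<integral>\<^sup>+h. f h \<partial>kpow \<pi> k l) \<partial>\<pi> g)"
    unfolding kpow.simps by (rule nn_integral_bind[OF f m])
  also have "\<dots> = (\<integral>\<^sup>+l. (Kop ^^ Suc k) f l \<partial>\<pi> g)"
    by (intro nn_integral_cong Suc.IH) (simp add: ac_chainD(3)[OF \<pi> Suc.prems])
  finally show ?case by (simp only: funpow.simps comp_apply Kop_def[of "Kop ((Kop ^^ k) f)"])
qed

text \<open>The uniform law on the indices below \<open>Suc n\<close>, a nonempty set, picks a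
  number of steps between 1 and \<open>n + 1\<close>.\<close>

lemma measure_cesaro_mixture:
  assumes \<pi>: "ac_chain \<pi>" and g: "g \<in> mor G" and A: "A \<in> sets arr"
  shows "measure (mixture (pmf_of_set {..<Suc n}) (kpow \<pi>) g) A = markov_kernel.cesaro \<pi> (Suc n) A g"
proof -
  interpret markov_kernel arr \<pi> by (rule ac_chain_markov_kernel[OF \<pi>])
  let ?M = "mixture (pmf_of_set {..<Suc n}) (kpow \<pi>) g"
  note kp = ac_chain_kpow[OF \<pi>]
  have "emeasure ?M A = (\<integral>\<^sup>+h. indicator A h \<partial>?M)"
    using A ac_chainD(2)[OF ac_chain_mixture[of "kpow \<pi>"] g] kp by simp
  also have "\<dots> = (\<integral>\<^sup>+k. (\<integral>\<^sup>+h. indicator A h \<partial>kpow \<pi> k g) \<partial>measure_pmf (pmf_of_set {..<Suc n}))"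
    by (rule nn_integral_mixture[OF kp g]) (use A in simp)
  also have "\<dots> = (\<integral>\<^sup>+k. (Kop ^^ Suc k) (indicator A) g \<partial>measure_pmf (pmf_of_set {..<Suc n}))"
    by (intro nn_integral_cong nn_integral_kpow \<pi> g) (use A in simp)
  also have "\<dots> = (\<Sum>k<Suc n. (Kop ^^ Suc k) (indicator A) g) / of_nat (Suc n)"
    by (subst nn_integral_pmf_of_set) (auto simp del: funpow.simps)
  also have "(\<Sum>k<Suc n. (Kop ^^ Suc k) (indicator A) g) = (\<Sum>k<Suc n. ennreal (enn2real ((Kop ^^ Suc k) (indicator A) g)))"
  proof (intro sum.cong refl)
    fix k
    have "(Kop ^^ Suc k) (indicator A) g \<le> 1"
      by (rule Kop_funpow_le_1) (use g in \<open>auto simp: space_arr indicator_def\<close>)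
    also have "(1::ennreal) < top" by simp
    finally show "(Kop ^^ Suc k) (indicator A) g = ennreal (enn2real ((Kop ^^ Suc k) (indicator A) g))" by simp
  qed
  also have "\<dots> / of_nat (Suc n) = ennreal (cesaro (Suc n) A g)"
    unfolding cesaro_def
    by (subst sum_ennreal, simp, subst ennreal_of_nat_eq_real_of_nat, rule divide_ennreal)
      (simp_all add: sum_nonneg del: funpow.simps sum.lessThan_Suc)
  finally have "emeasure ?M A = ennreal (cesaro (Suc n) A g)" .
  moreover have "0 \<le> cesaro (Suc n) A g" by (simp add: cesaro_def sum_nonneg)
  ultimately show ?thesis by (simp add: measure_def)
qed

lemma cesaro_fibre:
  assumes \<pi>: "ac_chain \<pi>" and x: "x \<in> objects G" and g: "g \<in> fibre G x"
  shows "markov_kernel.cesaro (fibre_chain G \<pi> x) n (A \<inter> fibre G x) g = markov_kernel.cesaro \<pi> n A g"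
proof -
  interpret A: markov_kernel arr \<pi> by (rule ac_chain_markov_kernel[OF \<pi>])
  interpret F: ac_markov_kernel "fibre_space G x" "fibre_chain G \<pi> x" "restrict_space (lam x) (fibre G x)"
    by (rule fibre_ac_markov_kernel[OF \<pi> x])
  have "(F.Kop ^^ n) (indicator (A \<inter> fibre G x)) g = (A.Kop ^^ n) (indicator A) g" for n
    by (rule Kop_fibre[OF \<pi> x g]) (simp add: indicator_def)
  then show ?thesis unfolding F.cesaro_def A.cesaro_def by (simp only:)
qed

text \<open>\<open>cesaro_diff_le\<close> is uniform in the set \<open>A\<close>, so it passes to
  the supremum defining the defect; it is used for \<open>g\<close> against \<open>x\<close> and for
  \<open>x\<close> against \<open>g\<close> to obtain absolute values.\<close>

lemma liouville_defect_tendsto: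
  assumes \<pi>: "ac_chain \<pi>" and x: "x \<in> objects G" and g: "g \<in> fibre G x"
    and triv: "poisson_boundary_trivial (fibre_space G x) (fibre_chain G \<pi> x) (restrict_space (lam x) (fibre G x))"
  shows "(\<lambda>n. defect (mixture (pmf_of_set {..<Suc n}) (kpow \<pi>)) g) \<longlonglongrightarrow> 0"
proof -
  interpret F: ac_markov_kernel "fibre_space G x" "fibre_chain G \<pi> x" "restrict_space (lam x) (fibre G x)"
    by (rule fibre_ac_markov_kernel[OF \<pi> x])
  have gm: "g \<in> mor G" "target G g = x" using fibreD[OF g] by auto
  have fin: "sigma_finite_measure (restrict_space (lam x) (fibre G x))"
  proof (rule sigma_finite_measure_restrict_space)
    show "sigma_finite_measure (lam x)" using rokhlin_fibres[OF x] by (simp add: lebesgue_rokhlin_def)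
    show "fibre G x \<in> sets (lam x)" using fibre_sets_object[OF x] fibred_systemD(1)[OF fibred_lam x] by simp
  qed
  note sp = space_fibre_space[OF x] object_in_fibre[OF x] g
  have ev: "\<forall>\<^sub>F n in sequentially. defect (mixture (pmf_of_set {..<Suc n}) (kpow \<pi>)) g \<le> ennreal \<delta>" if \<delta>: "0 < \<delta>" for \<delta>
  proof -
    obtain n1 where n1: "\<forall>n\<ge>n1. \<forall>A\<in>sets (fibre_space G x). F.cesaro n A g - F.cesaro n A x \<le> \<delta>"
      using F.cesaro_diff_le[OF fin triv _ _ \<delta>, of g x] sp by auto
    obtain n2 where n2: "\<forall>n\<ge>n2. \<forall>A\<in>sets (fibre_space G x). F.cesaro n A x - F.cesaro n A g \<le> \<delta>"
      using F.cesaro_diff_le[OF fin triv _ _ \<delta>, of x g] sp by auto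
    have "defect (mixture (pmf_of_set {..<Suc n}) (kpow \<pi>)) g \<le> ennreal \<delta>" if n: "n \<ge> max n1 n2" for n
      unfolding defect_def sup_dist_def gm(2)
    proof (rule SUP_least)
      fix A assume "A \<in> gen_alg"
      then have A: "A \<in> sets arr" unfolding gen_alg(3) by (rule sigma_sets.Basic)
      then have AF: "A \<inter> fibre G x \<in> sets (fibre_space G x)"
        by (auto simp: fibre_space_def sets_restrict_space)
      have "\<bar>markov_kernel.cesaro \<pi> (Suc n) A g - markov_kernel.cesaro \<pi> (Suc n) A x\<bar> \<le> \<delta>"
        using n1[rule_format, of "Suc n", OF _ AF] n2[rule_format, of "Suc n", OF _ AF] n
        by (simp add: cesaro_fibre[OF \<pi> x g] cesaro_fibre[OF \<pi> x object_in_fibre[OF x]] abs_le_iff)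
      then show "ennreal \<bar>measure (mixture (pmf_of_set {..<Suc n}) (kpow \<pi>) g) A -
          measure (mixture (pmf_of_set {..<Suc n}) (kpow \<pi>) x) A\<bar> \<le> ennreal \<delta>"
        by (intro ennreal_leI)
          (simp only: measure_cesaro_mixture[OF \<pi> gm(1) A] measure_cesaro_mixture[OF \<pi> object_mor[OF x] A])
    qed
    then show ?thesis unfolding eventually_sequentially by blast
  qed
  show ?thesis
  proof (rule order_tendstoI)
    fix a :: ennreal assume "0 < a"
    then obtain b where b: "0 < b" "b < a" using dense by blast
    obtain r where r: "b = ennreal r" "0 < r"
      using b by (cases b) (auto simp: less_top[symmetric])
    show "\<forall>\<^sub>F n in sequentially. defect (mixture (pmf_of_set {..<Suc n}) (kpow \<pi>)) g < a"
      using ev[OF r(2)] by eventually_elim (use b r in \<open>auto intro: le_less_trans\<close>)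
  qed simp
qed

text \<open>The required systems are the Cesaro kernels at the objects. Their defects are bounded by
  1 and tend to 0 almost everywhere for each test measure, so dominated convergence applies; the
  factor 2 is the comparison with total variation.\<close>

theorem liouville_imp_amenable:
  assumes \<pi>: "ac_chain \<pi>" and L: "fibrewise_liouville G lam kap \<pi>"
  shows "amenable G lam kap"
proof -
  define \<theta> where "\<theta> n = mixture (pmf_of_set {..<Suc n}) (kpow \<pi>)" for n
  have \<theta>: "ac_chain (\<theta> n)" for n
    unfolding \<theta>_def by (rule ac_chain_mixture[OF ac_chain_kpow[OF \<pi>]])
  have "fibred_system G (\<theta> n)" for n
    unfolding fibred_system_def
  proof (intro conjI ballI allI impI)
    fix x assume x: "x \<in> objects G"
    show "sets (\<theta> n x) = sets arr" by (rule ac_chainD(2)[OF \<theta> object_mor[OF x]])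
    show "AE g in \<theta> n x. g \<in> fibre G x"
      using ac_chainD(5)[OF \<theta> object_mor[OF x]] by (simp add: target_identity x)
  next
    fix f :: "'a \<Rightarrow> ennreal" assume f: "f \<in> borel_measurable arr"
    show "(\<lambda>x. \<integral>\<^sup>+g. f g \<partial>\<theta> n x) \<in> borel_measurable (obj_space G)"
      unfolding obj_space_def
      by (intro measurable_restrict_space1
          measurable_compose[OF measurable_prob_algebraD[OF ac_chainD(1)[OF \<theta>]] nn_integral_measurable_subprob_algebra[OF f]])
  qed
  moreover have "prob_space (\<theta> n x)" "absolutely_continuous (lam x) (\<theta> n x)" if x: "x \<in> objects G" for n x
    using ac_chainD(4,7)[OF \<theta> object_mor[OF x]] by (simp_all add: target_identity x)
  moreover have "(\<lambda>n. \<integral>\<^sup>+g. tv_dist (translate G g (\<theta> n (source G g))) (\<theta> n (target G g)) \<partial>m) \<longlonglongrightarrow> 0"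
    if m: "prob_space m" "sets m = sets arr" "absolutely_continuous star m" for m
  proof -
    interpret m: prob_space m by fact
    have spm: "space m = mor G" using sets_eq_imp_space_eq[OF m(2)] space_arr by simp
    have le: "tv_dist (translate G g (\<theta> n (source G g))) (\<theta> n (target G g)) \<le> 2 * defect (\<theta> n) g" if g: "g \<in> mor G" for n g
    proof -
      have c: "(g, source G g) \<in> composable G"
        using g source_object object_mor by (simp add: composable_def target_identity)
      have "translate G g (\<theta> n (source G g)) = \<theta> n g"
        using ac_chainD(6)[OF \<theta> c] by (simp add: mult_source[OF g])
      then show ?thesis
        using countably_generated_pair.tv_dist_le_sup_dist[OF defect_pair[OF \<theta> g]] by (simp add: defect_def)
    qed
    have "AE g in m. poisson_boundary_trivial (fibre_space G (target G g)) (fibre_chain G \<pi> (target G g))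
        (restrict_space (lam (target G g)) (fibre G (target G g)))"
      using L unfolding fibrewise_liouville_def by (rule AE_kap_AE_target[OF _ m(2,3)])
    with AE_space have lim: "AE g in m. (\<lambda>n. defect (\<theta> n) g) \<longlonglongrightarrow> 0"
    proof eventually_elim
      case (elim g)
      then have g: "g \<in> mor G" by (simp add: spm)
      have "g \<in> fibre G (target G g)" using g by (simp add: fibre_def)
      then show ?case unfolding \<theta>_def by (rule liouville_defect_tendsto[OF \<pi> target_object[OF g] _ elim(2)])
    qed
    have dm: "defect (\<theta> n) \<in> borel_measurable m" for n
      using defect_measurable[OF \<theta>] by (simp add: measurable_cong_sets[OF m(2) refl])
    have "(\<lambda>n. \<integral>\<^sup>+g. defect (\<theta> n) g \<partial>m) \<longlonglongrightarrow> (\<integral>\<^sup>+g. 0 \<partial>m)"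
    proof (rule nn_integral_dominated_convergence[where w="\<lambda>_. 1"])
      show "AE g in m. defect (\<theta> j) g \<le> 1" for j
        using defect_le_1[OF \<theta>] by (intro AE_I2) (simp add: spm)
    qed (use dm lim m.emeasure_space_1 in simp_all)
    then have "(\<lambda>n. 2 * (\<integral>\<^sup>+g. defect (\<theta> n) g \<partial>m)) \<longlonglongrightarrow> 2 * 0"
      by (intro ennreal_tendsto_cmult) simp_all
    then have lim2: "(\<lambda>n. 2 * (\<integral>\<^sup>+g. defect (\<theta> n) g \<partial>m)) \<longlonglongrightarrow> 0" by simp
    show ?thesis
    proof (rule tendsto_sandwich[OF _ _ tendsto_const lim2])
      show "\<forall>\<^sub>F n in sequentially. (\<integral>\<^sup>+g. tv_dist (translate G g (\<theta> n (source G g))) (\<theta> n (target G g)) \<partial>m)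
          \<le> 2 * (\<integral>\<^sup>+g. defect (\<theta> n) g \<partial>m)"
      proof (intro always_eventually allI)
        fix n
        have "(\<integral>\<^sup>+g. tv_dist (translate G g (\<theta> n (source G g))) (\<theta> n (target G g)) \<partial>m) \<le> (\<integral>\<^sup>+g. 2 * defect (\<theta> n) g \<partial>m)"
          using le by (intro nn_integral_mono) (simp add: spm)
        then show "(\<integral>\<^sup>+g. tv_dist (translate G g (\<theta> n (source G g))) (\<theta> n (target G g)) \<partial>m) \<le> 2 * (\<integral>\<^sup>+g. defect (\<theta> n) g \<partial>m)"
          by (simp add: nn_integral_cmult dm)
      qed
    qed simp
  qed
  ultimately show ?thesis unfolding amenable_def by blast
qed

text \<open>Exit events are tail events.\<close>

lemma tail_trivial_imp_liouville:
  assumes "fibrewise_tail_trivial G lam kap \<pi>" shows "fibrewise_liouville G lam kap \<pi>"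
  using assms unfolding fibrewise_tail_trivial_def fibrewise_liouville_def
  by (rule eventually_mono)
    (auto simp: tail_boundary_trivial_def poisson_boundary_trivial_def trivial_events_def exit_sets_def)

end

section \<open>Trivial tail boundary from amenability\<close>

definition geom_weight :: "nat \<Rightarrow> ennreal" where "geom_weight k = ennreal ((1/2) ^ Suc k)"

lemma sum_geom_weight: "(\<Sum>i<m. geom_weight i) = ennreal (1 - (1/2) ^ m)"
proof -
  have "(\<Sum>i<m. (1/2 :: real) ^ Suc i) = 1 - (1/2) ^ m"
    by (induction m) (simp_all add: field_simps)
  then show ?thesis unfolding geom_weight_def by (simp only: sum_ennreal zero_le_power zero_le_divide_1_iff zero_le_numeral)
qed

lemma suminf_geom_weight: "(\<Sum>k. geom_weight (k + m)) = ennreal ((1/2) ^ m)"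
proof -
  have "(\<lambda>k. (1/2) ^ Suc m * (1/2 :: real) ^ k) sums ((1/2) ^ Suc m * (1 / (1 - 1/2)))"
    by (intro sums_mult geometric_sums) simp
  then have "(\<lambda>k. (1/2 :: real) ^ Suc (k + m)) sums (1/2) ^ m"
    by (simp add: power_add mult.commute mult.left_commute)
  then show ?thesis unfolding geom_weight_def by (intro suminf_ennreal_eq) simp_all
qed

lemma nn_integral_geometric_pmf:
  fixes F :: "nat \<Rightarrow> ennreal"
  shows "(\<integral>\<^sup>+k. F k \<partial>measure_pmf (geometric_pmf (1/2))) = (\<Sum>k. geom_weight k * F k)"
proof -
  have "pmf (geometric_pmf (1/2)) k = (1/2 :: real) ^ Suc k" for k
    by (subst pmf_geometric) auto
  then show ?thesis
    unfolding nn_integral_measure_pmf nn_integral_count_space_nat geom_weight_def by (simp only:)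
qed

lemma suminf_split_ennreal:
  fixes f :: "nat \<Rightarrow> ennreal"
  shows "(\<Sum>k. f k) = (\<Sum>k<m. f k) + (\<Sum>k. f (k + m))"
  by (subst suminf_offset[of f m]) (simp_all add: add.commute summableI)

lemma tendsto_0_of_suminf_ennreal:
  fixes f :: "nat \<Rightarrow> ennreal"
  assumes "(\<Sum>k. f k) \<noteq> top" shows "f \<longlonglongrightarrow> 0"
proof -
  have "f k \<noteq> top" for k
  proof
    assume "f k = top"
    moreover have "f k \<le> (\<Sum>k. f k)"
      using sum_le_suminf[of f "{k}"] by (simp add: summableI)
    ultimately show False using assms by (simp add: top_unique)
  qed
  then have f: "f k = ennreal (enn2real (f k))" for k by (simp add: less_top)
  have "(\<Sum>k. ennreal (enn2real (f k))) \<noteq> top" using assms f by simp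
  then have "summable (\<lambda>k. enn2real (f k))" by (intro summable_suminf_not_top) auto
  then have "(\<lambda>k. enn2real (f k)) \<longlonglongrightarrow> 0" by (rule summable_LIMSEQ_zero)
  then have "(\<lambda>k. ennreal (enn2real (f k))) \<longlonglongrightarrow> ennreal 0" by (rule tendsto_ennrealI)
  then show ?thesis using f by simp
qed

context measured_groupoid
begin

text \<open>The part of one step of the geometric mixture that uses kernels of index below
  \<open>m\<close>: an operator of total mass \<open>1 - (1/2)^m\<close>.\<close>

definition trunc_step :: "(nat \<Rightarrow> 'a \<Rightarrow> 'a measure) \<Rightarrow> nat \<Rightarrow> ('a \<Rightarrow> ennreal) \<Rightarrow> 'a \<Rightarrow> ennreal" where
  "trunc_step \<kappa> m u g = (\<Sum>i<m. geom_weight i * (\<integral>\<^sup>+h. u h \<partial>\<kappa> i g))"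

definition slack :: "(nat \<Rightarrow> 'a \<Rightarrow> 'a measure) \<Rightarrow> nat \<Rightarrow> 'a \<Rightarrow> ennreal" where
  "slack \<kappa> m g = (\<Sum>k. geom_weight (k + m) * defect (\<kappa> (k + m)) g)"

text \<open>The power is the probability that none of \<open>n\<close> steps uses a kernel of index
  at least \<open>m\<close>. The sum is over the number \<open>j\<close> of steps before the first
  such use; its term is the defect incurred then.\<close>

definition merge_error :: "(nat \<Rightarrow> 'a \<Rightarrow> 'a measure) \<Rightarrow> nat \<Rightarrow> nat \<Rightarrow> 'a \<Rightarrow> ennreal" where
  "merge_error \<kappa> m n g = ennreal (1 - (1/2) ^ m) ^ n + (\<Sum>j<n. (trunc_step \<kappa> m ^^ j) (slack \<kappa> m) g)"

text \<open>Only kernels of index below \<open>m\<close> enter, which makes the recursive choice of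
  the kernels well founded.\<close>

lemma trunc_step_agree: "(\<And>i. i < m \<Longrightarrow> \<kappa> i = \<kappa>' i) \<Longrightarrow> trunc_step \<kappa> m = trunc_step \<kappa>' m"
  by (auto simp: trunc_step_def fun_eq_iff intro!: sum.cong)

context
  fixes \<kappa> :: "nat \<Rightarrow> 'a \<Rightarrow> 'a measure"
  assumes \<kappa>: "\<And>k. ac_chain (\<kappa> k)"
begin

lemma \<kappa>_measurable: "u \<in> borel_measurable arr \<Longrightarrow> (\<lambda>g. \<integral>\<^sup>+h. u h \<partial>\<kappa> i g) \<in> borel_measurable arr"
  by (rule measurable_compose[OF measurable_prob_algebraD[OF ac_chainD(1)[OF \<kappa>]] nn_integral_measurable_subprob_algebra])

lemma \<kappa>_cong: "g \<in> mor G \<Longrightarrow> u \<in> borel_measurable arr \<Longrightarrow> u \<in> borel_measurable (\<kappa> i g)"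
  by (simp add: measurable_cong_sets[OF ac_chainD(2)[OF \<kappa>] refl])

lemma trunc_step_measurable: "u \<in> borel_measurable arr \<Longrightarrow> trunc_step \<kappa> m u \<in> borel_measurable arr"
  unfolding trunc_step_def[abs_def]
  by (intro borel_measurable_sum borel_measurable_times_ennreal \<kappa>_measurable borel_measurable_const) auto

lemma trunc_step_funpow_measurable: "u \<in> borel_measurable arr \<Longrightarrow> (trunc_step \<kappa> m ^^ j) u \<in> borel_measurable arr"
  by (induction j) (simp_all add: trunc_step_measurable)

lemma trunc_step_cong: "g \<in> mor G \<Longrightarrow> (\<And>h. h \<in> mor G \<Longrightarrow> u h = v h) \<Longrightarrow> trunc_step \<kappa> m u g = trunc_step \<kappa> m v g"
  unfolding trunc_step_def by (intro sum.cong refl arg_cong2[where f="(*)"] nn_integral_cong) (simp add: ac_chainD(3)[OF \<kappa>])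

lemma trunc_step_const: "g \<in> mor G \<Longrightarrow> trunc_step \<kappa> m (\<lambda>_. c) g = ennreal (1 - (1/2) ^ m) * c"
  unfolding trunc_step_def sum_geom_weight[symmetric] sum_distrib_right
  using prob_space.emeasure_space_1[OF ac_chainD(4)[OF \<kappa>]] by (intro sum.cong) simp_all

lemma trunc_step_add:
  assumes "g \<in> mor G" "u \<in> borel_measurable arr" "v \<in> borel_measurable arr"
  shows "trunc_step \<kappa> m (\<lambda>h. u h + v h) g = trunc_step \<kappa> m u g + trunc_step \<kappa> m v g"
  unfolding trunc_step_def sum.distrib[symmetric] distrib_left[symmetric]
  using assms by (intro sum.cong refl arg_cong2[where f="(*)"] nn_integral_add) (simp_all add: \<kappa>_cong)

lemma trunc_step_sum:
  fixes n :: nat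
  assumes g: "g \<in> mor G" and u: "\<And>j. u j \<in> borel_measurable arr"
  shows "trunc_step \<kappa> m (\<lambda>h. \<Sum>j<n. u j h) g = (\<Sum>j<n. trunc_step \<kappa> m (u j) g)"
proof (induction n)
  case 0
  then show ?case using trunc_step_const[OF g, of m 0] by simp
next
  case (Suc n)
  have "(\<lambda>h. \<Sum>j<n. u j h) \<in> borel_measurable arr" using u by simp
  then show ?case using trunc_step_add[OF g _ u[of n], of "\<lambda>h. \<Sum>j<n. u j h" m] Suc by simp
qed

lemma trunc_step_suminf:
  assumes g: "g \<in> mor G" and u: "\<And>k. u k \<in> borel_measurable arr"
  shows "trunc_step \<kappa> m (\<lambda>h. \<Sum>k. w k * u k h) g = (\<Sum>k. w k * trunc_step \<kappa> m (u k) g)"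
proof -
  have "(\<integral>\<^sup>+h. (\<Sum>k. w k * u k h) \<partial>\<kappa> i g) = (\<Sum>k. w k * (\<integral>\<^sup>+h. u k h \<partial>\<kappa> i g))" for i
    using \<kappa>_cong[OF g u] by (subst nn_integral_suminf) (simp_all add: nn_integral_cmult)
  then have "trunc_step \<kappa> m (\<lambda>h. \<Sum>k. w k * u k h) g = (\<Sum>i<m. geom_weight i * (\<Sum>k. w k * (\<integral>\<^sup>+h. u k h \<partial>\<kappa> i g)))"
    by (simp only: trunc_step_def)
  also have "\<dots> = (\<Sum>i<m. \<Sum>k. geom_weight i * (w k * (\<integral>\<^sup>+h. u k h \<partial>\<kappa> i g)))" by simp
  also have "\<dots> = (\<Sum>k. \<Sum>i<m. geom_weight i * (w k * (\<integral>\<^sup>+h. u k h \<partial>\<kappa> i g)))"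
    by (rule suminf_sum[symmetric]) (simp add: summableI)
  also have "\<dots> = (\<Sum>k. w k * trunc_step \<kappa> m (u k) g)"
    unfolding trunc_step_def sum_distrib_left by (intro suminf_cong sum.cong) (simp_all add: ac_simps)
  finally show ?thesis .
qed

lemma slack_measurable: "slack \<kappa> m \<in> borel_measurable arr"
  unfolding slack_def[abs_def] using defect_measurable[OF \<kappa>]
  by (intro borel_measurable_suminf_order borel_measurable_times_ennreal) auto

lemma trunc_step_funpow_slack:
  assumes "g \<in> mor G"
  shows "(trunc_step \<kappa> m ^^ j) (slack \<kappa> m) g = (\<Sum>k. geom_weight (k + m) * (trunc_step \<kappa> m ^^ j) (defect (\<kappa> (k + m))) g)"
  using assms
proof (induction j arbitrary: g)
  case 0
  then show ?case by (simp add: slack_def)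
next
  case (Suc j)
  have "(trunc_step \<kappa> m ^^ Suc j) (slack \<kappa> m) g = trunc_step \<kappa> m (\<lambda>h. \<Sum>k. geom_weight (k + m) * (trunc_step \<kappa> m ^^ j) (defect (\<kappa> (k + m))) h) g"
    using trunc_step_cong[OF Suc.prems Suc.IH] by simp
  also have "\<dots> = (\<Sum>k. geom_weight (k + m) * trunc_step \<kappa> m ((trunc_step \<kappa> m ^^ j) (defect (\<kappa> (k + m)))) g)"
    by (intro trunc_step_suminf Suc.prems trunc_step_funpow_measurable defect_measurable \<kappa>)
  finally show ?case by simp
qed

lemma merge_error_measurable: "merge_error \<kappa> m n \<in> borel_measurable arr"
  unfolding merge_error_def[abs_def]
  by (intro borel_measurable_add borel_measurable_const borel_measurable_sum trunc_step_funpow_measurable slack_measurable)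

lemma merge_error_Suc:
  assumes g: "g \<in> mor G" shows "merge_error \<kappa> m (Suc n) g = slack \<kappa> m g + trunc_step \<kappa> m (merge_error \<kappa> m n) g"
proof -
  have "trunc_step \<kappa> m (merge_error \<kappa> m n) g = trunc_step \<kappa> m (\<lambda>_. ennreal (1 - (1/2) ^ m) ^ n) g +
      trunc_step \<kappa> m (\<lambda>h. \<Sum>j<n. (trunc_step \<kappa> m ^^ j) (slack \<kappa> m) h) g"
    unfolding merge_error_def[abs_def]
    by (intro trunc_step_add g borel_measurable_const borel_measurable_sum trunc_step_funpow_measurable slack_measurable)
  also have "\<dots> = ennreal (1 - (1/2) ^ m) ^ Suc n + (\<Sum>j<n. (trunc_step \<kappa> m ^^ Suc j) (slack \<kappa> m) g)"
    by (subst trunc_step_sum[OF g]) (simp_all add: trunc_step_const[OF g] trunc_step_funpow_measurable slack_measurable)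
  finally show ?thesis
    unfolding merge_error_def by (simp add: sum.lessThan_Suc_shift ac_simps del: sum.lessThan_Suc)
qed

text \<open>The first step by one of the \<open>\<kappa> k\<close> with \<open>k \<ge> m\<close> forgets the starting point up to the defect of
  \<open>\<kappa> k\<close>; the weight of the paths which never make such a step decays geometrically.\<close>

lemma mixture_step_le:
  fixes m :: nat and c :: "'a \<Rightarrow> ennreal"
  assumes u: "u \<in> borel_measurable arr" and g: "g \<in> mor G"
    and e: "e \<in> borel_measurable arr" and u1: "\<And>h. h \<in> mor G \<Longrightarrow> u h \<le> 1"
    and c: "\<And>h. h \<in> mor G \<Longrightarrow> u h \<le> c (target G h) + e h \<and> c (target G h) \<le> u h + e h"
  defines "c' \<equiv> \<lambda>x. ennreal (1 - (1/2) ^ m) * c x + (\<Sum>k. geom_weight (k + m) * (\<integral>\<^sup>+h. u h \<partial>\<kappa> (k + m) x))"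
  shows "markov_kernel.Kop (mixture (geometric_pmf (1/2)) \<kappa>) u g \<le> c' (target G g) + (slack \<kappa> m g + trunc_step \<kappa> m e g)"
    and "c' (target G g) \<le> markov_kernel.Kop (mixture (geometric_pmf (1/2)) \<kappa>) u g + (slack \<kappa> m g + trunc_step \<kappa> m e g)"
proof -
  interpret markov_kernel arr "mixture (geometric_pmf (1/2)) \<kappa>"
    by (rule ac_chain_markov_kernel[OF ac_chain_mixture[OF \<kappa>]])
  let ?x = "target G g"
  let ?T = "\<lambda>y. \<Sum>k. geom_weight (k + m) * (\<integral>\<^sup>+h. u h \<partial>\<kappa> (k + m) y)"
  let ?s = "ennreal (1 - (1/2) ^ m)"
  \<comment> \<open>The mixture is split at index \<open>m\<close>. Early kernels stay in the fibre,
    where the old constant still serves; late ones are moved to the base point \<open>?x\<close>,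
    and their values there become the new part of \<open>c'\<close>.\<close>
  have K: "Kop u g = trunc_step \<kappa> m u g + ?T g"
    unfolding Kop_def nn_integral_mixture[OF \<kappa> g u] nn_integral_geometric_pmf trunc_step_def
    by (rule suminf_split_ennreal)
  have i1: "(\<integral>\<^sup>+h. u h \<partial>\<kappa> i g) \<le> c ?x + (\<integral>\<^sup>+h. e h \<partial>\<kappa> i g)"
    and i2: "c ?x \<le> (\<integral>\<^sup>+h. u h \<partial>\<kappa> i g) + (\<integral>\<^sup>+h. e h \<partial>\<kappa> i g)" for i
  proof -
    have one: "emeasure (\<kappa> i g) (space (\<kappa> i g)) = 1"
      by (rule prob_space.emeasure_space_1[OF ac_chainD(4)[OF \<kappa> g]])
    have "(\<integral>\<^sup>+h. u h \<partial>\<kappa> i g) \<le> (\<integral>\<^sup>+h. c ?x + e h \<partial>\<kappa> i g)"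
    proof (rule nn_integral_mono_AE)
      show "AE h in \<kappa> i g. u h \<le> c ?x + e h"
        using ac_chainD(5)[OF \<kappa> g]
      proof eventually_elim
        case (elim h)
        then show ?case using c[of h] fibreD[OF elim] by simp
      qed
    qed
    also have "\<dots> = c ?x + (\<integral>\<^sup>+h. e h \<partial>\<kappa> i g)"
      using \<kappa>_cong[OF g e] by (subst nn_integral_add) (simp_all add: one)
    finally show "(\<integral>\<^sup>+h. u h \<partial>\<kappa> i g) \<le> c ?x + (\<integral>\<^sup>+h. e h \<partial>\<kappa> i g)" .
    have "c ?x = (\<integral>\<^sup>+h. c ?x \<partial>\<kappa> i g)" by (simp add: one)
    also have "\<dots> \<le> (\<integral>\<^sup>+h. u h + e h \<partial>\<kappa> i g)"
    proof (rule nn_integral_mono_AE)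
      show "AE h in \<kappa> i g. c ?x \<le> u h + e h"
        using ac_chainD(5)[OF \<kappa> g]
      proof eventually_elim
        case (elim h)
        then show ?case using c[of h] fibreD[OF elim] by simp
      qed
    qed
    also have "\<dots> = (\<integral>\<^sup>+h. u h \<partial>\<kappa> i g) + (\<integral>\<^sup>+h. e h \<partial>\<kappa> i g)"
      by (intro nn_integral_add \<kappa>_cong g u e)
    finally show "c ?x \<le> (\<integral>\<^sup>+h. u h \<partial>\<kappa> i g) + (\<integral>\<^sup>+h. e h \<partial>\<kappa> i g)" .
  qed
  have s1: "trunc_step \<kappa> m u g \<le> ?s * c ?x + trunc_step \<kappa> m e g"
    unfolding trunc_step_def sum_geom_weight[symmetric] sum_distrib_right sum.distrib[symmetric] distrib_left[symmetric]
    by (intro sum_mono mult_left_mono i1) simp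
  have s2: "?s * c ?x \<le> trunc_step \<kappa> m u g + trunc_step \<kappa> m e g"
    unfolding trunc_step_def sum_geom_weight[symmetric] sum_distrib_right sum.distrib[symmetric] distrib_left[symmetric]
    by (intro sum_mono mult_left_mono i2) simp
  have t1: "(\<integral>\<^sup>+h. u h \<partial>\<kappa> i g) \<le> (\<integral>\<^sup>+h. u h \<partial>\<kappa> i ?x) + defect (\<kappa> i) g" for i
    unfolding defect_def
    by (intro countably_generated_pair.nn_integral_le_sup_dist[OF defect_pair[OF \<kappa> g]] \<kappa>_cong g u)
      (simp add: ac_chainD(3)[OF \<kappa> g] u1)
  have t2: "(\<integral>\<^sup>+h. u h \<partial>\<kappa> i ?x) \<le> (\<integral>\<^sup>+h. u h \<partial>\<kappa> i g) + defect (\<kappa> i) g" for i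
  proof -
    have "countably_generated_pair gen_alg (\<kappa> i ?x) (\<kappa> i g)"
      by (intro countably_generated_pairI ac_chainD(2,4)[OF \<kappa>] target_mor g)
    from countably_generated_pair.nn_integral_le_sup_dist[OF this \<kappa>_cong[OF target_mor[OF g] u]] show ?thesis
      unfolding defect_def by (subst sup_dist_commute) (simp add: ac_chainD(3)[OF \<kappa> target_mor[OF g]] u1)
  qed
  have T1: "?T g \<le> ?T ?x + slack \<kappa> m g"
    unfolding slack_def suminf_add[OF summableI summableI] distrib_left[symmetric]
    by (intro suminf_le summableI mult_left_mono t1) simp
  have T2: "?T ?x \<le> ?T g + slack \<kappa> m g"
    unfolding slack_def suminf_add[OF summableI summableI] distrib_left[symmetric]
    by (intro suminf_le summableI mult_left_mono t2) simp
  show "Kop u g \<le> c' ?x + (slack \<kappa> m g + trunc_step \<kappa> m e g)"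
    using add_mono[OF s1 T1] unfolding K c'_def by (simp add: ac_simps)
  show "c' ?x \<le> Kop u g + (slack \<kappa> m g + trunc_step \<kappa> m e g)"
    using add_mono[OF s2 T2] unfolding K c'_def by (simp add: ac_simps)
qed

text \<open>\<open>c\<close> is a function of the target, one constant for each fibre. Each step of
  the induction is \<open>mixture_step_le\<close>, matched by the recursion
  \<open>merge_error_Suc\<close>.\<close>

lemma mixture_almost_constant:
  assumes h: "h \<in> borel_measurable arr" and h1: "\<And>g. g \<in> mor G \<Longrightarrow> h g \<le> 1"
  shows "\<exists>c. \<forall>g\<in>mor G.
    (markov_kernel.Kop (mixture (geometric_pmf (1/2)) \<kappa>) ^^ n) h g \<le> c (target G g) + merge_error \<kappa> m n g \<and>
    c (target G g) \<le> (markov_kernel.Kop (mixture (geometric_pmf (1/2)) \<kappa>) ^^ n) h g + merge_error \<kappa> m n g"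
proof -
  interpret markov_kernel arr "mixture (geometric_pmf (1/2)) \<kappa>"
    by (rule ac_chain_markov_kernel[OF ac_chain_mixture[OF \<kappa>]])
  show ?thesis
  proof (induction n)
    case 0
    \<comment> \<open>For \<open>n = 0\<close> the merging error is 1, which covers any
      \<open>h \<le> 1\<close> with constant 0.\<close>
    show ?case by (rule exI[of _ "\<lambda>_. 0"]) (simp add: merge_error_def h1)
  next
    case (Suc n)
    then obtain c where c: "\<forall>g\<in>mor G. (Kop ^^ n) h g \<le> c (target G g) + merge_error \<kappa> m n g \<and>
        c (target G g) \<le> (Kop ^^ n) h g + merge_error \<kappa> m n g" by blast
    have u: "(Kop ^^ n) h \<in> borel_measurable arr" by (rule Kop_funpow_measurable[OF h])
    have u1: "(Kop ^^ n) h g \<le> 1" if "g \<in> mor G" for g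
      by (rule Kop_funpow_le_1) (use that h1 in \<open>simp_all add: space_arr\<close>)
    have c': "(Kop ^^ n) h g \<le> c (target G g) + merge_error \<kappa> m n g \<and> c (target G g) \<le> (Kop ^^ n) h g + merge_error \<kappa> m n g"
      if "g \<in> mor G" for g
      using c that by blast
    show ?case
    proof (intro exI ballI)
      fix g assume g: "g \<in> mor G"
      show "(Kop ^^ Suc n) h g \<le>
          (\<lambda>x. ennreal (1 - (1/2) ^ m) * c x + (\<Sum>k. geom_weight (k + m) * (\<integral>\<^sup>+l. (Kop ^^ n) h l \<partial>\<kappa> (k + m) x))) (target G g)
            + merge_error \<kappa> m (Suc n) g \<and>
          (\<lambda>x. ennreal (1 - (1/2) ^ m) * c x + (\<Sum>k. geom_weight (k + m) * (\<integral>\<^sup>+l. (Kop ^^ n) h l \<partial>\<kappa> (k + m) x))) (target G g)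
            \<le> (Kop ^^ Suc n) h g + merge_error \<kappa> m (Suc n) g"
        using mixture_step_le[OF u g merge_error_measurable u1 c'] unfolding merge_error_Suc[OF g] funpow.simps comp_apply
        by (intro conjI)
    qed
  qed
qed

text \<open>Each of the two terms of the error contributes at most \<open>(1/2)^m\<close>: the first
  by the choice of \<open>n\<close>, the second because the weights from index \<open>m\<close> on
  add up to \<open>(1/2)^m\<close> and \<open>sm\<close> bounds what they multiply by 1.\<close>

lemma nn_integral_merge_error_le:
  assumes m0: "prob_space m0" "sets m0 = sets arr"
    and N: "(1 - (1/2 :: real) ^ m) ^ n \<le> (1/2) ^ m"
    and sm: "\<And>k. (\<Sum>j<n. \<integral>\<^sup>+g. (trunc_step \<kappa> m ^^ j) (defect (\<kappa> (k + m))) g \<partial>m0) \<le> 1"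
  shows "(\<integral>\<^sup>+g. merge_error \<kappa> m n g \<partial>m0) \<le> ennreal (2 * (1/2) ^ m)"
proof -
  interpret m0: prob_space m0 by fact
  have sp: "space m0 = mor G" using sets_eq_imp_space_eq[OF m0(2)] space_arr by simp
  have mm: "f \<in> borel_measurable m0" if "f \<in> borel_measurable arr" for f :: "'a \<Rightarrow> ennreal"
    using that by (simp add: measurable_cong_sets[OF m0(2) refl])
  have dm: "(trunc_step \<kappa> m ^^ j) (defect (\<kappa> (k + m))) \<in> borel_measurable m0" for j k
    by (intro mm trunc_step_funpow_measurable defect_measurable \<kappa>)
  have "(\<integral>\<^sup>+g. merge_error \<kappa> m n g \<partial>m0) = ennreal (1 - (1/2) ^ m) ^ n + (\<integral>\<^sup>+g. (\<Sum>j<n. (trunc_step \<kappa> m ^^ j) (slack \<kappa> m) g) \<partial>m0)"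
    unfolding merge_error_def
    by (subst nn_integral_add)
      (auto intro!: mm borel_measurable_sum trunc_step_funpow_measurable slack_measurable simp: m0.emeasure_space_1)
  also have "(\<integral>\<^sup>+g. (\<Sum>j<n. (trunc_step \<kappa> m ^^ j) (slack \<kappa> m) g) \<partial>m0) =
     (\<Sum>j<n. \<integral>\<^sup>+g. (trunc_step \<kappa> m ^^ j) (slack \<kappa> m) g \<partial>m0)"
    by (intro nn_integral_sum mm trunc_step_funpow_measurable slack_measurable)
  also have "\<dots> = (\<Sum>j<n. \<Sum>k. geom_weight (k + m) * (\<integral>\<^sup>+g. (trunc_step \<kappa> m ^^ j) (defect (\<kappa> (k + m))) g \<partial>m0))"
  proof (intro sum.cong refl)
    fix j
    have "(\<integral>\<^sup>+g. (trunc_step \<kappa> m ^^ j) (slack \<kappa> m) g \<partial>m0) = (\<integral>\<^sup>+g. (\<Sum>k. geom_weight (k + m) * (trunc_step \<kappa> m ^^ j) (defect (\<kappa> (k + m))) g) \<partial>m0)"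
      by (intro nn_integral_cong) (simp add: sp trunc_step_funpow_slack)
    also have "\<dots> = (\<Sum>k. geom_weight (k + m) * (\<integral>\<^sup>+g. (trunc_step \<kappa> m ^^ j) (defect (\<kappa> (k + m))) g \<partial>m0))"
      using dm by (subst nn_integral_suminf) (simp_all add: nn_integral_cmult)
    finally show "(\<integral>\<^sup>+g. (trunc_step \<kappa> m ^^ j) (slack \<kappa> m) g \<partial>m0) = (\<Sum>k. geom_weight (k + m) * (\<integral>\<^sup>+g. (trunc_step \<kappa> m ^^ j) (defect (\<kappa> (k + m))) g \<partial>m0))" .
  qed
  also have "\<dots> = (\<Sum>k. \<Sum>j<n. geom_weight (k + m) * (\<integral>\<^sup>+g. (trunc_step \<kappa> m ^^ j) (defect (\<kappa> (k + m))) g \<partial>m0))"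
    by (rule suminf_sum[symmetric]) (simp add: summableI)
  also have "\<dots> \<le> (\<Sum>k. geom_weight (k + m) * 1)"
    unfolding sum_distrib_left[symmetric] by (intro suminf_le summableI mult_left_mono sm) simp
  also have "\<dots> = ennreal ((1/2) ^ m)" by (simp add: suminf_geom_weight)
  also have "ennreal (1 - (1/2) ^ m) ^ n = ennreal ((1 - (1/2) ^ m) ^ n)"
    by (rule ennreal_power) (simp add: power_le_one)
  also have "\<dots> \<le> ennreal ((1/2) ^ m)" by (rule ennreal_leI[OF N])
  finally have "(\<integral>\<^sup>+g. merge_error \<kappa> m n g \<partial>m0) \<le> ennreal ((1/2) ^ m) + ennreal ((1/2) ^ m)"
    by (simp add: add_mono)
  also have "\<dots> = ennreal (2 * (1/2) ^ m)" by (subst ennreal_plus[symmetric]) simp_all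
  finally show ?thesis .
qed

text \<open>One step carries \<open>m0\<close> to the measures \<open>m0 \<bind> \<kappa> i\<close>,
  which are again absolutely continuous with respect to \<open>star\<close>. The hypothesis on all
  such measures thus survives the induction, in which \<open>m0\<close> varies.\<close>

lemma trunc_step_funpow_tendsto_0:
  assumes m0: "prob_space m0" "sets m0 = sets arr" "absolutely_continuous star m0"
    and u: "\<And>n. u n \<in> borel_measurable arr"
    and lim: "\<And>m0. prob_space m0 \<Longrightarrow> sets m0 = sets arr \<Longrightarrow> absolutely_continuous star m0 \<Longrightarrow>
      (\<lambda>n. \<integral>\<^sup>+g. u n g \<partial>m0) \<longlonglongrightarrow> 0"
  shows "(\<lambda>n. \<integral>\<^sup>+g. (trunc_step \<kappa> m ^^ j) (u n) g \<partial>m0) \<longlonglongrightarrow> 0"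
  using m0
proof (induction j arbitrary: m0)
  case 0
  then show ?case using lim by simp
next
  case (Suc j)
  interpret m0: prob_space m0 by fact
  have sp: "space m0 = mor G" using sets_eq_imp_space_eq[OF Suc.prems(2)] space_arr by simp
  have m0in: "m0 \<in> space (prob_algebra arr)" using Suc.prems by (simp add: space_prob_algebra)
  have \<kappa>m: "\<kappa> i \<in> m0 \<rightarrow>\<^sub>M subprob_algebra arr" for i
    using measurable_prob_algebraD[OF ac_chainD(1)[OF \<kappa>]] by (simp add: measurable_cong_sets[OF Suc.prems(2) refl])
  have bind: "prob_space (m0 \<bind> \<kappa> i)" "sets (m0 \<bind> \<kappa> i) = sets arr" "absolutely_continuous star (m0 \<bind> \<kappa> i)" for i
  proof -
    show "prob_space (m0 \<bind> \<kappa> i)" by (rule prob_space_bind'[OF m0in ac_chainD(1)[OF \<kappa>]])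
    show s: "sets (m0 \<bind> \<kappa> i) = sets arr" by (rule sets_bind'[OF m0in ac_chainD(1)[OF \<kappa>]])
    show "absolutely_continuous star (m0 \<bind> \<kappa> i)"
      unfolding absolutely_continuous_def
    proof
      fix A assume A: "A \<in> null_sets star"
      then have As: "A \<in> sets arr" by (auto simp: sets_star[symmetric])
      have "AE x in kap. emeasure (lam x) A = 0" using A null_sets_star_iff[OF As] by simp
      from AE_kap_AE_target[OF this Suc.prems(2,3)] AE_space
      have "AE g in m0. emeasure (\<kappa> i g) A = 0"
        by eventually_elim (simp add: sp ac_chain_null[OF \<kappa> _ As])
      then have "(\<integral>\<^sup>+g. emeasure (\<kappa> i g) A \<partial>m0) = (\<integral>\<^sup>+g. 0 \<partial>m0)" by (rule nn_integral_cong_AE)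
      then have "emeasure (m0 \<bind> \<kappa> i) A = 0"
        using emeasure_bind[OF m0.not_empty \<kappa>m As] by simp
      then show "A \<in> null_sets (m0 \<bind> \<kappa> i)" using As s by (simp add: null_sets_def)
    qed
  qed
  have um: "(trunc_step \<kappa> m ^^ j) (u n) \<in> borel_measurable arr" for n by (rule trunc_step_funpow_measurable[OF u])
  have "(\<integral>\<^sup>+g. (trunc_step \<kappa> m ^^ Suc j) (u n) g \<partial>m0) = (\<Sum>i<m. geom_weight i * (\<integral>\<^sup>+g. (trunc_step \<kappa> m ^^ j) (u n) g \<partial>(m0 \<bind> \<kappa> i)))" for n
  proof -
    have km: "(\<lambda>g. \<integral>\<^sup>+h. (trunc_step \<kappa> m ^^ j) (u n) h \<partial>\<kappa> i g) \<in> borel_measurable m0" for i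
      using \<kappa>_measurable[OF um] by (simp add: measurable_cong_sets[OF Suc.prems(2) refl])
    have "(\<integral>\<^sup>+g. (trunc_step \<kappa> m ^^ Suc j) (u n) g \<partial>m0) = (\<integral>\<^sup>+g. (\<Sum>i<m. geom_weight i * (\<integral>\<^sup>+h. (trunc_step \<kappa> m ^^ j) (u n) h \<partial>\<kappa> i g)) \<partial>m0)"
      by (simp add: trunc_step_def[of _ _ "(trunc_step \<kappa> m ^^ j) (u n)"])
    also have "\<dots> = (\<Sum>i<m. geom_weight i * (\<integral>\<^sup>+g. (\<integral>\<^sup>+h. (trunc_step \<kappa> m ^^ j) (u n) h \<partial>\<kappa> i g) \<partial>m0))"
      using km by (subst nn_integral_sum) (simp_all add: nn_integral_cmult)
    also have "\<dots> = (\<Sum>i<m. geom_weight i * (\<integral>\<^sup>+g. (trunc_step \<kappa> m ^^ j) (u n) g \<partial>(m0 \<bind> \<kappa> i)))"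
      by (simp add: nn_integral_bind[OF um \<kappa>m])
    finally show ?thesis .
  qed
  moreover have "(\<lambda>n. \<Sum>i<m. geom_weight i * (\<integral>\<^sup>+g. (trunc_step \<kappa> m ^^ j) (u n) g \<partial>(m0 \<bind> \<kappa> i))) \<longlonglongrightarrow> (\<Sum>i<m. geom_weight i * 0)"
    by (intro tendsto_sum ennreal_tendsto_cmult Suc.IH bind) (simp add: geom_weight_def)
  ultimately show ?case by simp
qed

theorem mixture_tail_trivial:
  assumes "AE g in star. (\<lambda>m. merge_error \<kappa> m (N m) g) \<longlonglongrightarrow> 0"
  shows "fibrewise_tail_trivial G lam kap (mixture (geometric_pmf (1/2)) \<kappa>)"
  unfolding fibrewise_tail_trivial_def
  using AE_star_AE_lam[OF assms] AE_space
proof eventually_elim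
  case (elim x)
  then have x: "x \<in> objects G" by (simp add: space_kap)
  let ?\<pi> = "mixture (geometric_pmf (1/2)) \<kappa>"
  have \<pi>: "ac_chain ?\<pi>" by (rule ac_chain_mixture[OF \<kappa>])
  interpret F: ac_markov_kernel "fibre_space G x" "fibre_chain G ?\<pi> x" "restrict_space (lam x) (fibre G x)"
    by (rule fibre_ac_markov_kernel[OF \<pi> x])
  have F: "fibre G x \<in> sets arr" by (rule fibre_sets_object[OF x])
  have F': "fibre G x \<inter> space (lam x) \<in> sets (lam x)"
    using F fibred_systemD(1,2)[OF fibred_lam x] by (simp add: sets.Int_space_eq2 flip: space_arr)
  show ?case
  proof (rule F.tail_boundary_trivialI)
    show "AE g in restrict_space (lam x) (fibre G x). (\<lambda>m. merge_error \<kappa> m (N m) g) \<longlonglongrightarrow> 0"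
      unfolding AE_restrict_space_iff[OF F'] using elim(1) by eventually_elim simp
    fix m and h :: "'a \<Rightarrow> ennreal"
    assume h: "h \<in> borel_measurable (fibre_space G x)" and h1: "\<And>z. z \<in> space (fibre_space G x) \<Longrightarrow> h z \<le> 1"
    \<comment> \<open>Extension by 0 makes \<open>h\<close> a function on all arrows without
      changing it where the fibre chain moves.\<close>
    let ?h = "\<lambda>k. if k \<in> fibre G x then h k else 0"
    have "?h \<in> borel_measurable arr"
      using h F unfolding fibre_space_def
      by (subst (asm) measurable_restrict_space_iff[where c=0]) (auto simp: sets.Int_space_eq2)
    moreover have "?h k \<le> 1" for k using h1 by (simp add: space_fibre_space[OF x])
    ultimately obtain c where c: "\<forall>g\<in>mor G.
        (markov_kernel.Kop ?\<pi> ^^ N m) ?h g \<le> c (target G g) + merge_error \<kappa> m (N m) g \<and>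
        c (target G g) \<le> (markov_kernel.Kop ?\<pi> ^^ N m) ?h g + merge_error \<kappa> m (N m) g"
      using mixture_almost_constant[of ?h "N m" m] by blast
    have "(F.Kop ^^ N m) h y \<le> c x + merge_error \<kappa> m (N m) y \<and> c x \<le> (F.Kop ^^ N m) h y + merge_error \<kappa> m (N m) y"
      if "y \<in> space (fibre_space G x)" for y
    proof -
      have y: "y \<in> fibre G x" using that by (simp add: space_fibre_space[OF x])
      have "(F.Kop ^^ N m) h y = (markov_kernel.Kop ?\<pi> ^^ N m) ?h y" by (rule Kop_fibre[OF \<pi> x y]) simp
      then show ?thesis using bspec[OF c, of y] fibreD[OF y] by simp
    qed
    then show "\<exists>c. \<forall>y\<in>space (fibre_space G x). (F.Kop ^^ N m) h y \<le> c + merge_error \<kappa> m (N m) y \<and>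
        c \<le> (F.Kop ^^ N m) h y + merge_error \<kappa> m (N m) y" by blast
  qed
qed

end

theorem amenable_imp_tail_trivial:
  assumes "amenable G lam kap"
  shows "\<exists>\<pi>. ac_chain \<pi> \<and> fibrewise_tail_trivial G lam kap \<pi>"
proof -
  obtain \<theta> where sys: "\<And>n. fibred_system G (\<theta> n)"
    and prob: "\<And>n x. x \<in> objects G \<Longrightarrow> prob_space (\<theta> n x)"
    and ac: "\<And>n x. x \<in> objects G \<Longrightarrow> absolutely_continuous (lam x) (\<theta> n x)"
    and lim: "\<And>m. prob_space m \<Longrightarrow> sets m = sets arr \<Longrightarrow> absolutely_continuous star m \<Longrightarrow>
      (\<lambda>n. \<integral>\<^sup>+g. tv_dist (translate G g (\<theta> n (source G g))) (\<theta> n (target G g)) \<partial>m) \<longlonglongrightarrow> 0"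
    using assms unfolding amenable_def by blast
  define \<alpha> where "\<alpha> n g = translate G g (\<theta> n (source G g))" for n g
  have \<alpha>: "ac_chain (\<alpha> n)" for n
    unfolding \<alpha>_def[abs_def] by (rule ac_chain_of_system[OF sys prob ac])
  \<comment> \<open>The unit \<open>x\<close> acts trivially on its fibre, so the equivariant
    extension gives back the original system at the objects.\<close>
  have \<alpha>_object: "\<alpha> n x = \<theta> n x" if x: "x \<in> objects G" for n x
  proof (rule measure_eqI_nn_integral)
    note D = fibred_systemD[OF sys x]
    show "sets (\<alpha> n x) = sets arr" by (simp add: \<alpha>_def)
    show "sets (\<theta> n x) = sets arr" by (rule D(1))
    fix f :: "'a \<Rightarrow> ennreal" assume f: "f \<in> borel_measurable arr"
    have "(\<integral>\<^sup>+h. f h \<partial>\<alpha> n x) = (\<integral>\<^sup>+h. lshift x f h \<partial>\<theta> n x)"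
      unfolding \<alpha>_def source_identity[OF x] by (rule nn_integral_translate[OF object_mor[OF x] D(1) f])
    also have "\<dots> = (\<integral>\<^sup>+h. f h \<partial>\<theta> n x)"
    proof (rule nn_integral_cong_AE)
      show "AE h in \<theta> n x. lshift x f h = f h"
        using D(3)[of n]
      proof eventually_elim
        case (elim h)
        then have "(x, h) \<in> composable G" "gmult G x h = h"
          using target_mult_left[of h] x
          by (auto simp: composable_iff object_mor source_identity dest: fibreD)
        then show ?case by (simp add: lshift_def)
      qed
    qed
    finally show "(\<integral>\<^sup>+h. f h \<partial>\<alpha> n x) = (\<integral>\<^sup>+h. f h \<partial>\<theta> n x)" .
  qed
  have defect_le: "defect (\<alpha> n) g \<le> tv_dist (translate G g (\<theta> n (source G g))) (\<theta> n (target G g))" if g: "g \<in> mor G" for n g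
    using countably_generated_pair.sup_dist_le_tv_dist[OF defect_pair[OF \<alpha> g]]
    by (simp add: defect_def \<alpha>_object[OF target_object[OF g]]) (simp add: \<alpha>_def)
  have dlim: "(\<lambda>n. \<integral>\<^sup>+g. defect (\<alpha> n) g \<partial>m) \<longlonglongrightarrow> 0"
    if m: "prob_space m" "sets m = sets arr" "absolutely_continuous star m" for m
  proof (rule tendsto_sandwich[OF _ _ tendsto_const lim[OF m]])
    have "space m = mor G" using sets_eq_imp_space_eq[OF m(2)] space_arr by simp
    then show "\<forall>\<^sub>F n in sequentially. (\<integral>\<^sup>+g. defect (\<alpha> n) g \<partial>m) \<le>
        (\<integral>\<^sup>+g. tv_dist (translate G g (\<theta> n (source G g))) (\<theta> n (target G g)) \<partial>m)"
      by (intro always_eventually allI nn_integral_mono defect_le) simp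
  qed simp
  \<comment> \<open>\<open>N m\<close> will be so large that a path of this length avoids all
    kernels of index at least \<open>m\<close> with probability at most
    \<open>(1/2)^m\<close>.\<close>
  have "\<exists>n. (1 - (1/2 :: real) ^ m) ^ n \<le> (1/2) ^ m" for m
  proof -
    have "(\<lambda>n. (1 - (1/2 :: real) ^ m) ^ n) \<longlonglongrightarrow> 0"
      by (rule LIMSEQ_realpow_zero) (simp_all add: power_le_one)
    then have "\<forall>\<^sub>F n in sequentially. (1 - (1/2 :: real) ^ m) ^ n < (1/2) ^ m"
      by (rule order_tendstoD(2)) simp
    then show ?thesis by (auto simp: eventually_sequentially intro: less_imp_le)
  qed
  then obtain N where N: "\<And>m. (1 - (1/2 :: real) ^ m) ^ N m \<le> (1/2) ^ m" by metis
  have "\<exists>f. AE g in star. (\<lambda>m. merge_error (\<lambda>k. \<alpha> (f k)) m (N m) g) \<longlonglongrightarrow> 0"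
  \<comment> \<open>A zero measure has no equivalent probability measure, but then the claim is
    vacuous.\<close>
  proof (cases "emeasure star (space star) = 0")
    case True
    then have "AE g in star. False" by (simp add: AE_iff_null null_sets_def)
    then show ?thesis by (auto elim!: eventually_mono)
  next
    case False
    interpret star: sigma_finite_measure star
      using rokhlin_arrows by (simp add: lebesgue_rokhlin_def)
    obtain m0 where m0: "prob_space m0" "sets m0 = sets star"
      and m0_AE: "\<And>Q. (AE g in m0. Q g) \<longleftrightarrow> (AE g in star. Q g)"
      using star.equivalent_prob_space[OF False] by blast
    have m0s: "sets m0 = sets arr" using m0(2) sets_star by simp
    have m0ac: "absolutely_continuous star m0"
      unfolding absolutely_continuous_def
    proof
      fix A assume A: "A \<in> null_sets star"
      then have "AE g in m0. g \<notin> A" using m0_AE AE_not_in by blast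
      moreover have "A \<in> sets m0" using A m0(2) by auto
      ultimately show "A \<in> null_sets m0" by (simp add: AE_iff_null_sets)
    qed
    \<comment> \<open>Stage \<open>k\<close> faces only the finitely many conditions with
      \<open>m \<le> k\<close>, so a late enough \<open>r\<close> meets them all. A kernel of index
      \<open>k + m\<close> thereby satisfies the condition for \<open>m\<close>.\<close>
    define Q where "Q f k r \<longleftrightarrow> (\<forall>m\<in>{..k}. (\<Sum>j<N m. \<integral>\<^sup>+g. (trunc_step (\<lambda>k. \<alpha> (f k)) m ^^ j) (defect (\<alpha> r)) g \<partial>m0) \<le> 1)"
      for f :: "nat \<Rightarrow> nat" and k r
    have "\<exists>f. \<forall>k. Q f k (f k)"
    \<comment> \<open>\<open>Q f k r\<close> inspects \<open>f\<close> only below \<open>k\<close>,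
      since the truncations at \<open>m \<le> k\<close> use earlier indices alone.\<close>
    proof (rule dependent_wf_choice[OF wf_less_than])
      fix f f' :: "nat \<Rightarrow> nat" and k r
      assume "\<And>z. (z, k) \<in> less_than \<Longrightarrow> f z = f' z"
      then have "trunc_step (\<lambda>k. \<alpha> (f k)) m = trunc_step (\<lambda>k. \<alpha> (f' k)) m" if "m \<le> k" for m
        using that by (intro trunc_step_agree) auto
      then show "Q f k r = Q f' k r" by (simp add: Q_def)
    next
      fix k and f :: "nat \<Rightarrow> nat"
      have "\<forall>\<^sub>F r in sequentially. (\<Sum>j<N m. \<integral>\<^sup>+g. (trunc_step (\<lambda>k. \<alpha> (f k)) m ^^ j) (defect (\<alpha> r)) g \<partial>m0) < 1" for m
      proof (rule order_tendstoD(2))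
        have "(\<lambda>r. \<Sum>j<N m. \<integral>\<^sup>+g. (trunc_step (\<lambda>k. \<alpha> (f k)) m ^^ j) (defect (\<alpha> r)) g \<partial>m0) \<longlonglongrightarrow> (\<Sum>j<N m. 0)"
          by (intro tendsto_sum trunc_step_funpow_tendsto_0 \<alpha> m0 m0s m0ac defect_measurable dlim)
        then show "(\<lambda>r. \<Sum>j<N m. \<integral>\<^sup>+g. (trunc_step (\<lambda>k. \<alpha> (f k)) m ^^ j) (defect (\<alpha> r)) g \<partial>m0) \<longlonglongrightarrow> 0" by simp
      qed simp
      then have "\<forall>\<^sub>F r in sequentially. \<forall>m\<in>{..k}. (\<Sum>j<N m. \<integral>\<^sup>+g. (trunc_step (\<lambda>k. \<alpha> (f k)) m ^^ j) (defect (\<alpha> r)) g \<partial>m0) < 1"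
        by (simp add: eventually_ball_finite)
      then show "\<exists>r. Q f k r" unfolding Q_def eventually_sequentially by (meson less_imp_le order_refl)
    qed
    then obtain f where f: "\<And>k. Q f k (f k)" by blast
    let ?\<kappa> = "\<lambda>k. \<alpha> (f k)"
    have em: "merge_error ?\<kappa> m (N m) \<in> borel_measurable m0" for m
      using merge_error_measurable[of ?\<kappa>, OF \<alpha>] by (simp add: measurable_cong_sets[OF m0s refl])
    have "(\<integral>\<^sup>+g. merge_error ?\<kappa> m (N m) g \<partial>m0) \<le> ennreal (2 * (1/2) ^ m)" for m
    proof (rule nn_integral_merge_error_le[of ?\<kappa>, OF \<alpha> m0(1) m0s N])
      show "(\<Sum>j<N m. \<integral>\<^sup>+g. (trunc_step ?\<kappa> m ^^ j) (defect (?\<kappa> (k + m))) g \<partial>m0) \<le> 1" for k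
        using f[of "k + m"] unfolding Q_def by auto
    qed
    \<comment> \<open>Summable mean errors make the series of errors finite almost everywhere, so
      its terms tend to 0 there.\<close>
    then have "(\<Sum>m. \<integral>\<^sup>+g. merge_error ?\<kappa> m (N m) g \<partial>m0) \<le> (\<Sum>m. ennreal (2 * (1/2) ^ m))"
      by (intro suminf_le summableI)
    also have "\<dots> = ennreal (\<Sum>m. 2 * (1/2) ^ m)"
      by (intro suminf_ennreal2 summable_mult summable_geometric) simp_all
    finally have "(\<integral>\<^sup>+g. (\<Sum>m. merge_error ?\<kappa> m (N m) g) \<partial>m0) \<noteq> \<infinity>"
      using em by (subst nn_integral_suminf) (auto simp: top_unique)
    then have "AE g in m0. (\<Sum>m. merge_error ?\<kappa> m (N m) g) \<noteq> \<infinity>"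
      using em by (intro nn_integral_PInf_AE borel_measurable_suminf_order)
    then have "AE g in m0. (\<lambda>m. merge_error ?\<kappa> m (N m) g) \<longlonglongrightarrow> 0"
      by eventually_elim (rule tendsto_0_of_suminf_ennreal, simp)
    then show ?thesis using m0_AE by blast
  qed
  then obtain f where "AE g in star. (\<lambda>m. merge_error (\<lambda>k. \<alpha> (f k)) m (N m) g) \<longlonglongrightarrow> 0" by blast
  from mixture_tail_trivial[OF \<alpha> this] ac_chain_mixture[of "\<lambda>k. \<alpha> (f k)", OF \<alpha>] show ?thesis by blast
qed

end

theorem theorem44:
  fixes G :: "'g groupoid_structure"
    and lam :: "'g \<Rightarrow> 'g measure"
    and kap :: "'g measure"
  assumes "measured_groupoid G lam kap"
  shows "(amenable G lam kap \<longleftrightarrow>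
            (\<exists>\<pi>. equivariant_chain G \<pi> \<and> abs_cont_transitions G lam \<pi> \<and>
                 fibrewise_tail_trivial G lam kap \<pi>)) \<and>
         (amenable G lam kap \<longleftrightarrow>
            (\<exists>\<pi>. equivariant_chain G \<pi> \<and> abs_cont_transitions G lam \<pi> \<and>
                 fibrewise_liouville G lam kap \<pi>))"
proof -
  interpret measured_groupoid G lam kap by fact
  show ?thesis
    using amenable_imp_tail_trivial liouville_imp_amenable tail_trivial_imp_liouville
    unfolding ac_chain_def by blast
qed

end
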